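(* Let $T$ be a rooted plane tree of depth $n\ge1$ which is not a path. There is a piecewise-linear isomorphism $\Gamma:\mathcal K^{\mathrm{met}}(T)\to\mathcal F(T)$ from the metric $n$-bracketing complex to the velocity fan. Namely, the following map is well defined and a piecewise-linear isomorphism: if $\ell_{\mathcal B}=\sum_{i=0}^k\lambda_i\ell(\mathcal C_i)$ with $\mathcal C_0=\mathcal B_{\min}$, $\mathcal C_1,\dots,\mathcal C_k$ collisions with $\mathcal C_i\le\mathcal B$, $\lambda_0\in\mathbb R$ and $\lambda_i\ge0$ for $i>0$, then $\Gamma(\ell_{\mathcal B})=\sum_{i=0}^k\lambda_i\rho(\mathcal C_i)$.
   Context: **Trees.** A rooted plane tree $T$ is a finite rooted tree with a total order on the set $\mathrm{ch}(u)$ of children of every vertex $u$. $V^k(T)$ is the set of vertices at distance $k$ from the root; the depth of $T$ is the largest $k$ with $V^k(T)\ne\emptyset$. $V^k(T)$ is totally ordered lexicographically (compare the sequences of child-positions along the paths from the root); $u^k_i$ is its $i$-th element. $T$ has depth $n\ge1$ and is not a path. **Brackets.** For $0\le k\le n$ a $k$-bracket of $T$ is $A=(A^0,\dots,A^k)$ with $A^i\subseteq V^i(T)$, $A^k\neq\emptyset$, such that the parent of every $u\in A^i$ ($i\ge 1$) lies in $A^{i-1}$, and for every $u\in A^{i-1}$ the set $A^i\cap\mathrm{ch}(u)$ is a (possibly empty) set of consecutive elements of $\mathrm{ch}(u)$. For $k$-brackets, $A\subseteq A'$ means $A^i\subseteq A'^i$ for all $i$. For $k\ge1$, $\pi(A)=(A^0,\dots,A^{k-1})$.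 The singleton $k$-bracket $A(u)$ of $u\in V^k(T)$ has $A(u)^i=\{\text{the depth-}i\text{ vertex on the path from the root to }u\}$; the maximum $k$-bracket is $(V^0(T),\dots,V^k(T))$. A bracket is nontrivial if it is neither singleton nor maximum. **$n$-bracketings.** An $n$-bracketing $\mathcal B$ of $T$ consists of sets $\mathcal B^k$ of $k$-brackets ($0\le k\le n$) and a strict partial order $<_{\mathcal B}$ on $\bigsqcup_k\mathcal B^k$ such that, writing $\mathcal B_A=\{A'\in\mathcal B^{k}:\pi(A')=A\}$ for $A\in\mathcal B^{k-1}$: (1) $\mathcal B^k$ contains the maximum and all singleton $k$-brackets; (2) $A\in\mathcal B^k$, $k\ge1$, implies $\pi(A)\in\mathcal B^{k-1}$; (3) if $A_1,A_2\in\mathcal B^k$ and $A_1^k\cap A_2^k\ne\emptyset$ then $A_1\subseteq A_2$ or $A_2\subseteq A_1$; (4a) for $A\in\mathcal B^{k-1}$, $1\le k\le n$: $\bigcup_{A'\in\mathcal B_A}A'^k=\bigcup_{u\in A^{k-1}}\mathrm{ch}(u)$; (4b) if $A_1,A_2\in\mathcal B_A$, $A_2\subsetneq A_1$, then every $u'\in A_1^k$ lies in $A_3^k$ for some $A_3\in\mathcal B_A$ with $A_3\subsetneq A_1$; (5a) distinct elements $A_1,A_2\in\mathcal B^k$ are comparable under $<_{\mathcal B}$ iff $\pi(A_1)=\pi(A_2)$ and $A_1^k\cap A_2^k=\emptyset$ (elements of different levels are incomparable); (5b) if $u_1$ precedes $u_2$ in $\mathrm{ch}(u)$ then $A(u_1)<_{\mathcal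 B}A(u_2)$; (5c) if $A,\tilde A\in\mathcal B^{k-1}$, $\tilde A\subseteq A$, $A_1\ne A_2\in\mathcal B_A$ are comparable, $\tilde A_1\ne\tilde A_2\in\mathcal B_{\tilde A}$ are comparable, and $\tilde A_i\subseteq A_i$ for $i=1,2$, then $A_1<_{\mathcal B}A_2\iff\tilde A_1<_{\mathcal B}\tilde A_2$. The categorical $n$-associahedron $\mathcal K(T)$ is the set of $n$-bracketings of $T$ ordered by: $\mathcal B_1\le\mathcal B_2$ iff $\mathcal B_1^k\subseteq\mathcal B_2^k$ for all $k$ and $<_{\mathcal B_1}$ is the restriction of $<_{\mathcal B_2}$. Its minimum $\mathcal B_{\min}$ has only singleton and maximum brackets. **Collisions.** A collision is an atom of $\mathcal K(T)$ (a minimal element of $\mathcal K(T)\setminus\{\mathcal B_{\min}\}$). The fusion bracket of a collision $\mathcal C$ is the (unique) nonsingleton bracket $E_0$ of $\mathcal C$ such that $\pi(E_0)$ is a singleton bracket and $E_0=\pi^{l}(A')$ for some nontrivial $A'$ in $\mathcal C$ and $l\ge0$. A bracket $E$ of $\mathcal C$ is essential if $E=\pi^l(A')$ for some nontrivial $A'$ in $\mathcal C$, $l\ge0$, and $\pi^j(E)=E_0$ for some $j\ge0$. **Contraction.** Let $E_0\in\mathcal C^{k_0}$, $\pi(E_0)=A(w)$, $W=E_0^{k_0}\subseteq\mathrm{ch}(w)$. The rooted plane tree $T/\mathcal C$ is obtained from $T$ by removing $W$ and all its descendants and inserting a depth-$k$ vertex $v_E$ for each essential $E\in\mathcal C^k$: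 $v_{E_0}$ is a child of $w$ taking the place of the consecutive set $W$; the children of $v_E$ are the $v_{E'}$ with $E'$ essential, $\pi(E')=E$, ordered by $<_{\mathcal C}$. The map $\psi:V(T)\to V(T/\mathcal C)$ fixes the remaining vertices and sends a depth-$k$ vertex $v$ in or below $W$ to $v_E$, where $E\in\mathcal C^k$ is the unique essential bracket with $v\in E^k$. **Velocity fan.** Put $t_k=|V^k(T)|-1$, $m=\sum_{k=1}^nt_k$; vectors in $\mathbb R^m$ have coordinates $x^k_i$, $1\le k\le n$, $1\le i\le t_k$. For a collision $\mathcal C$, $\rho(\mathcal C)^k_i=d(\psi(u^k_i))-d(\psi(u^k_{i+1}))+1$, where $d(v)$ is the position of $v$ in the ordered set $V^k(T/\mathcal C)$; $\rho(\mathcal B_{\min})=\mathbf 1$ (all ones). For $\mathcal B\in\mathcal K(T)$, $\tau(\mathcal B)=\{\sum_{\mathcal C\le\mathcal B}\lambda_{\mathcal C}\rho(\mathcal C)+\lambda\mathbf 1:\lambda_{\mathcal C}\ge0,\lambda\in\mathbb R\}$ (sum over collisions $\mathcal C\leq \mathcal B$). $\mathcal F(T)=\{\tau(\mathcal B):\mathcal B\in\mathcal K(T)\}$. **Metric $n$-bracketings.** A metric $n$-bracketing is a pair $(\mathcal B,\ell_{\mathcal B})$ (also written $\ell_{\mathcal B}$) with $\mathcal B\in\mathcal K(T)$ and $\ell_{\mathcal B}$ a real function on the brackets of $T$ such that: $\ell_{\mathcal B}(A)=0$ if $A$ is not in $\mathcal B$; $\ell_{\mathcal B}(A)=0$ if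 $A$ is singleton; $\ell_{\mathcal B}(A)>0$ if $A$ is a nontrivial bracket of $\mathcal B$; and for every nonsingleton $\tilde A\in\mathcal B^k$ and $A,A'\in\mathcal B_{\tilde A}$ with $A$ containment-maximal in $\mathcal{B}_{\tilde A}$, $A'$ containment-minimal in $\mathcal B_{\tilde A}$ and $A'\subseteq A$, one has $\ell_{\mathcal B}(\tilde A)=\sum_{A''\in\mathcal B_{\tilde A},\,A'\subseteq A''\subseteq A}\ell_{\mathcal B}(A'')$. Let $\tau^{\mathrm{met}}(\mathcal B)$ be the set of metric $n$-bracketings $(\mathcal B',\ell_{\mathcal B'})$ with $\mathcal B'\le\mathcal B$; it is an $\mathbb R_{\ge0}$-semimodule via $(\mathcal B_1,\ell_1)+(\mathcal B_2,\ell_2)=(\mathcal B_1\vee\mathcal B_2,\ell_1+\ell_2)$ and $t(\mathcal B',\ell)=(\mathcal B',t\ell)$ for $t>0$, with zero element $(\mathcal B_{\min},0)$. $\mathcal K^{\mathrm{met}}(T)=\{\tau^{\mathrm{met}}(\mathcal B):\mathcal B\in\mathcal K(T)\}$. For a collision $\mathcal C$, $\ell(\mathcal C)$ is the metric $n$-bracketing on $\mathcal C$ equal to $1$ on essential brackets and $0$ otherwise; $\ell(\mathcal B_{\min})$ equals $1$ on nonsingleton maximum brackets and $0$ otherwise (negative multiples of $\ell(\mathcal B_{\min})$ are allowed). A piecewise-linear map between such collections of semimodules/cones is a map between the unions which restricts to an $\mathbb R_{\ge0}$-linear map from each member of the source into some member of the target; it is a piecewise-linear isomorphism if it has a two-sided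 piecewise-linear inverse. *)

theory Defs
  imports Complex_Main
begin

section \<open>Rooted plane trees\<close>

text \<open>
  A finite rooted tree whose children are listed from left to right. The total order on the
  children of \<open>u\<close> is the order of the list \<open>kids T u\<close>; values of \<open>kids T\<close> outside
  \<open>verts T\<close> are irrelevant.
\<close>

record 'a plane_tree =
  verts :: "'a set"
  root_of :: "'a"
  kids :: "'a \<Rightarrow> 'a list"

text \<open>
  \<open>walk T u p\<close> descends from \<open>u\<close>, following the sequence \<open>p\<close> of child positions (counted from 0).
\<close>

fun walk :: "'a plane_tree \<Rightarrow> 'a \<Rightarrow> nat list \<Rightarrow> 'a option" where
  "walk T u [] = Some u"
| "walk T u (i # p) = (if i < length (kids T u) then walk T (kids T u ! i) p else None)"

text \<open>
  The last condition says that there is exactly one descending path from the root to each vertex;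
  in particular the lists of children have no repetitions.
\<close>

definition rooted_plane_tree :: "'a plane_tree \<Rightarrow> bool" where
  "rooted_plane_tree T \<longleftrightarrow>
     finite (verts T) \<and> root_of T \<in> verts T \<and>
     (\<forall>u\<in>verts T. set (kids T u) \<subseteq> verts T) \<and>
     (\<forall>v\<in>verts T. \<exists>!p. walk T (root_of T) p = Some v)"

definition address :: "'a plane_tree \<Rightarrow> 'a \<Rightarrow> nat list" where
  "address T v = (THE p. walk T (root_of T) p = Some v)"

definition level :: "'a plane_tree \<Rightarrow> nat \<Rightarrow> 'a set" where
  "level T k = {v \<in> verts T. length (address T v) = k}"

definition tree_depth :: "'a plane_tree \<Rightarrow> nat" where
  "tree_depth T = Max {k. level T k \<noteq> {}}"

text \<open>A path is understood as a path starting at the root.\<close>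

definition is_path_tree :: "'a plane_tree \<Rightarrow> bool" where
  "is_path_tree T \<longleftrightarrow> (\<forall>u\<in>verts T. length (kids T u) \<le> 1)"

definition parent :: "'a plane_tree \<Rightarrow> 'a \<Rightarrow> 'a" where
  "parent T v = (THE u. u \<in> verts T \<and> v \<in> set (kids T u))"

definition ancestor_at :: "'a plane_tree \<Rightarrow> 'a \<Rightarrow> nat \<Rightarrow> 'a" where
  "ancestor_at T u i = the (walk T (root_of T) (take i (address T u)))"

definition in_or_below :: "'a plane_tree \<Rightarrow> 'a set \<Rightarrow> 'a set" where
  "in_or_below T W = {v \<in> verts T. \<exists>u\<in>W. \<exists>p. walk T u p = Some v}"

definition precedes :: "'a list \<Rightarrow> 'a \<Rightarrow> 'a \<Rightarrow> bool" where
  "precedes xs u v \<longleftrightarrow> (\<exists>i j. i < j \<and> j < length xs \<and> xs ! i = u \<and> xs ! j = v)"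

definition lex_less :: "'a plane_tree \<Rightarrow> 'a \<Rightarrow> 'a \<Rightarrow> bool" where
  "lex_less T u v \<longleftrightarrow> (address T u, address T v) \<in> lexord {(i, j). i < j}"

text \<open>The position, counted from 1, of a vertex within its level.\<close>

definition pos :: "'a plane_tree \<Rightarrow> 'a \<Rightarrow> nat" where
  "pos T v = card {u \<in> level T (length (address T v)). u = v \<or> lex_less T u v}"

definition nth_vertex :: "'a plane_tree \<Rightarrow> nat \<Rightarrow> nat \<Rightarrow> 'a" where
  "nth_vertex T k i = (THE u. u \<in> level T k \<and> pos T u = i)"


section \<open>Brackets\<close>

text \<open>
  A \<open>k\<close>-bracket \<open>(A\<^sup>0, \<dots>, A\<^sup>k)\<close> is a list of length \<open>k + 1\<close>, so \<open>A\<^sup>i\<close> is \<open>A ! i\<close>, the level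
  \<open>k\<close> can be recovered from the bracket, and \<open>\<pi>\<close> is \<^const>\<open>butlast\<close>.
\<close>

type_synonym 'a bracket = "'a set list"

definition is_bracket :: "'a plane_tree \<Rightarrow> nat \<Rightarrow> 'a bracket \<Rightarrow> bool" where
  "is_bracket T k A \<longleftrightarrow>
     k \<le> tree_depth T \<and> length A = Suc k \<and>
     (\<forall>i\<le>k. A ! i \<subseteq> level T i) \<and> A ! k \<noteq> {} \<and>
     (\<forall>i\<in>{1..k}. \<forall>u\<in>A ! i. parent T u \<in> A ! (i - 1)) \<and>
     (\<forall>i\<in>{1..k}. \<forall>u\<in>A ! (i - 1).
        \<exists>xs ys zs. kids T u = xs @ ys @ zs \<and> A ! i \<inter> set (kids T u) = set ys)"

abbreviation proj :: "'a bracket \<Rightarrow> 'a bracket" where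
  "proj \<equiv> butlast"

definition bracket_sub :: "'a bracket \<Rightarrow> 'a bracket \<Rightarrow> bool" (infix "\<sqsubseteq>\<^sub>b" 50) where
  "A \<sqsubseteq>\<^sub>b A' \<longleftrightarrow> list_all2 (\<subseteq>) A A'"

definition bracket_psub :: "'a bracket \<Rightarrow> 'a bracket \<Rightarrow> bool" (infix "\<sqsubset>\<^sub>b" 50) where
  "A \<sqsubset>\<^sub>b A' \<longleftrightarrow> A \<sqsubseteq>\<^sub>b A' \<and> A \<noteq> A'"

definition singleton_bracket :: "'a plane_tree \<Rightarrow> 'a \<Rightarrow> 'a bracket" where
  "singleton_bracket T u = map (\<lambda>i. {ancestor_at T u i}) [0..<Suc (length (address T u))]"

definition max_bracket :: "'a plane_tree \<Rightarrow> nat \<Rightarrow> 'a bracket" where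
  "max_bracket T k = map (level T) [0..<Suc k]"

definition is_singleton_bracket :: "'a plane_tree \<Rightarrow> 'a bracket \<Rightarrow> bool" where
  "is_singleton_bracket T A \<longleftrightarrow> (\<exists>u\<in>verts T. A = singleton_bracket T u)"

definition is_max_bracket :: "'a plane_tree \<Rightarrow> 'a bracket \<Rightarrow> bool" where
  "is_max_bracket T A \<longleftrightarrow> (\<exists>k\<le>tree_depth T. A = max_bracket T k)"

definition nontrivial :: "'a plane_tree \<Rightarrow> 'a bracket \<Rightarrow> bool" where
  "nontrivial T A \<longleftrightarrow> \<not> is_singleton_bracket T A \<and> \<not> is_max_bracket T A"


section \<open>Bracketings and the categorical associahedron\<close>

text \<open>
  \<open>brk B k\<close> is the set \<open>\<B>\<^sup>k\<close> and \<open>prec B\<close> the strict partial order. Brackets of different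
  levels are lists of different lengths, so the union over all levels is disjoint. Both
  fields carry no data beyond the mathematical object (see \<open>is_bracketing\<close>), so equality of
  records is equality of bracketings.
\<close>

record 'a bracketing =
  brk :: "nat \<Rightarrow> 'a bracket set"
  prec :: "('a bracket \<times> 'a bracket) set"

definition all_brk :: "'a bracketing \<Rightarrow> 'a bracket set" where
  "all_brk B = (\<Union>k. brk B k)"

text \<open>\<open>\<B>\<^sub>A\<close>: if \<open>A\<close> has level \<open>k - 1\<close>, then \<open>length A = k\<close>.\<close>

definition over :: "'a bracketing \<Rightarrow> 'a bracket \<Rightarrow> 'a bracket set" where
  "over B A = {A' \<in> brk B (length A). proj A' = A}"

definition comparable :: "'a bracketing \<Rightarrow> 'a bracket \<Rightarrow> 'a bracket \<Rightarrow> bool" where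
  "comparable B A1 A2 \<longleftrightarrow> (A1, A2) \<in> prec B \<or> (A2, A1) \<in> prec B"

text \<open>
  The first conjunct includes \<open>brk B k = {}\<close> for \<open>k > tree_depth T\<close>. The further conjuncts are,
  in order, the strict partial order and the axioms 1, 2, 3, 4a, 4b, 5a, 5b, 5c.
\<close>

definition is_bracketing :: "'a plane_tree \<Rightarrow> 'a bracketing \<Rightarrow> bool" where
  "is_bracketing T B \<longleftrightarrow>
     (\<forall>k. \<forall>A\<in>brk B k. is_bracket T k A) \<and>
     prec B \<subseteq> all_brk B \<times> all_brk B \<and> irrefl (prec B) \<and> trans (prec B) \<and>
     (\<forall>k\<le>tree_depth T. max_bracket T k \<in> brk B k \<and>
        (\<forall>u\<in>level T k. singleton_bracket T u \<in> brk B k)) \<and>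
     (\<forall>k\<ge>1. \<forall>A\<in>brk B k. proj A \<in> brk B (k - 1)) \<and>
     (\<forall>k. \<forall>A1\<in>brk B k. \<forall>A2\<in>brk B k. A1 ! k \<inter> A2 ! k \<noteq> {} \<longrightarrow> A1 \<sqsubseteq>\<^sub>b A2 \<or> A2 \<sqsubseteq>\<^sub>b A1) \<and>
     (\<forall>k\<in>{1..tree_depth T}. \<forall>A\<in>brk B (k - 1).
        (\<Union>A'\<in>over B A. A' ! k) = (\<Union>u\<in>A ! (k - 1). set (kids T u))) \<and>
     (\<forall>k\<in>{1..tree_depth T}. \<forall>A\<in>brk B (k - 1). \<forall>A1\<in>over B A. \<forall>A2\<in>over B A.
        A2 \<sqsubset>\<^sub>b A1 \<longrightarrow> (\<forall>u'\<in>A1 ! k. \<exists>A3\<in>over B A. u' \<in> A3 ! k \<and> A3 \<sqsubset>\<^sub>b A1)) \<and>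
     (\<forall>A1\<in>all_brk B. \<forall>A2\<in>all_brk B. A1 \<noteq> A2 \<longrightarrow>
        (comparable B A1 A2 \<longleftrightarrow>
           (\<exists>k. A1 \<in> brk B k \<and> A2 \<in> brk B k \<and> proj A1 = proj A2 \<and> A1 ! k \<inter> A2 ! k = {}))) \<and>
     (\<forall>u\<in>verts T. \<forall>u1 u2. precedes (kids T u) u1 u2 \<longrightarrow>
        (singleton_bracket T u1, singleton_bracket T u2) \<in> prec B) \<and>
     (\<forall>k\<in>{1..tree_depth T}. \<forall>A\<in>brk B (k - 1). \<forall>A'\<in>brk B (k - 1). A' \<sqsubseteq>\<^sub>b A \<longrightarrow>
        (\<forall>A1\<in>over B A. \<forall>A2\<in>over B A. \<forall>A1'\<in>over B A'. \<forall>A2'\<in>over B A'.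
           A1 \<noteq> A2 \<and> comparable B A1 A2 \<and> A1' \<noteq> A2' \<and> comparable B A1' A2' \<and>
           A1' \<sqsubseteq>\<^sub>b A1 \<and> A2' \<sqsubseteq>\<^sub>b A2 \<longrightarrow>
           ((A1, A2) \<in> prec B \<longleftrightarrow> (A1', A2') \<in> prec B)))"

definition bracketings :: "'a plane_tree \<Rightarrow> 'a bracketing set" where
  "bracketings T = {B. is_bracketing T B}"

definition bracketing_le :: "'a bracketing \<Rightarrow> 'a bracketing \<Rightarrow> bool" (infix "\<preceq>\<^sub>K" 50) where
  "B1 \<preceq>\<^sub>K B2 \<longleftrightarrow> (\<forall>k. brk B1 k \<subseteq> brk B2 k) \<and> prec B1 = prec B2 \<inter> (all_brk B1 \<times> all_brk B1)"

definition min_bracketing :: "'a plane_tree \<Rightarrow> 'a bracketing" where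
  "min_bracketing T = (THE B. B \<in> bracketings T \<and> (\<forall>B'\<in>bracketings T. B \<preceq>\<^sub>K B'))"

definition join :: "'a plane_tree \<Rightarrow> 'a bracketing \<Rightarrow> 'a bracketing \<Rightarrow> 'a bracketing" where
  "join T B1 B2 =
     (THE J. J \<in> bracketings T \<and> B1 \<preceq>\<^sub>K J \<and> B2 \<preceq>\<^sub>K J \<and>
        (\<forall>J'\<in>bracketings T. B1 \<preceq>\<^sub>K J' \<and> B2 \<preceq>\<^sub>K J' \<longrightarrow> J \<preceq>\<^sub>K J'))"


section \<open>Collisions and contraction\<close>

definition collisions :: "'a plane_tree \<Rightarrow> 'a bracketing set" where
  "collisions T = {C \<in> bracketings T. C \<noteq> min_bracketing T \<and>
     (\<forall>B\<in>bracketings T. B \<noteq> min_bracketing T \<and> B \<preceq>\<^sub>K C \<longrightarrow> B = C)}"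

definition under_nontrivial :: "'a plane_tree \<Rightarrow> 'a bracketing \<Rightarrow> 'a bracket \<Rightarrow> bool" where
  "under_nontrivial T C E \<longleftrightarrow> (\<exists>A'\<in>all_brk C. nontrivial T A' \<and> (\<exists>l. E = (proj ^^ l) A'))"

definition fusion_bracket :: "'a plane_tree \<Rightarrow> 'a bracketing \<Rightarrow> 'a bracket" where
  "fusion_bracket T C =
     (THE E. E \<in> all_brk C \<and> \<not> is_singleton_bracket T E \<and>
        is_singleton_bracket T (proj E) \<and> under_nontrivial T C E)"

definition essential :: "'a plane_tree \<Rightarrow> 'a bracketing \<Rightarrow> 'a bracket set" where
  "essential T C = {E \<in> all_brk C. under_nontrivial T C E \<and>
     (\<exists>j. (proj ^^ j) E = fusion_bracket T C)}"

text \<open>\<open>W\<close> and its parent \<open>w\<close>, whose singleton bracket is the projection of the fusion bracket.\<close>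

definition fused_set :: "'a plane_tree \<Rightarrow> 'a bracketing \<Rightarrow> 'a set" where
  "fused_set T C = last (fusion_bracket T C)"

definition fused_parent :: "'a plane_tree \<Rightarrow> 'a bracketing \<Rightarrow> 'a" where
  "fused_parent T C =
     (THE w. w \<in> verts T \<and> proj (fusion_bracket T C) = singleton_bracket T w)"

text \<open>
  The contracted tree: \<open>Inl v\<close> are the vertices that remain, \<open>Inr E\<close> is the new vertex for the
  essential bracket \<open>E\<close>.
\<close>

definition contract :: "'a plane_tree \<Rightarrow> 'a bracketing \<Rightarrow> ('a + 'a bracket) plane_tree" where
  "contract T C = \<lparr>
     verts = Inl ` (verts T - in_or_below T (fused_set T C)) \<union> Inr ` essential T C,
     root_of = Inl (root_of T),
     kids = (\<lambda>x. case x of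
         Inl u \<Rightarrow>
           if u = fused_parent T C
           then map Inl (takeWhile (\<lambda>v. v \<notin> fused_set T C) (kids T u)) @
                [Inr (fusion_bracket T C)] @
                map Inl (dropWhile (\<lambda>v. v \<in> fused_set T C)
                          (dropWhile (\<lambda>v. v \<notin> fused_set T C) (kids T u)))
           else map Inl (kids T u)
       | Inr E \<Rightarrow>
           map Inr (THE Es. distinct Es \<and> set Es = {E' \<in> essential T C. proj E' = E} \<and>
                      sorted_wrt (\<lambda>E1 E2. (E1, E2) \<in> prec C) Es)) \<rparr>"

definition contract_map :: "'a plane_tree \<Rightarrow> 'a bracketing \<Rightarrow> 'a \<Rightarrow> 'a + 'a bracket" where
  "contract_map T C v =
     (if v \<in> in_or_below T (fused_set T C)
      then Inr (THE E. E \<in> essential T C \<and> E \<in> brk C (length (address T v)) \<and>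
                  v \<in> E ! length (address T v))
      else Inl v)"


section \<open>The velocity fan\<close>

text \<open>
  A vector of \<open>\<real>\<^sup>m\<close> with coordinates \<open>x\<^sup>k\<^sub>i\<close> is a function \<open>x\<close> with \<open>x k i = 0\<close> for
  \<open>(k, i)\<close> outside the index set \<open>coords T\<close>.
\<close>

type_synonym vec = "nat \<Rightarrow> nat \<Rightarrow> real"

definition coords :: "'a plane_tree \<Rightarrow> (nat \<times> nat) set" where
  "coords T = {(k, i). 1 \<le> k \<and> k \<le> tree_depth T \<and> 1 \<le> i \<and> i \<le> card (level T k) - 1}"

definition ones :: "'a plane_tree \<Rightarrow> vec" where
  "ones T k i = (if (k, i) \<in> coords T then 1 else 0)"

definition rho :: "'a plane_tree \<Rightarrow> 'a bracketing \<Rightarrow> vec" where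
  "rho T C =
     (if C = min_bracketing T then ones T
      else (\<lambda>k i.
        if (k, i) \<in> coords T
        then real (pos (contract T C) (contract_map T C (nth_vertex T k i)))
             - real (pos (contract T C) (contract_map T C (nth_vertex T k (i + 1)))) + 1
        else 0))"

definition tau :: "'a plane_tree \<Rightarrow> 'a bracketing \<Rightarrow> vec set" where
  "tau T B =
     {(\<lambda>k i. (\<Sum>C | C \<in> collisions T \<and> C \<preceq>\<^sub>K B. lam C * rho T C k i) + c * ones T k i) | lam c.
        \<forall>C. C \<in> collisions T \<and> C \<preceq>\<^sub>K B \<longrightarrow> 0 \<le> lam C}"

definition velocity_fan :: "'a plane_tree \<Rightarrow> vec set set" where
  "velocity_fan T = tau T ` bracketings T"


section \<open>Metric bracketings\<close>

text \<open>
  A function on the brackets of \<open>T\<close> is a function on all lists of sets which vanishes outside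
  of the bracketing, hence at all lists that are not brackets.
\<close>

type_synonym 'a metric_bracketing = "'a bracketing \<times> ('a bracket \<Rightarrow> real)"

definition is_metric :: "'a plane_tree \<Rightarrow> 'a metric_bracketing \<Rightarrow> bool" where
  "is_metric T M \<longleftrightarrow> (case M of (B, ell) \<Rightarrow>
     B \<in> bracketings T \<and>
     (\<forall>A. A \<notin> all_brk B \<longrightarrow> ell A = 0) \<and>
     (\<forall>A. is_singleton_bracket T A \<longrightarrow> ell A = 0) \<and>
     (\<forall>A\<in>all_brk B. nontrivial T A \<longrightarrow> 0 < ell A) \<and>
     (\<forall>At\<in>all_brk B. \<not> is_singleton_bracket T At \<longrightarrow>
        (\<forall>A\<in>over B At. \<forall>A'\<in>over B At.
           (\<forall>X\<in>over B At. \<not> A \<sqsubset>\<^sub>b X) \<and> (\<forall>X\<in>over B At. \<not> X \<sqsubset>\<^sub>b A') \<and> A' \<sqsubseteq>\<^sub>b A \<longrightarrow>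
           ell At = (\<Sum>X | X \<in> over B At \<and> A' \<sqsubseteq>\<^sub>b X \<and> X \<sqsubseteq>\<^sub>b A. ell X))))"

definition tau_met :: "'a plane_tree \<Rightarrow> 'a bracketing \<Rightarrow> 'a metric_bracketing set" where
  "tau_met T B = {M. is_metric T M \<and> fst M \<preceq>\<^sub>K B}"

definition metric_complex :: "'a plane_tree \<Rightarrow> 'a metric_bracketing set set" where
  "metric_complex T = tau_met T ` bracketings T"

definition met_add ::
    "'a plane_tree \<Rightarrow> 'a metric_bracketing \<Rightarrow> 'a metric_bracketing \<Rightarrow> 'a metric_bracketing" where
  "met_add T M N = (join T (fst M) (fst N), \<lambda>A. snd M A + snd N A)"

text \<open>
  Scaling by \<open>t = 0\<close> gives the zero element. Negative \<open>t\<close> is only ever used for multiples of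
  \<open>ell T (min_bracketing T)\<close>.
\<close>

definition met_scale :: "'a plane_tree \<Rightarrow> real \<Rightarrow> 'a metric_bracketing \<Rightarrow> 'a metric_bracketing" where
  "met_scale T t M =
     (if t = 0 then (min_bracketing T, \<lambda>A. 0) else (fst M, \<lambda>A. t * snd M A))"

definition ell :: "'a plane_tree \<Rightarrow> 'a bracketing \<Rightarrow> 'a metric_bracketing" where
  "ell T C =
     (C, \<lambda>A. if C = min_bracketing T
             then (if is_max_bracket T A \<and> \<not> is_singleton_bracket T A then 1 else 0)
             else (if A \<in> essential T C then 1 else 0))"

fun met_sum :: "'a plane_tree \<Rightarrow> (nat \<Rightarrow> 'a metric_bracketing) \<Rightarrow> nat \<Rightarrow> 'a metric_bracketing" where
  "met_sum T f 0 = f 0"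
| "met_sum T f (Suc k) = met_add T (met_sum T f k) (f (Suc k))"

definition is_decomposition ::
    "'a plane_tree \<Rightarrow> 'a metric_bracketing \<Rightarrow> nat \<Rightarrow> (nat \<Rightarrow> real) \<Rightarrow> (nat \<Rightarrow> 'a bracketing) \<Rightarrow> bool"
  where
  "is_decomposition T M k lam C \<longleftrightarrow>
     C 0 = min_bracketing T \<and>
     (\<forall>i\<in>{1..k}. C i \<in> collisions T \<and> C i \<preceq>\<^sub>K fst M \<and> 0 \<le> lam i) \<and>
     M = met_sum T (\<lambda>i. met_scale T (lam i) (ell T (C i))) k"


section \<open>Piecewise-linear maps\<close>

record 'x semimodule_ops =
  sadd :: "'x \<Rightarrow> 'x \<Rightarrow> 'x"
  sscale :: "real \<Rightarrow> 'x \<Rightarrow> 'x"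

text \<open>Linearity on \<open>S\<close> over the nonnegative reals; preservation of zero is the case \<open>t = 0\<close>.\<close>

definition semilinear_on ::
    "'x semimodule_ops \<Rightarrow> 'y semimodule_ops \<Rightarrow> 'x set \<Rightarrow> ('x \<Rightarrow> 'y) \<Rightarrow> bool" where
  "semilinear_on X Y S f \<longleftrightarrow>
     (\<forall>x\<in>S. \<forall>y\<in>S. f (sadd X x y) = sadd Y (f x) (f y)) \<and>
     (\<forall>x\<in>S. \<forall>t\<ge>0. f (sscale X t x) = sscale Y t (f x))"

definition pl_map ::
    "'x semimodule_ops \<Rightarrow> 'x set set \<Rightarrow> 'y semimodule_ops \<Rightarrow> 'y set set \<Rightarrow> ('x \<Rightarrow> 'y) \<Rightarrow> bool" where
  "pl_map X SS Y TT f \<longleftrightarrow> (\<forall>S\<in>SS. \<exists>S'\<in>TT. f ` S \<subseteq> S' \<and> semilinear_on X Y S f)"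

definition pl_iso ::
    "'x semimodule_ops \<Rightarrow> 'x set set \<Rightarrow> 'y semimodule_ops \<Rightarrow> 'y set set \<Rightarrow> ('x \<Rightarrow> 'y) \<Rightarrow> bool" where
  "pl_iso X SS Y TT f \<longleftrightarrow> pl_map X SS Y TT f \<and>
     (\<exists>g. pl_map Y TT X SS g \<and> (\<forall>x\<in>\<Union>SS. g (f x) = x) \<and> (\<forall>y\<in>\<Union>TT. f (g y) = y))"

definition met_ops :: "'a plane_tree \<Rightarrow> 'a metric_bracketing semimodule_ops" where
  "met_ops T = \<lparr> sadd = met_add T, sscale = met_scale T \<rparr>"

definition vec_ops :: "vec semimodule_ops" where
  "vec_ops = \<lparr> sadd = (\<lambda>x y k i. x k i + y k i), sscale = (\<lambda>t x k i. t * x k i) \<rparr>"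

end

theory Submission
  imports Defs
begin

text \<open>
  A metric bracketing below \<open>B\<close> is a function on the brackets of \<open>B\<close>, nonnegative on the nontrivial
  ones, that is conserved along the maximal chains above every bracket; its bracketing is recovered
  from its support. Collisions are the indicator functions of slices, and subtracting slices one after
  the other decomposes every such function.

  Whether a bracket \<open>Y\<close> lies to the left of a vertex \<open>v\<close> does not depend on the contraction in which
  \<open>Y\<close> is a vertex. Hence the position of the image of \<open>v\<close> in \<open>T/C\<close> is a linear function of the
  essential brackets of \<open>C\<close>, and its linear extension is a formula for \<open>\<Gamma>\<close> that makes sense on every
  cone.

  For injectivity, the bracketing and its weights are recovered level by level and, within a level, one
  bracket \<open>A\<close> at a time: after the known contributions are removed, the differences of positions of
  two children of \<open>A\<close> tell by their sign how these are ordered, and by their size, for neighbours, how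
  long they remain in a common bracket; an ultrametric is determined by such data.
\<close>

section \<open>Rooted plane trees\<close>

text \<open>A position in \<open>T/C\<close> counts every vertex to the left, including those that
  were not contracted, so singleton brackets need weights as well. \<open>wt\<close> provides them
  through one constant c, which changes the differences of neighbours in a level only by c: the
  value 0 makes \<open>Gam\<close> linear, the value 1 reproduces positions in contracted trees, a
  large value makes all weights positive.

  The inverse must be defined on the whole fan, so injectivity is needed on the union of all cones,
  and the two bracketings to be compared need not have a common upper bound. The obstacle is that
  brackets above some Q strictly containing A also move the children of A apart, while such a Q is
  treated only after A. Its contribution never has the wrong sign, and it vanishes for two children
  that share a bracket above A. So signs still give the order. Sizes are exact for neighbours that
  share a bracket; for other separated pairs they are only bounds, which is why closeness is
  recovered through chains of neighbours.\<close>

locale rpt =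
  fixes T :: "'a plane_tree"
  assumes rpt: "rooted_plane_tree T"
begin

abbreviation "V \<equiv> verts T"
abbreviation "ch \<equiv> kids T"
abbreviation "rt \<equiv> root_of T"
abbreviation "lev \<equiv> level T"
abbreviation "dep v \<equiv> length (address T v)"
abbreviation "anc \<equiv> ancestor_at T"

lemma finite_V [simp]: "finite V"
  and rt_in [simp]: "rt \<in> V"
  and ch_V: "u \<in> V \<Longrightarrow> set (ch u) \<subseteq> V"
  and ex1_walk: "v \<in> V \<Longrightarrow> \<exists>!p. walk T rt p = Some v"
  using rpt unfolding rooted_plane_tree_def by auto

lemma nth_ch_V: "u \<in> V \<Longrightarrow> i < length (ch u) \<Longrightarrow> ch u ! i \<in> V"
  using ch_V nth_mem by blast

end

section \<open>Walks, and the order of entries in a list\<close>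

lemma walk_append: "walk T u (p @ q) = Option.bind (walk T u p) (\<lambda>x. walk T x q)"
  by (induction p arbitrary: u) auto

lemma precedes_total:
  "x \<in> set xs \<Longrightarrow> y \<in> set xs \<Longrightarrow> x \<noteq> y \<Longrightarrow> precedes xs x y \<or> precedes xs y x"
  unfolding precedes_def in_set_conv_nth by (metis nat_neq_iff)

lemma precedes_asym: "distinct xs \<Longrightarrow> precedes xs x y \<Longrightarrow> \<not> precedes xs y x"
  unfolding precedes_def by (metis less_asym less_trans nth_eq_iff_index_eq)

lemma precedes_in: "precedes xs x y \<Longrightarrow> x \<in> set xs \<and> y \<in> set xs"
  unfolding precedes_def by (metis less_trans nth_mem)

lemma precedes_nth:
  assumes "distinct xs" "i < length xs" "j < length xs"
  shows "precedes xs (xs ! i) (xs ! j) \<longleftrightarrow> i < j"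
  using assms unfolding precedes_def by (metis less_trans nth_eq_iff_index_eq)

lemma precedes_append:
  "precedes (xs @ ys) x y \<longleftrightarrow>
     precedes xs x y \<or> precedes ys x y \<or> x \<in> set xs \<and> y \<in> set ys" (is "?l \<longleftrightarrow> ?r")
proof
  assume ?l
  then obtain i j where ij: "i < j" "j < length (xs @ ys)" "(xs @ ys) ! i = x" "(xs @ ys) ! j = y"
    unfolding precedes_def by auto
  show ?r
  proof (cases "j < length xs")
    case True
    then have "precedes xs x y" using ij unfolding precedes_def by (auto simp: nth_append)
    then show ?thesis by simp
  next
    case jF: False
    show ?thesis
    proof (cases "i < length xs")
      case True
      with jF ij show ?thesis by (auto simp: nth_append intro!: nth_mem)
    next
      case False
      have "i - length xs < j - length xs" "j - length xs < length ys"
        using False jF ij by auto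
      moreover have "ys ! (i - length xs) = x" "ys ! (j - length xs) = y"
        using False jF ij by (auto simp: nth_append)
      ultimately have "precedes ys x y" unfolding precedes_def by blast
      then show ?thesis by simp
    qed
  qed
next
  assume ?r
  then consider "precedes xs x y" | "precedes ys x y" | "x \<in> set xs" "y \<in> set ys" by blast
  then show ?l
  proof cases
    case 1
    then obtain i j where "i < j" "j < length xs" "xs ! i = x" "xs ! j = y"
      unfolding precedes_def by auto
    then show ?thesis unfolding precedes_def
      by (intro exI[of _ i] exI[of _ j]) (auto simp: nth_append)
  next
    case 2
    then obtain i j where "i < j" "j < length ys" "ys ! i = x" "ys ! j = y"
      unfolding precedes_def by auto
    then show ?thesis unfolding precedes_def
      by (intro exI[of _ "length xs + i"] exI[of _ "length xs + j"]) auto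
  next
    case 3
    then obtain i j where "i < length xs" "j < length ys" "xs ! i = x" "ys ! j = y"
      unfolding in_set_conv_nth by auto
    then show ?thesis unfolding precedes_def
      by (intro exI[of _ i] exI[of _ "length xs + j"]) (auto simp: nth_append)
  qed
qed

text \<open>In a contracted tree parents are easy to describe and walks are not. The height
  \<open>h\<close> drops towards the parent, so climbing reaches the root, which gives a walk;
  unique parents and repetition-free lists determine its last step, which gives uniqueness.\<close>

lemma rooted_plane_treeI:
  assumes fin: "finite (verts S)" and r: "root_of S \<in> verts S"
    and cl: "\<And>u. u \<in> verts S \<Longrightarrow> set (kids S u) \<subseteq> verts S"
    and dist: "\<And>u. u \<in> verts S \<Longrightarrow> distinct (kids S u)"
    and rk: "\<And>u. u \<in> verts S \<Longrightarrow> root_of S \<notin> set (kids S u)"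
    and up: "\<And>u u' x. u \<in> verts S \<Longrightarrow> u' \<in> verts S \<Longrightarrow> x \<in> set (kids S u) \<Longrightarrow>
               x \<in> set (kids S u') \<Longrightarrow> u = u'"
    and ex: "\<And>v. v \<in> verts S \<Longrightarrow> v \<noteq> root_of S \<Longrightarrow>
               \<exists>u\<in>verts S. v \<in> set (kids S u) \<and> (h u :: nat) < h v"
  shows "rooted_plane_tree S"
proof -
  let ?r = "root_of S"
  have wv: "v \<in> verts S" if "u \<in> verts S" "walk S u p = Some v" for u p v
    using that
  proof (induction p arbitrary: u)
    case (Cons i p)
    then have "i < length (kids S u)" "walk S (kids S u ! i) p = Some v" by (auto split: if_splits)
    moreover from this have "kids S u ! i \<in> verts S" using cl[OF Cons.prems(1)] nth_mem by blast
    ultimately show ?case using Cons.IH by blast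
  qed auto
  have exw: "\<exists>p. walk S ?r p = Some v" if "v \<in> verts S" for v
    using that
  proof (induction "h v" arbitrary: v rule: less_induct)
    case less
    show ?case
    proof (cases "v = ?r")
      case True
      then have "walk S ?r [] = Some v" by simp
      then show ?thesis by blast
    next
      case False
      then obtain u where u: "u \<in> verts S" "v \<in> set (kids S u)" "h u < h v"
        using ex less.prems by blast
      then obtain p where p: "walk S ?r p = Some u" using less.hyps by blast
      obtain i where "i < length (kids S u)" "kids S u ! i = v"
        using u(2) unfolding in_set_conv_nth by blast
      then have "walk S ?r (p @ [i]) = Some v" using p by (simp add: walk_append)
      then show ?thesis by blast
    qed
  qed
  have lastw: "\<exists>u\<in>verts S. walk S ?r p = Some u \<and> i < length (kids S u) \<and> v = kids S u ! i"
    if "walk S ?r (p @ [i]) = Some v" for p i v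
    using that wv[OF r] by (cases "walk S ?r p") (auto simp: walk_append split: if_splits)
  have uniq: "p = q" if "walk S ?r p = Some v" "walk S ?r q = Some v" for p q v
    using that
  proof (induction p arbitrary: q v rule: rev_induct)
    case Nil
    show ?case
    proof (cases q rule: rev_cases)
      case (snoc q' j)
      then show ?thesis using Nil lastw[of q' j v] rk by (metis nth_mem option.inject walk.simps(1))
    qed simp
  next
    case (snoc i p)
    obtain u where u: "u \<in> verts S" "walk S ?r p = Some u" "i < length (kids S u)" "v = kids S u ! i"
      using lastw snoc.prems(1) by blast
    show ?case
    proof (cases q rule: rev_cases)
      case Nil
      then show ?thesis using snoc.prems(2) u rk by (metis nth_mem option.inject walk.simps(1))
    next
      case q: (snoc q' j)
      obtain u' where u': "u' \<in> verts S" "walk S ?r q' = Some u'" "j < length (kids S u')"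
        "v = kids S u' ! j"
        using lastw snoc.prems(2) q by blast
      have "u' = u" using up u u' by (metis nth_mem)
      then show ?thesis using snoc.IH u u' q dist by (metis nth_eq_iff_index_eq)
    qed
  qed
  show ?thesis unfolding rooted_plane_tree_def
    using fin r cl exw uniq by (metis)
qed

section \<open>Addresses, ancestors, levels and positions\<close>

context rpt
begin

lemma walk_V: "u \<in> V \<Longrightarrow> walk T u p = Some v \<Longrightarrow> v \<in> V"
proof (induction p arbitrary: u)
  case (Cons i p)
  then show ?case using nth_ch_V by (auto split: if_splits)
qed auto

lemma walk_address: "v \<in> V \<Longrightarrow> walk T rt (address T v) = Some v"
  unfolding address_def by (rule theI'[OF ex1_walk])

lemma address_eq: "walk T rt p = Some v \<Longrightarrow> address T v = p"
  using ex1_walk[of v] walk_V[OF rt_in] walk_address by blast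

lemma address_inj: "u \<in> V \<Longrightarrow> v \<in> V \<Longrightarrow> address T u = address T v \<Longrightarrow> u = v"
  using walk_address by (metis option.inject)

lemma address_rt [simp]: "address T rt = []"
  by (rule address_eq) simp

lemma address_nth_ch: "u \<in> V \<Longrightarrow> i < length (ch u) \<Longrightarrow> address T (ch u ! i) = address T u @ [i]"
  by (rule address_eq) (simp add: walk_append walk_address)

lemma distinct_ch: "u \<in> V \<Longrightarrow> distinct (ch u)"
  unfolding distinct_conv_nth using address_nth_ch by (metis last_snoc)

lemma dep_ch: "u \<in> V \<Longrightarrow> v \<in> set (ch u) \<Longrightarrow> dep v = Suc (dep u)"
  unfolding in_set_conv_nth using address_nth_ch by fastforce

lemma ch_in: "u \<in> V \<Longrightarrow> v \<in> set (ch u) \<Longrightarrow> v \<in> V"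
  using ch_V by blast

lemma ch_unique: "u \<in> V \<Longrightarrow> u' \<in> V \<Longrightarrow> v \<in> set (ch u) \<Longrightarrow> v \<in> set (ch u') \<Longrightarrow> u = u'"
  unfolding in_set_conv_nth using address_nth_ch address_inj by (metis butlast_snoc)

lemma parent_ch: "u \<in> V \<Longrightarrow> v \<in> set (ch u) \<Longrightarrow> parent T v = u"
  unfolding parent_def using ch_unique by blast

lemma anc_walk: "v \<in> V \<Longrightarrow> walk T rt (take i (address T v)) = Some (anc v i)"
proof -
  assume v: "v \<in> V"
  have "walk T rt (take i (address T v) @ drop i (address T v)) = Some v"
    using walk_address[OF v] by simp
  then show ?thesis unfolding ancestor_at_def walk_append
    by (cases "walk T rt (take i (address T v))") auto
qed

lemma anc_V: "v \<in> V \<Longrightarrow> anc v i \<in> V"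
  using anc_walk walk_V rt_in by blast

lemma address_anc: "v \<in> V \<Longrightarrow> address T (anc v i) = take i (address T v)"
  by (rule address_eq) (rule anc_walk)

lemma anc_dep [simp]: "v \<in> V \<Longrightarrow> anc v (dep v) = v"
  using anc_walk[of v "dep v"] walk_address by simp

lemma anc_0 [simp]: "v \<in> V \<Longrightarrow> anc v 0 = rt"
  using anc_walk[of v 0] by simp

lemma dep_anc: "v \<in> V \<Longrightarrow> i \<le> dep v \<Longrightarrow> dep (anc v i) = i"
  by (simp add: address_anc)

lemma anc_anc: "v \<in> V \<Longrightarrow> j \<le> i \<Longrightarrow> anc (anc v i) j = anc v j"
  by (rule address_inj) (auto simp: anc_V address_anc min_def)

lemma anc_Suc: "v \<in> V \<Longrightarrow> Suc i \<le> dep v \<Longrightarrow> anc v (Suc i) \<in> set (ch (anc v i))"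
proof -
  assume v: "v \<in> V" and i: "Suc i \<le> dep v"
  have "walk T rt (take i (address T v) @ [address T v ! i]) = Some (anc v (Suc i))"
    using anc_walk[OF v, of "Suc i"] i by (simp add: take_Suc_conv_app_nth)
  then show ?thesis using anc_walk[OF v, of i]
    by (auto simp: walk_append split: if_splits) (metis nth_mem)
qed

lemma anc_ch: "u \<in> V \<Longrightarrow> v \<in> set (ch u) \<Longrightarrow> i \<le> dep u \<Longrightarrow> anc v i = anc u i"
  by (metis anc_V anc_anc anc_dep anc_Suc ch_in ch_unique dep_ch order_refl)

lemma walk_anc: "u \<in> V \<Longrightarrow> v \<in> V \<Longrightarrow>
  (\<exists>p. walk T u p = Some v) \<longleftrightarrow> dep u \<le> dep v \<and> anc v (dep u) = u"
proof
  assume u: "u \<in> V" and v: "v \<in> V" and "\<exists>p. walk T u p = Some v"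
  then obtain p where "walk T u p = Some v" by blast
  then have "walk T rt (address T u @ p) = Some v" using u by (simp add: walk_append walk_address)
  then have "address T v = address T u @ p" by (rule address_eq)
  then show "dep u \<le> dep v \<and> anc v (dep u) = u"
    using anc_walk[OF v, of "dep u"] walk_address[OF u] by simp
next
  assume u: "u \<in> V" and v: "v \<in> V" and a: "dep u \<le> dep v \<and> anc v (dep u) = u"
  have "walk T rt (take (dep u) (address T v) @ drop (dep u) (address T v)) = Some v"
    using walk_address[OF v] by simp
  then have "walk T u (drop (dep u) (address T v)) = Some v"
    using anc_walk[OF v, of "dep u"] a by (simp add: walk_append del: append_take_drop_id)
  then show "\<exists>p. walk T u p = Some v" by blast
qed

lemma in_lev: "v \<in> lev k \<longleftrightarrow> v \<in> V \<and> dep v = k"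
  unfolding level_def by auto

lemma finite_lev [simp]: "finite (lev k)"
  unfolding level_def by simp

lemma lev_0: "lev 0 = {rt}"
  using address_inj by (auto simp: in_lev)

lemma anc_lev: "v \<in> lev k \<Longrightarrow> i \<le> k \<Longrightarrow> anc v i \<in> lev i"
  by (auto simp: in_lev anc_V dep_anc)

lemma anc_self: "v \<in> lev k \<Longrightarrow> anc v k = v"
  by (auto simp: in_lev)

lemma lev_Suc: "v \<in> lev (Suc k) \<longleftrightarrow> (\<exists>u\<in>lev k. v \<in> set (ch u))"
  using anc_lev[of v "Suc k" k] anc_Suc[of v k] anc_self[of v "Suc k"] ch_in dep_ch
  by (auto simp: in_lev)

lemma lev_Suc_anc: "v \<in> lev (Suc k) \<Longrightarrow> v \<in> set (ch (anc v k)) \<and> anc v k \<in> lev k"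
  using anc_lev[of v "Suc k" k] anc_Suc[of v k] anc_self[of v "Suc k"] by (auto simp: in_lev)

lemma anc_lev_ch: "u \<in> lev k \<Longrightarrow> v \<in> set (ch u) \<Longrightarrow> i \<le> k \<Longrightarrow> anc v i = anc u i"
  using anc_ch by (auto simp: in_lev)

lemma anc_parent: "u \<in> lev k \<Longrightarrow> v \<in> set (ch u) \<Longrightarrow> anc v k = u"
  using anc_lev_ch anc_self by fastforce

lemma parent_anc: "v \<in> lev (Suc k) \<Longrightarrow> parent T v = anc v k"
  using lev_Suc_anc parent_ch in_lev by blast

lemma finite_levels: "finite {k. lev k \<noteq> {}}"
proof -
  have "{k. lev k \<noteq> {}} \<subseteq> (\<lambda>v. dep v) ` V" by (auto simp: in_lev)
  then show ?thesis by (rule finite_subset) simp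
qed

lemma lev_ne: "lev k \<noteq> {} \<longleftrightarrow> k \<le> tree_depth T"
proof
  assume "lev k \<noteq> {}" then show "k \<le> tree_depth T"
    unfolding tree_depth_def using finite_levels by simp
next
  assume k: "k \<le> tree_depth T"
  have "tree_depth T \<in> {k. lev k \<noteq> {}}"
    unfolding tree_depth_def using lev_0 by (intro Max_in finite_levels) auto
  then obtain v where "v \<in> lev (tree_depth T)" by auto
  then show "lev k \<noteq> {}" using anc_lev k by blast
qed

lemma lev_le: "v \<in> lev k \<Longrightarrow> k \<le> tree_depth T"
  using lev_ne by blast

text \<open>The first index at which two addresses differ is the depth of the last common ancestor.
  This turns the lexicographic order into an order of siblings, which is all that brackets can
  see.\<close>

lemma lex_anc:
  assumes u: "u \<in> lev k" and v: "v \<in> lev k"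
  shows "lex_less T u v \<longleftrightarrow>
    (\<exists>j<k. anc u j = anc v j \<and> precedes (ch (anc u j)) (anc u (Suc j)) (anc v (Suc j)))"
proof -
  have V: "u \<in> V" "v \<in> V" and d: "dep u = k" "dep v = k" using u v in_lev by auto
  have "lex_less T u v \<longleftrightarrow> (\<exists>j<k. take j (address T u) = take j (address T v) \<and>
      address T u ! j < address T v ! j)"
    unfolding lex_less_def lexord_take_index_conv using d by auto
  also have "\<dots> \<longleftrightarrow> (\<exists>j<k. anc u j = anc v j \<and> precedes (ch (anc u j)) (anc u (Suc j)) (anc v (Suc j)))"
  proof (intro ex_cong1 conj_cong refl)
    fix j assume j: "j < k"
    show "take j (address T u) = take j (address T v) \<longleftrightarrow> anc u j = anc v j"
      using address_anc V address_inj anc_V by metis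
    assume eq: "anc u j = anc v j"
    have nth: "address T x ! j < length (ch (anc x j)) \<and> anc x (Suc j) = ch (anc x j) ! (address T x ! j)"
      if x: "x \<in> lev k" for x
    proof -
      have xV: "x \<in> V" and dx: "dep x = k" using x in_lev by auto
      have "walk T rt (take j (address T x) @ [address T x ! j]) = Some (anc x (Suc j))"
        using anc_walk[OF xV, of "Suc j"] j dx by (simp add: take_Suc_conv_app_nth)
      then show ?thesis using anc_walk[OF xV, of j]
        by (auto simp: walk_append split: if_splits)
    qed
    show "address T u ! j < address T v ! j \<longleftrightarrow> precedes (ch (anc u j)) (anc u (Suc j)) (anc v (Suc j))"
      using nth[OF u] nth[OF v] eq distinct_ch anc_V[OF V(2), of j] by (simp add: precedes_nth)
  qed
  finally show ?thesis .
qed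

lemma lex_irrefl: "\<not> lex_less T u u"
  unfolding lex_less_def using lexord_irreflexive[of "{(i::nat, j). i < j}"] by auto

lemma lex_trans: "lex_less T u v \<Longrightarrow> lex_less T v w \<Longrightarrow> lex_less T u w"
  unfolding lex_less_def by (rule lexord_trans) (auto simp: trans_def)

lemma lex_total: "u \<in> V \<Longrightarrow> v \<in> V \<Longrightarrow> u \<noteq> v \<Longrightarrow> lex_less T u v \<or> lex_less T v u"
proof -
  assume uv: "u \<in> V" "v \<in> V" "u \<noteq> v"
  have "(address T u, address T v) \<in> lexord {(i::nat, j). i < j} \<or> address T u = address T v \<or>
      (address T v, address T u) \<in> lexord {(i::nat, j). i < j}"
    by (rule lexord_linear) auto
  then show "lex_less T u v \<or> lex_less T v u"
    unfolding lex_less_def using uv address_inj by blast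
qed

lemma pos_lev: "v \<in> lev k \<Longrightarrow> pos T v = Suc (card {z \<in> lev k. lex_less T z v})"
proof -
  assume v: "v \<in> lev k"
  have "{u \<in> lev k. u = v \<or> lex_less T u v} = insert v {z \<in> lev k. lex_less T z v}" using v by auto
  then show ?thesis using v lex_irrefl unfolding pos_def in_lev by simp
qed

lemma pos_mono: "u \<in> lev k \<Longrightarrow> v \<in> lev k \<Longrightarrow> lex_less T u v \<Longrightarrow> pos T u < pos T v"
proof -
  assume u: "u \<in> lev k" and v: "v \<in> lev k" and l: "lex_less T u v"
  have "{z \<in> lev k. lex_less T z u} \<subset> {z \<in> lev k. lex_less T z v}"
    using u l lex_trans lex_irrefl by blast
  then show ?thesis using u v by (simp add: pos_lev psubset_card_mono)
qed

lemma pos_bij: "bij_betw (pos T) (lev k) {1..card (lev k)}"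
proof -
  have inj: "inj_on (pos T) (lev k)"
    by (rule inj_onI) (metis in_lev lex_total nat_neq_iff pos_mono)
  have sub: "pos T ` lev k \<subseteq> {1..card (lev k)}"
  proof
    fix i assume "i \<in> pos T ` lev k"
    then obtain v where v: "v \<in> lev k" "i = pos T v" by blast
    have "{z \<in> lev k. lex_less T z v} \<subset> lev k" using v lex_irrefl by blast
    then have "card {z \<in> lev k. lex_less T z v} < card (lev k)" by (simp add: psubset_card_mono)
    then show "i \<in> {1..card (lev k)}" using v by (simp add: pos_lev)
  qed
  have "pos T ` lev k = {1..card (lev k)}"
    using sub card_image[OF inj] by (intro card_subset_eq) auto
  then show ?thesis using inj by (simp add: bij_betw_def)
qed

lemma nth_vertex: assumes "1 \<le> i" "i \<le> card (lev k)"
  shows "nth_vertex T k i \<in> lev k" "pos T (nth_vertex T k i) = i"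
proof -
  have "\<exists>!u. u \<in> lev k \<and> pos T u = i"
    using pos_bij[of k] assms unfolding bij_betw_def inj_on_def by (metis atLeastAtMost_iff imageE)
  from theI'[OF this] show "nth_vertex T k i \<in> lev k" "pos T (nth_vertex T k i) = i"
    unfolding nth_vertex_def by auto
qed

lemma nth_vertex_pos: "v \<in> lev k \<Longrightarrow> nth_vertex T k (pos T v) = v \<and> 1 \<le> pos T v \<and> pos T v \<le> card (lev k)"
  using pos_bij[of k] nth_vertex[of "pos T v" k] unfolding bij_betw_def inj_on_def
  by (metis atLeastAtMost_iff imageI)

end

section \<open>Brackets\<close>

lemma sub_refl [simp]: "A \<sqsubseteq>\<^sub>b A"
  unfolding bracket_sub_def by (simp add: list_all2_refl)

lemma sub_length: "A \<sqsubseteq>\<^sub>b A' \<Longrightarrow> length A = length A'"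
  unfolding bracket_sub_def by (rule list_all2_lengthD)

lemma sub_nth: "A \<sqsubseteq>\<^sub>b A' \<Longrightarrow> i < length A \<Longrightarrow> A ! i \<subseteq> A' ! i"
  unfolding bracket_sub_def by (rule list_all2_nthD)

lemma subI: "length A = length A' \<Longrightarrow> (\<And>i. i < length A \<Longrightarrow> A ! i \<subseteq> A' ! i) \<Longrightarrow> A \<sqsubseteq>\<^sub>b A'"
  unfolding bracket_sub_def by (rule list_all2_all_nthI)

lemma sub_antisym: "A \<sqsubseteq>\<^sub>b A' \<Longrightarrow> A' \<sqsubseteq>\<^sub>b A \<Longrightarrow> A = A'"
  unfolding bracket_sub_def by (rule list_all2_antisym[of "(\<subseteq>)" "(\<subseteq>)"]) auto

lemma sub_snoc: "A @ [x] \<sqsubseteq>\<^sub>b A' @ [y] \<longleftrightarrow> A \<sqsubseteq>\<^sub>b A' \<and> x \<subseteq> y"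
proof
  assume "A @ [x] \<sqsubseteq>\<^sub>b A' @ [y]"
  then show "A \<sqsubseteq>\<^sub>b A' \<and> x \<subseteq> y"
    using list_all2_lengthD[of "(\<subseteq>)" "A @ [x]" "A' @ [y]"]
    unfolding bracket_sub_def by (simp add: list_all2_append)
next
  assume "A \<sqsubseteq>\<^sub>b A' \<and> x \<subseteq> y"
  then show "A @ [x] \<sqsubseteq>\<^sub>b A' @ [y]"
    unfolding bracket_sub_def by (auto intro: list_all2_appendI)
qed

lemma sub_butlast: "A \<sqsubseteq>\<^sub>b A' \<Longrightarrow> butlast A \<sqsubseteq>\<^sub>b butlast A'"
  proof (rule subI)
  assume s: "A \<sqsubseteq>\<^sub>b A'"
  then show "length (butlast A) = length (butlast A')" by (simp add: sub_length)
  show "butlast A ! i \<subseteq> butlast A' ! i" if "i < length (butlast A)" for i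
    using that s sub_nth[OF s, of i] sub_length[OF s] by (simp add: nth_butlast)
qed

lemma sub_last: "A \<sqsubseteq>\<^sub>b A' \<Longrightarrow> A \<noteq> [] \<Longrightarrow> last A \<subseteq> last A'"
  using sub_length[of A A'] sub_nth[of A A' "length A - 1"]
  by (cases "A' = []") (auto simp: last_conv_nth)

context rpt
begin

abbreviation "sb \<equiv> singleton_bracket T"
abbreviation "mx \<equiv> max_bracket T"
abbreviation "sing \<equiv> is_singleton_bracket T"
abbreviation "ismx \<equiv> is_max_bracket T"

text \<open>The ground set that axiom 4a requires the brackets directly above \<open>A\<close> to
  cover.\<close>

definition fib :: "'a bracket \<Rightarrow> 'a set" where
  "fib A = (\<Union>u\<in>last A. set (ch u))"

lemma br_length: "is_bracket T k A \<Longrightarrow> length A = Suc k"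
  and br_depth: "is_bracket T k A \<Longrightarrow> k \<le> tree_depth T"
  and br_lev: "is_bracket T k A \<Longrightarrow> i \<le> k \<Longrightarrow> A ! i \<subseteq> lev i"
  and br_ne: "is_bracket T k A \<Longrightarrow> A ! k \<noteq> {}"
  unfolding is_bracket_def by auto

lemma br_last: "is_bracket T k A \<Longrightarrow> last A = A ! k"
  by (metis br_length diff_Suc_1 last_conv_nth list.size(3) nat.distinct(1))

lemma br_parent: "is_bracket T k A \<Longrightarrow> Suc i \<le> k \<Longrightarrow> v \<in> A ! Suc i \<Longrightarrow> anc v i \<in> A ! i"
proof -
  assume A: "is_bracket T k A" and i: "Suc i \<le> k" and v: "v \<in> A ! Suc i"
  have "parent T v \<in> A ! (Suc i - 1)" using A i v unfolding is_bracket_def by force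
  moreover have "v \<in> lev (Suc i)" using br_lev[OF A i] v by blast
  ultimately show ?thesis by (simp add: parent_anc)
qed

lemma br_anc: assumes A: "is_bracket T k A" and j: "j \<le> k" and v: "v \<in> A ! j" and i: "i \<le> j"
  shows "anc v i \<in> A ! i"
  using i
proof (induction i rule: inc_induct)
  case base
  then show ?case using br_lev[OF A j] v anc_self by (metis subsetD)
next
  case (step n)
  have "anc v (Suc n) \<in> lev (Suc n)" using br_lev[OF A, of "Suc n"] step j by auto
  moreover have "v \<in> V" using br_lev[OF A j] v in_lev by blast
  ultimately have "anc (anc v (Suc n)) n = anc v n" by (simp add: anc_anc)
  then show ?case using br_parent[OF A _ step.IH] step j by auto
qed

lemma br_rt: "is_bracket T k A \<Longrightarrow> A ! 0 = {rt}"
proof -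
  assume A: "is_bracket T k A"
  obtain v where v: "v \<in> A ! k" using br_ne[OF A] by blast
  then have "v \<in> V" using br_lev[OF A order_refl] in_lev by blast
  then have "rt \<in> A ! 0" using br_anc[OF A order_refl v, of 0] by simp
  then show ?thesis using br_lev[OF A, of 0] lev_0 by auto
qed

lemma fib_iff: assumes A: "is_bracket T k A"
  shows "v \<in> fib A \<longleftrightarrow> v \<in> lev (Suc k) \<and> anc v k \<in> last A"
proof
  assume "v \<in> fib A"
  then obtain u where u: "u \<in> last A" "v \<in> set (ch u)" unfolding fib_def by blast
  then have "u \<in> lev k" using br_lev[OF A order_refl] br_last[OF A] by blast
  then show "v \<in> lev (Suc k) \<and> anc v k \<in> last A" using u lev_Suc anc_parent by blast
next
  assume "v \<in> lev (Suc k) \<and> anc v k \<in> last A"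
  then show "v \<in> fib A" using lev_Suc_anc unfolding fib_def by blast
qed

lemma sb_length [simp]: "length (sb u) = Suc (dep u)"
  unfolding singleton_bracket_def by simp

lemma sb_nth: "i \<le> dep u \<Longrightarrow> sb u ! i = {anc u i}"
  unfolding singleton_bracket_def by (simp del: upt_Suc)

lemma sb_ne [simp]: "sb u \<noteq> []"
  by (metis length_0_conv nat.distinct(1) sb_length)

lemma last_sb: "u \<in> V \<Longrightarrow> last (sb u) = {u}"
  by (simp add: last_conv_nth sb_nth)

lemma sb_inj: "u \<in> V \<Longrightarrow> v \<in> V \<Longrightarrow> sb u = sb v \<Longrightarrow> u = v"
  by (metis last_sb singleton_inject)

lemma take_sb: "v \<in> V \<Longrightarrow> i \<le> dep v \<Longrightarrow> take (Suc i) (sb v) = sb (anc v i)"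
  by (rule nth_equalityI) (auto simp: sb_nth dep_anc anc_anc)

lemma butlast_sb: "u \<in> V \<Longrightarrow> v \<in> set (ch u) \<Longrightarrow> butlast (sb v) = sb u"
  using take_sb[of v "dep u"] dep_ch[of u v] ch_in[of u v] anc_ch[of u v "dep u"]
  by (simp add: butlast_conv_take)

lemma butlast_sb_lev: "v \<in> lev (Suc k) \<Longrightarrow> butlast (sb v) = sb (anc v k)"
  using lev_Suc_anc butlast_sb in_lev by blast

lemma mx_length [simp]: "length (mx k) = Suc k"
  unfolding max_bracket_def by simp

lemma mx_nth: "i \<le> k \<Longrightarrow> mx k ! i = lev i"
  unfolding max_bracket_def by (simp del: upt_Suc)

lemma last_mx [simp]: "last (mx k) = lev k"
  unfolding max_bracket_def by simp

lemma mx_ne [simp]: "mx k \<noteq> []"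
  by (metis length_0_conv nat.distinct(1) mx_length)

lemma butlast_mx [simp]: "butlast (mx (Suc k)) = mx k"
  unfolding max_bracket_def by (subst upt_Suc) (simp del: upt_Suc)

lemma take_mx: "i \<le> k \<Longrightarrow> take (Suc i) (mx k) = mx i"
  by (rule nth_equalityI) (auto simp: mx_nth)

lemma sing_sb: "u \<in> V \<Longrightarrow> sing (sb u)"
  unfolding is_singleton_bracket_def by blast

lemma singE: assumes "sing A" "is_bracket T k A"
  obtains u where "u \<in> lev k" "A = sb u" "last A = {u}"
proof -
  obtain u where u: "u \<in> V" "A = sb u" using assms(1) unfolding is_singleton_bracket_def by blast
  moreover have "u \<in> lev k" using br_length[OF assms(2)] u by (simp add: in_lev)
  ultimately show ?thesis using that last_sb by blast
qed

lemma sing_butlast: "sing A \<Longrightarrow> 2 \<le> length A \<Longrightarrow> sing (butlast A)"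
proof -
  assume "sing A" "2 \<le> length A"
  then obtain v k where v: "v \<in> V" "A = sb v" "dep v = Suc k"
    unfolding is_singleton_bracket_def by (metis Suc_le_D Suc_le_mono numeral_2_eq_2 sb_length)
  then have "butlast A = sb (anc v k)" using butlast_sb_lev in_lev by blast
  then show ?thesis using sing_sb anc_V v by simp
qed

lemma sing_take: "sing A \<Longrightarrow> 0 < i \<Longrightarrow> sing (take i A)"
proof -
  assume "sing A" "0 < i"
  then obtain v where v: "v \<in> V" "A = sb v" unfolding is_singleton_bracket_def by blast
  obtain j where j: "i = Suc j" using \<open>0 < i\<close> by (cases i) auto
  show ?thesis
  proof (cases "j \<le> dep v")
    case True
    then show ?thesis using take_sb v j sing_sb anc_V by metis
  next
    case False
    then show ?thesis using v j \<open>sing A\<close> by simp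
  qed
qed

lemma ismx_iff: "is_bracket T k A \<Longrightarrow> ismx A \<longleftrightarrow> A = mx k"
  unfolding is_max_bracket_def using br_length br_depth by (metis Suc_inject mx_length)

end

section \<open>Bracketings\<close>

locale bing = rpt T for T :: "'a plane_tree" +
  fixes B :: "'a bracketing"
  assumes B: "is_bracketing T B"
begin

abbreviation "AB \<equiv> all_brk B"

lemmas bing_ax = B[unfolded is_bracketing_def]
lemmas brk_ax = bing_ax[THEN conjunct1]
lemmas prec_sub_ax = bing_ax[THEN conjunct2, THEN conjunct1]
lemmas irrefl_ax = bing_ax[THEN conjunct2, THEN conjunct2, THEN conjunct1]
lemmas trans_ax = bing_ax[THEN conjunct2, THEN conjunct2, THEN conjunct2, THEN conjunct1]
lemmas bing_axA = bing_ax[THEN conjunct2, THEN conjunct2, THEN conjunct2, THEN conjunct2]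
lemmas trivial_ax = bing_axA[THEN conjunct1]
lemmas proj_ax = bing_axA[THEN conjunct2, THEN conjunct1]
lemmas nested_ax = bing_axA[THEN conjunct2, THEN conjunct2, THEN conjunct1]
lemmas bing_axB = bing_axA[THEN conjunct2, THEN conjunct2, THEN conjunct2]
lemmas cover_ax = bing_axB[THEN conjunct1]
lemmas smaller_ax = bing_axB[THEN conjunct2, THEN conjunct1]
lemmas bing_axC = bing_axB[THEN conjunct2, THEN conjunct2]
lemmas comparable_ax = bing_axC[THEN conjunct1]
lemmas siblings_ax = bing_axC[THEN conjunct2, THEN conjunct1]
lemmas consistent_ax = bing_axC[THEN conjunct2, THEN conjunct2]

lemma br: "A \<in> brk B k \<Longrightarrow> is_bracket T k A"
  using brk_ax by blast

lemma brk_iff: "A \<in> brk B k \<longleftrightarrow> A \<in> AB \<and> length A = Suc k"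
proof
  assume "A \<in> brk B k"
  then show "A \<in> AB \<and> length A = Suc k" unfolding all_brk_def using br br_length by blast
next
  assume a: "A \<in> AB \<and> length A = Suc k"
  then obtain l where l: "A \<in> brk B l" unfolding all_brk_def by blast
  then have "l = k" using a br_length[OF br[OF l]] by simp
  then show "A \<in> brk B k" using l by simp
qed

lemma ABE: assumes "A \<in> AB" obtains k where "A \<in> brk B k" "is_bracket T k A" "length A = Suc k"
  using assms that br br_length unfolding all_brk_def by blast

lemma AB_ne: "A \<in> AB \<Longrightarrow> A \<noteq> []"
  by (metis ABE length_0_conv nat.distinct(1))

lemma last_ne: "A \<in> AB \<Longrightarrow> last A \<noteq> {}"
  by (metis ABE br_last br_ne)

lemma last_V: "A \<in> AB \<Longrightarrow> last A \<subseteq> V"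
proof -
  assume "A \<in> AB"
  then obtain k where "is_bracket T k A" by (rule ABE)
  then have "last A \<subseteq> lev k" using br_last br_lev by (metis order_refl)
  then show ?thesis using in_lev by blast
qed

lemma last_lev: "A \<in> brk B k \<Longrightarrow> last A \<subseteq> lev k"
  using br br_last br_lev by (metis order_refl)

lemma finite_last: "A \<in> AB \<Longrightarrow> finite (last A)"
  using last_V finite_V finite_subset by metis

lemma finite_AB [simp]: "finite AB"
proof (rule finite_subset)
  show "AB \<subseteq> {A. set A \<subseteq> Pow V \<and> length A \<le> Suc (tree_depth T)}"
  proof
    fix A assume "A \<in> AB"
    then obtain k where A: "is_bracket T k A" "length A = Suc k" by (rule ABE)
    have "A ! i \<subseteq> V" if "i < length A" for i
      using br_lev[OF A(1), of i] that A(2) by (auto simp: in_lev)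
    then have "set A \<subseteq> Pow V" by (metis PowI in_set_conv_nth subsetI)
    then show "A \<in> {A. set A \<subseteq> Pow V \<and> length A \<le> Suc (tree_depth T)}" using A br_depth by auto
  qed
  show "finite {A. set A \<subseteq> Pow V \<and> length A \<le> Suc (tree_depth T)}"
    by (rule finite_lists_length_le) simp
qed

lemma finite_brk [simp]: "finite (brk B k)"
  by (rule finite_subset[OF _ finite_AB]) (auto simp: all_brk_def)

lemma mx_brk: "k \<le> tree_depth T \<Longrightarrow> mx k \<in> brk B k"
  using trivial_ax by blast

lemma sb_brk: "u \<in> lev k \<Longrightarrow> sb u \<in> brk B k"
  using trivial_ax lev_le by blast

lemma sb_AB: "u \<in> V \<Longrightarrow> sb u \<in> AB"
  using sb_brk in_lev unfolding all_brk_def by blast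

lemma sing_AB: "sing A \<Longrightarrow> A \<in> AB"
  using sb_AB unfolding is_singleton_bracket_def by blast

lemma ismx_AB: "ismx A \<Longrightarrow> A \<in> AB"
  using mx_brk unfolding is_max_bracket_def all_brk_def by blast

lemma butlast_brk: "A \<in> brk B (Suc k) \<Longrightarrow> butlast A \<in> brk B k"
  using proj_ax[THEN spec, of "Suc k"] by simp

lemma butlast_AB: "A \<in> AB \<Longrightarrow> 2 \<le> length A \<Longrightarrow> butlast A \<in> AB"
proof -
  assume A: "A \<in> AB" "2 \<le> length A"
  then obtain k where "A \<in> brk B (Suc k)" using brk_iff[of A "length A - 2 + 1"] by auto
  then show ?thesis using butlast_brk unfolding all_brk_def by blast
qed

lemma take_brk: "A \<in> brk B k \<Longrightarrow> i \<le> k \<Longrightarrow> take (Suc i) A \<in> brk B i"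
proof (induction k arbitrary: A)
  case 0
  then show ?case using brk_iff by simp
next
  case (Suc k)
  have l: "length A = Suc (Suc k)" using Suc.prems brk_iff by blast
  show ?case
  proof (cases "i = Suc k")
    case True
    then show ?thesis using Suc.prems l by simp
  next
    case False
    then have "take (Suc i) (butlast A) \<in> brk B i"
      using Suc.IH[OF butlast_brk[OF Suc.prems(1)]] Suc.prems(2) by simp
    moreover have "take (Suc i) (butlast A) = take (Suc i) A"
      using l False Suc.prems(2) by (simp add: take_butlast)
    ultimately show ?thesis by simp
  qed
qed

lemma take_AB: "A \<in> AB \<Longrightarrow> 0 < i \<Longrightarrow> take i A \<in> AB"
proof -
  assume A: "A \<in> AB" "0 < i"
  then obtain k where k: "A \<in> brk B k" "length A = Suc k" by (metis ABE)
  show ?thesis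
  proof (cases "i \<le> Suc k")
    case True
    then have "take (Suc (i - 1)) A \<in> brk B (i - 1)" using A(2) True by (intro take_brk[OF k(1)]) simp
    then show ?thesis using A(2) brk_iff by simp
  next
    case False
    then show ?thesis using k A by simp
  qed
qed

lemma over_iff: "A \<in> AB \<Longrightarrow> X \<in> over B A \<longleftrightarrow> X \<in> AB \<and> butlast X = A"
  unfolding over_def brk_iff using AB_ne by (auto simp: Suc_diff_Suc)

lemma over_brk: "A \<in> brk B k \<Longrightarrow> X \<in> over B A \<longleftrightarrow> X \<in> brk B (Suc k) \<and> butlast X = A"
  unfolding over_def brk_iff by auto

text \<open>Brackets directly above \<open>A\<close> differ only in their last set, so they may be
  treated as a family of subsets of \<open>fib A\<close>.\<close>

lemma over_eq: "A \<in> AB \<Longrightarrow> X \<in> over B A \<Longrightarrow> X = A @ [last X]"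
  using over_iff AB_ne by (metis append_butlast_last_id)

lemma over_AB: "A \<in> AB \<Longrightarrow> X \<in> over B A \<Longrightarrow> X \<in> AB"
  using over_iff by blast

lemma over_length: "A \<in> AB \<Longrightarrow> X \<in> over B A \<Longrightarrow> length X = Suc (length A)"
  using over_eq by (metis length_append_singleton)

lemma finite_over [simp]: "finite (over B A)"
  unfolding over_def by simp

lemma over_sub: "A \<in> AB \<Longrightarrow> X \<in> over B A \<Longrightarrow> Y \<in> over B A \<Longrightarrow> X \<sqsubseteq>\<^sub>b Y \<longleftrightarrow> last X \<subseteq> last Y"
  using over_eq sub_snoc sub_refl by metis

lemma over_last_inj: "A \<in> AB \<Longrightarrow> X \<in> over B A \<Longrightarrow> Y \<in> over B A \<Longrightarrow> last X = last Y \<Longrightarrow> X = Y"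
  using over_eq by metis

lemma nested: assumes "X \<in> AB" "Y \<in> AB" "length X = length Y" "last X \<inter> last Y \<noteq> {}"
  shows "X \<sqsubseteq>\<^sub>b Y \<or> Y \<sqsubseteq>\<^sub>b X"
proof -
  obtain k where "X \<in> brk B k" "length X = Suc k" "last X = X ! k"
    using assms(1) ABE br_last by metis
  moreover have "Y \<in> brk B k" "last Y = Y ! k"
    using assms(2,3) calculation brk_iff br br_last by metis+
  ultimately show ?thesis using nested_ax assms(4) by metis
qed

lemma nested_over: "A \<in> AB \<Longrightarrow> X \<in> over B A \<Longrightarrow> Y \<in> over B A \<Longrightarrow> last X \<inter> last Y \<noteq> {} \<Longrightarrow>
    last X \<subseteq> last Y \<or> last Y \<subseteq> last X"
  using nested[of X Y] over_sub over_AB over_length by metis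

lemma fib_iff': "A \<in> brk B k \<Longrightarrow> v \<in> fib A \<longleftrightarrow> v \<in> lev (Suc k) \<and> anc v k \<in> last A"
  using fib_iff br by blast

lemma over_fib: "A \<in> AB \<Longrightarrow> X \<in> over B A \<Longrightarrow> last X \<subseteq> fib A"
proof
  fix v assume A: "A \<in> AB" and X: "X \<in> over B A" and v: "v \<in> last X"
  obtain k where k: "A \<in> brk B k" "is_bracket T k A" "length A = Suc k" using A ABE by blast
  have X': "X \<in> brk B (Suc k)" using X over_brk k by blast
  have "v \<in> X ! Suc k" using v br_last[OF br[OF X']] by simp
  then have "anc v k \<in> X ! k" using br_parent[OF br[OF X'] order_refl] by blast
  moreover have "X ! k = last A"
    using over_eq[OF A X] k br_last[OF k(2)] by (metis lessI nth_append)
  ultimately show "v \<in> fib A" using fib_iff' k last_lev[OF X'] v by blast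
qed

lemma cover: assumes A: "A \<in> AB" and v: "v \<in> fib A"
  shows "\<exists>X\<in>over B A. v \<in> last X"
proof -
  obtain k where k: "A \<in> brk B k" "is_bracket T k A" "length A = Suc k" using A ABE by blast
  have "v \<in> lev (Suc k)" using v fib_iff' k by blast
  then have kd: "Suc k \<in> {1..tree_depth T}" using lev_le by auto
  have "(\<Union>A'\<in>over B A. A' ! Suc k) = (\<Union>u\<in>A ! (Suc k - 1). set (ch u))"
    using cover_ax kd k(1) by (metis diff_Suc_1)
  then have "v \<in> (\<Union>A'\<in>over B A. A' ! Suc k)" using v br_last[OF k(2)] unfolding fib_def by simp
  then obtain X where "X \<in> over B A" "v \<in> X ! Suc k" by blast
  moreover have "last X = X ! Suc k" using br_last br over_brk k calculation by blast
  ultimately show ?thesis by blast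
qed

lemma smaller: assumes A: "A \<in> AB" and X: "X \<in> over B A" "Y \<in> over B A" "last Y \<subset> last X" and v: "v \<in> last X"
  shows "\<exists>Z\<in>over B A. v \<in> last Z \<and> last Z \<subset> last X"
proof -
  obtain k where k: "A \<in> brk B k" "is_bracket T k A" "length A = Suc k" using A ABE by blast
  have XX: "X \<in> brk B (Suc k)" using over_brk k X by blast
  then have kd: "Suc k \<in> {1..tree_depth T}" using br br_depth by force
  have lst: "last Z = Z ! Suc k" if "Z \<in> over B A" for Z using that br_last br over_brk k by blast
  have ps: "Z \<sqsubset>\<^sub>b X \<longleftrightarrow> last Z \<subset> last X" if "Z \<in> over B A" for Z
    unfolding bracket_psub_def using over_sub[OF A that X(1)] over_last_inj[OF A that X(1)] by blast
  have "\<exists>A3\<in>over B A. v \<in> A3 ! Suc k \<and> A3 \<sqsubset>\<^sub>b X"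
  proof -
    have A': "A \<in> brk B (Suc k - 1)" using k(1) by simp
    have YX: "Y \<sqsubset>\<^sub>b X" using ps X by blast
    have "v \<in> X ! Suc k" using v lst X by simp
    then show ?thesis
      by (rule smaller_ax[THEN bspec, OF kd, THEN bspec, OF A', THEN bspec, OF X(1), THEN bspec,
          OF X(2), THEN mp, OF YX, THEN bspec])
  qed
  then show ?thesis using ps lst by blast
qed

text \<open>A bracket of least cardinality around \<open>v\<close> works: whatever meets it without
  containing it is properly inside by axiom 3, and then axiom 4b produces a smaller bracket around
  \<open>v\<close>.\<close>

lemma ex_min: assumes A: "A \<in> AB" and v: "v \<in> fib A"
  shows "\<exists>X. X \<in> over B A \<and> v \<in> last X \<and> (\<forall>Z\<in>over B A. last Z \<inter> last X \<noteq> {} \<longrightarrow> last X \<subseteq> last Z)"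
proof -
  obtain X where X: "X \<in> over B A" "v \<in> last X"
    and least: "\<And>Y. Y \<in> over B A \<Longrightarrow> v \<in> last Y \<Longrightarrow> card (last X) \<le> card (last Y)"
    using ex_has_least_nat[of "\<lambda>X. X \<in> over B A \<and> v \<in> last X" _ "\<lambda>X. card (last X)"] cover[OF A v]
    by blast
  have "last X \<subseteq> last Z" if Z: "Z \<in> over B A" "last Z \<inter> last X \<noteq> {}" for Z
  proof (rule ccontr)
    assume "\<not> last X \<subseteq> last Z"
    then have "last Z \<subset> last X" using nested_over[OF A Z(1) X(1) Z(2)] by blast
    then obtain Y where Y: "Y \<in> over B A" "v \<in> last Y" "last Y \<subset> last X"
      using smaller[OF A X(1) Z(1) _ X(2)] by blast
    have "card (last Y) < card (last X)"
      by (rule psubset_card_mono[OF finite_last[OF over_AB[OF A X(1)]] Y(3)])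
    then show False using least[OF Y(1,2)] by simp
  qed
  then show ?thesis using X by blast
qed

text \<open>The innermost bracket above \<open>A\<close> around \<open>v\<close>. Innermost brackets
  partition \<open>fib A\<close>, and they stand in for vertices whenever two bracketings are
  compared.\<close>

definition mb :: "'a bracket \<Rightarrow> 'a \<Rightarrow> 'a bracket" where
  "mb A v = (SOME X. X \<in> over B A \<and> v \<in> last X \<and>
     (\<forall>Z\<in>over B A. last Z \<inter> last X \<noteq> {} \<longrightarrow> last X \<subseteq> last Z))"

lemma mb: assumes "A \<in> AB" "v \<in> fib A"
  shows mb_over: "mb A v \<in> over B A" and mb_in: "v \<in> last (mb A v)"
    and mb_min: "Z \<in> over B A \<Longrightarrow> last Z \<inter> last (mb A v) \<noteq> {} \<Longrightarrow> last (mb A v) \<subseteq> last Z"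
  using someI_ex[OF ex_min[OF assms]] unfolding mb_def by blast+

lemma mb_le: "A \<in> AB \<Longrightarrow> Z \<in> over B A \<Longrightarrow> v \<in> last Z \<Longrightarrow> last (mb A v) \<subseteq> last Z"
  using mb[of A v] over_fib by blast

section \<open>The order on disjoint siblings\<close>

lemma prec_AB: "(X, Y) \<in> prec B \<Longrightarrow> X \<in> AB \<and> Y \<in> AB"
  using prec_sub_ax by blast

lemma prec_neq: "(X, Y) \<in> prec B \<Longrightarrow> X \<noteq> Y"
  using irrefl_ax unfolding irrefl_def by blast

lemma prec_trans: "(X, Y) \<in> prec B \<Longrightarrow> (Y, Z) \<in> prec B \<Longrightarrow> (X, Z) \<in> prec B"
  using trans_ax unfolding trans_def by blast

lemma prec_asym: "(X, Y) \<in> prec B \<Longrightarrow> (Y, X) \<notin> prec B"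
  using prec_trans prec_neq by blast

lemma comparable_iff: assumes "X \<in> AB" "Y \<in> AB"
  shows "(X, Y) \<in> prec B \<or> (Y, X) \<in> prec B \<longleftrightarrow>
    length X = length Y \<and> butlast X = butlast Y \<and> last X \<inter> last Y = {}"
proof (cases "X = Y")
  case True
  then show ?thesis using prec_neq last_ne[OF assms(1)] by auto
next
  case False
  have *: "comparable B X Y \<longleftrightarrow>
      (\<exists>k. X \<in> brk B k \<and> Y \<in> brk B k \<and> proj X = proj Y \<and> X ! k \<inter> Y ! k = {})"
    using comparable_ax assms False by blast
  have "comparable B X Y \<longleftrightarrow> length X = length Y \<and> butlast X = butlast Y \<and> last X \<inter> last Y = {}"
  proof
    assume "comparable B X Y"
    then obtain k where k: "X \<in> brk B k" "Y \<in> brk B k" "proj X = proj Y" "X ! k \<inter> Y ! k = {}"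
      using * by blast
    then show "length X = length Y \<and> butlast X = butlast Y \<and> last X \<inter> last Y = {}"
      using brk_iff br_last[OF br] by simp
  next
    assume a: "length X = length Y \<and> butlast X = butlast Y \<and> last X \<inter> last Y = {}"
    obtain k where "X \<in> brk B k" "length X = Suc k" using assms ABE by metis
    moreover then have "Y \<in> brk B k" using assms a brk_iff by simp
    ultimately show "comparable B X Y" using * a br_last[OF br] by metis
  qed
  then show ?thesis unfolding comparable_def .
qed

lemma precD: assumes "(X, Y) \<in> prec B"
  shows "length X = length Y" "butlast X = butlast Y" "last X \<inter> last Y = {}"
  using comparable_iff[of X Y] prec_AB[OF assms] assms by blast+

lemma prec_over: assumes "(X, Y) \<in> prec B"
  shows "2 \<le> length X" "butlast X \<in> AB" "X \<in> over B (butlast X)" "Y \<in> over B (butlast X)"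
proof -
  note XY = prec_AB[OF assms] precD[OF assms]
  obtain k where k: "X \<in> brk B k" "is_bracket T k X" "length X = Suc k" using XY ABE by blast
  have Yk: "Y \<in> brk B k" using XY k brk_iff by simp
  \<comment> \<open>Two brackets of level 0 share the root, so they cannot be disjoint.\<close>
  have "k \<noteq> 0"
  proof
    assume "k = 0"
    then have "last X = {rt}" "last Y = {rt}" using br_rt br_last br k Yk by metis+
    then show False using XY by simp
  qed
  then show l: "2 \<le> length X" using k by simp
  then show b: "butlast X \<in> AB" using butlast_AB XY by blast
  show "X \<in> over B (butlast X)" "Y \<in> over B (butlast X)" using over_iff[OF b] XY by auto
qed

lemma precI: "A \<in> AB \<Longrightarrow> X \<in> over B A \<Longrightarrow> Y \<in> over B A \<Longrightarrow> last X \<inter> last Y = {} \<Longrightarrow>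
    (X, Y) \<in> prec B \<or> (Y, X) \<in> prec B"
  using comparable_iff[of X Y] over_AB over_length over_iff by metis

lemma prec_sb: "u \<in> V \<Longrightarrow> precedes (ch u) v w \<Longrightarrow> (sb v, sb w) \<in> prec B"
  using siblings_ax by blast

text \<open>The direction of axiom 5c used below: an order between large brackets passes to smaller
  ones. That the smaller ones are comparable at all follows from the inclusions.\<close>

lemma prec_mono: assumes XY: "(X, Y) \<in> prec B" and Z: "Z \<in> AB" "W \<in> AB" "butlast Z = butlast W"
    and le: "Z \<sqsubseteq>\<^sub>b X" "W \<sqsubseteq>\<^sub>b Y"
  shows "(Z, W) \<in> prec B"
proof -
  note P = prec_AB[OF XY] precD[OF XY] prec_over[OF XY]
  have lZ: "length Z = length X" "length W = length X" using le sub_length P by metis+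
  have "last Z \<subseteq> last X" "last W \<subseteq> last Y" using sub_last le AB_ne Z by metis+
  then have "last Z \<inter> last W = {}" using P by blast
  then have cZ: "comparable B Z W" using comparable_iff Z lZ unfolding comparable_def by simp
  have cX: "comparable B X Y" using XY unfolding comparable_def by simp
  have Z2: "butlast Z \<in> AB" "Z \<in> over B (butlast Z)" "W \<in> over B (butlast Z)"
  proof -
    show b: "butlast Z \<in> AB" using butlast_AB[of Z] P(5) lZ Z(1) by metis
    show "Z \<in> over B (butlast Z)" "W \<in> over B (butlast Z)" using over_iff[OF b] Z by auto
  qed
  obtain k where k: "length X = Suc (Suc k)" using P(5) by (metis Suc_le_D Suc_le_mono numeral_2_eq_2)
  have kk: "butlast X \<in> brk B k" "butlast Z \<in> brk B k" using k lZ P Z2 brk_iff by auto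
  then have kk': "butlast X \<in> brk B (Suc k - 1)" "butlast Z \<in> brk B (Suc k - 1)" by simp_all
  have kd: "Suc k \<in> {1..tree_depth T}" using br[of X "Suc k"] brk_iff P k br_depth by force
  have bZ: "butlast Z \<sqsubseteq>\<^sub>b butlast X" using sub_butlast le by blast
  have "X \<noteq> Y" "Z \<noteq> W" using prec_neq XY cZ unfolding comparable_def by blast+
  then have c: "X \<noteq> Y \<and> comparable B X Y \<and> Z \<noteq> W \<and> comparable B Z W \<and> Z \<sqsubseteq>\<^sub>b X \<and> W \<sqsubseteq>\<^sub>b Y"
    using cX cZ le by simp
  have "(X, Y) \<in> prec B \<longleftrightarrow> (Z, W) \<in> prec B"
    by (rule consistent_ax[THEN bspec, OF kd, THEN bspec, OF kk'(1), THEN bspec, OF kk'(2),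
          THEN mp, OF bZ, THEN bspec, OF P(7), THEN bspec, OF P(8), THEN bspec, OF Z2(2),
          THEN bspec, OF Z2(3), THEN mp, OF c])
  then show ?thesis using XY by simp
qed

text \<open>Overlapping siblings are nested. Shrinking \<open>X\<close> to \<open>X'\<close> is
  axiom 5c; when \<open>X'\<close> is the larger one, the opposite order of \<open>X'\<close> and
  \<open>Y\<close> would shrink to the opposite order of \<open>X\<close> and \<open>Y\<close>. This
  allows a bracket to be traded for any other one through the same vertex.\<close>

lemma prec_cong_right: assumes XY: "(Y, X) \<in> prec B" and X': "X' \<in> over B (butlast X)"
    and d: "last X \<inter> last X' \<noteq> {}" "last Y \<inter> last X' = {}"
  shows "(Y, X') \<in> prec B"
proof -
  have A: "butlast X \<in> AB" "X \<in> over B (butlast X)" "Y \<in> over B (butlast X)"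
    using prec_over[OF XY] precD[OF XY] by auto
  have AB: "X \<in> AB" "Y \<in> AB" "X' \<in> AB" using prec_AB[OF XY] over_AB A X' by auto
  have bl: "butlast X' = butlast X" "butlast Y = butlast X" using over_iff A X' by blast+
  have "X' \<sqsubseteq>\<^sub>b X \<or> X \<sqsubseteq>\<^sub>b X'" using nested_over A X' d over_sub by (metis Int_commute)
  then show ?thesis
  proof
    assume "X' \<sqsubseteq>\<^sub>b X"
    then show ?thesis using prec_mono[OF XY, of Y X'] AB bl by simp
  next
    assume le: "X \<sqsubseteq>\<^sub>b X'"
    have "(X', Y) \<notin> prec B" using prec_mono[of X' Y X Y] le AB bl prec_asym[OF XY] by auto
    then show ?thesis using precI[OF A(1) A(3) X' d(2)] by blast
  qed
qed

lemma prec_cong_left: assumes XY: "(X, Y) \<in> prec B" and X': "X' \<in> over B (butlast X)"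
    and d: "last X \<inter> last X' \<noteq> {}" "last Y \<inter> last X' = {}"
  shows "(X', Y) \<in> prec B"
proof -
  have A: "butlast X \<in> AB" "Y \<in> over B (butlast X)"
    using prec_over[OF XY] precD[OF XY] by auto
  have "(Y, X') \<notin> prec B"
  proof
    assume YX': "(Y, X') \<in> prec B"
    have "butlast X' = butlast X" using over_iff[OF A(1)] X' by blast
    then have "(Y, X) \<in> prec B"
      using prec_cong_right[OF YX', of X] prec_over[OF XY] precD[OF XY] d by (simp add: Int_commute)
    then show False using prec_asym XY by blast
  qed
  then show ?thesis using precI[OF A(1) X' A(2)] d(2) by blast
qed

end

section \<open>Sub-bracketings\<close>

definition triv :: "'a plane_tree \<Rightarrow> 'a bracket set" where
  "triv T = {A. is_singleton_bracket T A \<or> is_max_bracket T A}"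

text \<open>Every bracketing below \<open>B\<close> has this form (\<open>le_restr\<close>), so
  below a fixed \<open>B\<close> comparing bracketings is comparing sets of brackets.\<close>

definition restr :: "'a bracketing \<Rightarrow> 'a bracket set \<Rightarrow> 'a bracketing" where
  "restr B D = \<lparr> brk = (\<lambda>k. brk B k \<inter> D), prec = prec B \<inter> D \<times> D \<rparr>"

lemma brk_restr [simp]: "brk (restr B D) k = brk B k \<inter> D"
  and prec_restr [simp]: "prec (restr B D) = prec B \<inter> D \<times> D"
  unfolding restr_def by simp_all

lemma all_brk_restr [simp]: "all_brk (restr B D) = all_brk B \<inter> D"
  unfolding all_brk_def by auto

lemma over_restr [simp]: "over (restr B D) A = over B A \<inter> D"
  unfolding over_def by auto

lemma le_brk: "B1 \<preceq>\<^sub>K B2 \<Longrightarrow> brk B1 k \<subseteq> brk B2 k"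
  and le_all_brk: "B1 \<preceq>\<^sub>K B2 \<Longrightarrow> all_brk B1 \<subseteq> all_brk B2"
  and le_prec: "B1 \<preceq>\<^sub>K B2 \<Longrightarrow> (X, Y) \<in> prec B1 \<longleftrightarrow> (X, Y) \<in> prec B2 \<and> X \<in> all_brk B1 \<and> Y \<in> all_brk B1"
  and le_over: "B1 \<preceq>\<^sub>K B2 \<Longrightarrow> over B1 A \<subseteq> over B2 A"
  unfolding bracketing_le_def all_brk_def over_def by blast+

lemma le_antisym: "B1 \<preceq>\<^sub>K B2 \<Longrightarrow> B2 \<preceq>\<^sub>K B1 \<Longrightarrow> B1 = (B2 :: 'a bracketing)"
proof (rule bracketing.equality)
  assume a: "B1 \<preceq>\<^sub>K B2" "B2 \<preceq>\<^sub>K B1"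
  show "brk B1 = brk B2" using le_brk[OF a(1)] le_brk[OF a(2)] by (intro ext subset_antisym)
  show "prec B1 = prec B2" using le_prec[OF a(1)] le_prec[OF a(2)] by auto
qed simp

lemma le_refl: "prec B \<subseteq> all_brk B \<times> all_brk B \<Longrightarrow> B \<preceq>\<^sub>K B"
  unfolding bracketing_le_def by blast

lemma le_trans: "B1 \<preceq>\<^sub>K B2 \<Longrightarrow> B2 \<preceq>\<^sub>K B3 \<Longrightarrow> B1 \<preceq>\<^sub>K B3"
  using le_all_brk[of B1 B2] unfolding bracketing_le_def by blast

context bing
begin

lemma psub_over: "A \<in> AB \<Longrightarrow> X \<in> over B A \<Longrightarrow> Y \<in> over B A \<Longrightarrow> Y \<sqsubset>\<^sub>b X \<longleftrightarrow> last Y \<subset> last X"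
  unfolding bracket_psub_def using over_sub over_last_inj by blast

lemma over_last_nth: "A \<in> brk B k \<Longrightarrow> X \<in> over B A \<Longrightarrow> last X = X ! Suc k"
  using br_last br over_brk by blast

lemma sb_over: "A \<in> AB \<Longrightarrow> sing A \<Longrightarrow> v \<in> fib A \<Longrightarrow> sb v \<in> over B A \<and> v \<in> V"
proof -
  assume A: "A \<in> AB" "sing A" "v \<in> fib A"
  then obtain k where k: "A \<in> brk B k" "is_bracket T k A" by (metis ABE)
  obtain u where u: "u \<in> lev k" "A = sb u" "last A = {u}" using singE[OF A(2) k(2)] by blast
  have v: "v \<in> set (ch u)" using A(3) u unfolding fib_def by simp
  then have "v \<in> V" "butlast (sb v) = A" using ch_in butlast_sb u in_lev by auto
  then show ?thesis using over_iff[OF A(1)] sb_AB by blast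
qed

lemma mx_over: "A \<in> brk B k \<Longrightarrow> ismx A \<Longrightarrow> v \<in> fib A \<Longrightarrow> mx (Suc k) \<in> over B A \<and> v \<in> lev (Suc k)"
proof -
  assume A: "A \<in> brk B k" "ismx A" "v \<in> fib A"
  have "v \<in> lev (Suc k)" using A fib_iff' by blast
  moreover have "A = mx k" using ismx_iff[OF br[OF A(1)]] A by blast
  ultimately show ?thesis using over_brk[OF A(1)] mx_brk lev_le by simp
qed

lemma over_mx_last: "A \<in> brk B k \<Longrightarrow> X \<in> over B A \<Longrightarrow> ismx X \<Longrightarrow> X = mx (Suc k)"
  using ismx_iff br over_brk by blast

text \<open>The remaining axioms pass to subsets; only 1, 2, 4a and 4b ask for brackets to be
  present. 4a and 4b are assumed only where trivial brackets do not supply the witness: over a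
  singleton the singletons of the children do, and the next maximum covers the fibre of a
  maximum.\<close>

lemma restr_bracketing:
  assumes triv: "triv T \<subseteq> D"
    and pr: "\<And>A. A \<in> AB \<Longrightarrow> A \<in> D \<Longrightarrow> 2 \<le> length A \<Longrightarrow> butlast A \<in> D"
    and cov: "\<And>A v. A \<in> AB \<Longrightarrow> A \<in> D \<Longrightarrow> nontrivial T A \<Longrightarrow> v \<in> fib A \<Longrightarrow>
                \<exists>X\<in>over B A. X \<in> D \<and> v \<in> last X"
    and sm: "\<And>A X Y v. A \<in> AB \<Longrightarrow> A \<in> D \<Longrightarrow> \<not> sing A \<Longrightarrow> X \<in> over B A \<Longrightarrow> X \<in> D \<Longrightarrow>
                Y \<in> over B A \<Longrightarrow> Y \<in> D \<Longrightarrow> last Y \<subset> last X \<Longrightarrow> v \<in> last X \<Longrightarrow>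
                \<exists>Z\<in>over B A. Z \<in> D \<and> v \<in> last Z \<and> last Z \<subset> last X"
  shows "is_bracketing T (restr B D)"
proof -
  have tD: "sing A \<Longrightarrow> A \<in> D" "ismx A \<Longrightarrow> A \<in> D" for A using triv unfolding triv_def by auto
  have cov': "\<exists>X\<in>over B A \<inter> D. v \<in> last X" if A: "A \<in> brk B k \<inter> D" and v: "v \<in> fib A" for A v k
  proof -
    have AB: "A \<in> AB" using A brk_iff by blast
    consider "sing A" | "ismx A" | "nontrivial T A" unfolding nontrivial_def by blast
    then show ?thesis
    proof cases
      case 1
      then have "sb v \<in> over B A" "v \<in> V" using sb_over[OF AB] v by auto
      then show ?thesis using tD sing_sb last_sb by (metis IntI singletonI)
    next
      case 2
      then have "mx (Suc k) \<in> over B A" "v \<in> lev (Suc k)" using mx_over A v by auto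
      moreover have "mx (Suc k) \<in> D" using tD calculation lev_le unfolding is_max_bracket_def by blast
      ultimately show ?thesis by (metis IntI last_mx)
    next
      case 3
      then show ?thesis using cov[OF AB _ 3 v] A by blast
    qed
  qed
  have sm': "\<exists>Z\<in>over B A \<inter> D. v \<in> last Z \<and> last Z \<subset> last X"
    if A: "A \<in> brk B k \<inter> D" and X: "X \<in> over B A \<inter> D" and Y: "Y \<in> over B A \<inter> D" "last Y \<subset> last X"
      and v: "v \<in> last X" for A X Y v k
  proof -
    have AB: "A \<in> AB" using A brk_iff by blast
    show ?thesis
    proof (cases "sing A")
      case True
      have "v \<in> fib A" using over_fib AB X v by blast
      then have s: "sb v \<in> over B A" "v \<in> V" using sb_over[OF AB True] by auto
      have "last Y \<noteq> {}" using last_ne over_AB AB Y by blast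
      then have "last X \<noteq> {v}" using Y(2) by (metis psubset_eq subset_singletonD)
      then have "{v} \<subset> last X" using v by blast
      then have "sb v \<in> over B A \<inter> D" "v \<in> last (sb v)" "last (sb v) \<subset> last X"
        using s tD sing_sb last_sb by auto
      then show ?thesis by blast
    next
      case False
      then show ?thesis using sm[OF AB _ False _ _ _ _ Y(2) v] A X Y by blast
    qed
  qed
  have c1: "\<forall>k. \<forall>A\<in>brk (restr B D) k. is_bracket T k A" using br by simp
  have c2: "prec (restr B D) \<subseteq> all_brk (restr B D) \<times> all_brk (restr B D)" using prec_AB by auto
  have c3: "irrefl (prec (restr B D))" using prec_neq unfolding irrefl_def by auto
  have c4: "trans (prec (restr B D))" using prec_trans unfolding trans_def by auto
  have c5: "\<forall>k\<le>tree_depth T. mx k \<in> brk (restr B D) k \<and> (\<forall>u\<in>lev k. sb u \<in> brk (restr B D) k)"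
  proof (intro allI impI conjI ballI)
    fix k assume k: "k \<le> tree_depth T"
    show "mx k \<in> brk (restr B D) k" using mx_brk[OF k] tD k unfolding is_max_bracket_def by auto
    fix u assume u: "u \<in> lev k"
    then have "u \<in> V" using in_lev by blast
    then show "sb u \<in> brk (restr B D) k" using sb_brk[OF u] tD(1)[OF sing_sb] by simp
  qed
  have c6: "\<forall>k\<ge>1. \<forall>A\<in>brk (restr B D) k. proj A \<in> brk (restr B D) (k - 1)"
  proof (intro allI impI ballI)
    fix k A assume k: "1 \<le> (k::nat)" and A: "A \<in> brk (restr B D) k"
    obtain j where j: "k = Suc j" using k by (cases k) auto
    have "A \<in> brk B (Suc j)" "A \<in> D" using A j by auto
    then show "proj A \<in> brk (restr B D) (k - 1)" using butlast_brk pr[of A] brk_iff j by auto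
  qed
  have c7: "\<forall>k. \<forall>A1\<in>brk (restr B D) k. \<forall>A2\<in>brk (restr B D) k.
      A1 ! k \<inter> A2 ! k \<noteq> {} \<longrightarrow> A1 \<sqsubseteq>\<^sub>b A2 \<or> A2 \<sqsubseteq>\<^sub>b A1"
    unfolding brk_restr using nested_ax by blast
  have c8: "\<forall>k\<in>{1..tree_depth T}. \<forall>A\<in>brk (restr B D) (k - 1).
        (\<Union>A'\<in>over (restr B D) A. A' ! k) = (\<Union>u\<in>A ! (k - 1). set (kids T u))"
  proof (intro ballI)
    fix k A assume k: "k \<in> {1..tree_depth T}" and A: "A \<in> brk (restr B D) (k - 1)"
    obtain j where j: "k = Suc j" using k by (cases k) auto
    have A': "A \<in> brk B j \<inter> D" using A j by simp
    have AB: "A \<in> AB" using A' brk_iff by blast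
    have "(\<Union>A'\<in>over B A \<inter> D. A' ! k) = (\<Union>A'\<in>over B A \<inter> D. last A')"
      using over_last_nth A' j by auto
    also have "\<dots> = fib A" using cov'[OF A'] over_fib[OF AB] by blast
    also have "\<dots> = (\<Union>u\<in>A ! (k - 1). set (kids T u))"
      unfolding fib_def using br_last br A' j by (metis IntD1 diff_Suc_1)
    finally show "(\<Union>A'\<in>over (restr B D) A. A' ! k) = (\<Union>u\<in>A ! (k - 1). set (kids T u))" by simp
  qed
  have c9: "\<forall>k\<in>{1..tree_depth T}. \<forall>A\<in>brk (restr B D) (k - 1).
      \<forall>A1\<in>over (restr B D) A. \<forall>A2\<in>over (restr B D) A. A2 \<sqsubset>\<^sub>b A1 \<longrightarrow>
        (\<forall>u'\<in>A1 ! k. \<exists>A3\<in>over (restr B D) A. u' \<in> A3 ! k \<and> A3 \<sqsubset>\<^sub>b A1)"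
  proof (intro ballI impI)
    fix k A A1 A2 u'
    assume k: "k \<in> {1..tree_depth T}" and A: "A \<in> brk (restr B D) (k - 1)"
      and A1: "A1 \<in> over (restr B D) A" and A2: "A2 \<in> over (restr B D) A" and ps: "A2 \<sqsubset>\<^sub>b A1"
      and u': "u' \<in> A1 ! k"
    obtain j where j: "k = Suc j" using k by (cases k) auto
    have A': "A \<in> brk B j \<inter> D" using A j by simp
    have AB: "A \<in> AB" using A' brk_iff by blast
    have X: "A1 \<in> over B A \<inter> D" "A2 \<in> over B A \<inter> D" using A1 A2 by auto
    have lst: "last Z = Z ! k" if "Z \<in> over B A" for Z using over_last_nth A' j that by blast
    have "last A2 \<subset> last A1" using ps psub_over[OF AB] X by blast
    moreover have "u' \<in> last A1" using u' lst X by auto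
    ultimately obtain Z where "Z \<in> over B A \<inter> D" "u' \<in> last Z" "last Z \<subset> last A1"
      using sm'[OF A' X] by blast
    then show "\<exists>A3\<in>over (restr B D) A. u' \<in> A3 ! k \<and> A3 \<sqsubset>\<^sub>b A1"
      using lst psub_over[OF AB] X by auto
  qed
  have cmp: "comparable (restr B D) X Y \<longleftrightarrow> comparable B X Y" if "X \<in> D" "Y \<in> D" for X Y
    using that unfolding comparable_def by auto
  have c10: "\<forall>A1\<in>all_brk (restr B D). \<forall>A2\<in>all_brk (restr B D). A1 \<noteq> A2 \<longrightarrow>
        (comparable (restr B D) A1 A2 \<longleftrightarrow>
           (\<exists>k. A1 \<in> brk (restr B D) k \<and> A2 \<in> brk (restr B D) k \<and> proj A1 = proj A2 \<and> A1 ! k \<inter> A2 ! k = {}))"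
    using comparable_ax cmp by simp
  have c11: "\<forall>u\<in>verts T. \<forall>u1 u2. precedes (kids T u) u1 u2 \<longrightarrow> (sb u1, sb u2) \<in> prec (restr B D)"
  proof (intro ballI allI impI)
    fix u u1 u2 assume u: "u \<in> V" "precedes (ch u) u1 u2"
    then have "u1 \<in> V" "u2 \<in> V" using precedes_in ch_in by metis+
    then show "(sb u1, sb u2) \<in> prec (restr B D)" using prec_sb[OF u] tD(1)[OF sing_sb] by simp
  qed
  have c12: "\<forall>k\<in>{1..tree_depth T}. \<forall>A\<in>brk (restr B D) (k - 1). \<forall>A'\<in>brk (restr B D) (k - 1). A' \<sqsubseteq>\<^sub>b A \<longrightarrow>
        (\<forall>A1\<in>over (restr B D) A. \<forall>A2\<in>over (restr B D) A. \<forall>A1'\<in>over (restr B D) A'. \<forall>A2'\<in>over (restr B D) A'.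
           A1 \<noteq> A2 \<and> comparable (restr B D) A1 A2 \<and> A1' \<noteq> A2' \<and> comparable (restr B D) A1' A2' \<and>
           A1' \<sqsubseteq>\<^sub>b A1 \<and> A2' \<sqsubseteq>\<^sub>b A2 \<longrightarrow>
           ((A1, A2) \<in> prec (restr B D) \<longleftrightarrow> (A1', A2') \<in> prec (restr B D)))"
  proof (intro ballI impI, elim conjE)
    fix k A A' A1 A2 A1' A2'
    assume k: "k \<in> {1..tree_depth T}" and A: "A \<in> brk (restr B D) (k - 1)" "A' \<in> brk (restr B D) (k - 1)"
      and X: "A1 \<in> over (restr B D) A" "A2 \<in> over (restr B D) A"
        "A1' \<in> over (restr B D) A'" "A2' \<in> over (restr B D) A'"
      and c: "comparable (restr B D) A1 A2" "comparable (restr B D) A1' A2'" "A1' \<sqsubseteq>\<^sub>b A1" "A2' \<sqsubseteq>\<^sub>b A2"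
    have AB: "A' \<in> AB" using A(2) brk_iff by simp
    have X': "A1' \<in> AB" "A2' \<in> AB" "butlast A1' = butlast A2'" using X(3,4) over_iff[OF AB] by auto
    have D: "A1 \<in> D" "A2 \<in> D" "A1' \<in> D" "A2' \<in> D" using X by auto
    have "(A1', A2') \<in> prec B" if "(A1, A2) \<in> prec B" using prec_mono[OF that X' c(3,4)] .
    moreover have "(A2', A1') \<in> prec B" if "(A2, A1) \<in> prec B"
      using prec_mono[OF that X'(2,1) X'(3)[symmetric] c(4,3)] .
    ultimately show "(A1, A2) \<in> prec (restr B D) \<longleftrightarrow> (A1', A2') \<in> prec (restr B D)"
      using c(1) D prec_asym unfolding comparable_def by auto
  qed
  show ?thesis unfolding is_bracketing_def
    by (intro conjI) (fact c1 c2 c3 c4 c5 c6 c7 c8 c9 c10 c11 c12)+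
qed

lemma restr_le: "restr B D \<preceq>\<^sub>K B"
  unfolding bracketing_le_def using prec_AB by auto

lemma le_self: "B \<preceq>\<^sub>K B"
  using prec_AB by (intro le_refl) auto

lemma le_restr: assumes B': "is_bracketing T B'" and le: "B' \<preceq>\<^sub>K B"
  shows "B' = restr B (all_brk B')"
proof (rule bracketing.equality)
  interpret B': bing T B' by unfold_locales (rule B')
  show "brk B' = brk (restr B (all_brk B'))"
  proof
    fix k show "brk B' k = brk (restr B (all_brk B')) k"
      using le_brk[OF le, of k] B'.brk_iff brk_iff by auto
  qed
  show "prec B' = prec (restr B (all_brk B'))" using le_prec[OF le] by auto
qed simp

lemma le_iff: assumes "is_bracketing T B1" "B1 \<preceq>\<^sub>K B" "is_bracketing T B2" "B2 \<preceq>\<^sub>K B"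
  shows "B1 \<preceq>\<^sub>K B2 \<longleftrightarrow> all_brk B1 \<subseteq> all_brk B2"
proof
  assume s: "all_brk B1 \<subseteq> all_brk B2"
  have r: "B1 = restr B (all_brk B1)" "B2 = restr B (all_brk B2)" using le_restr assms by auto
  have "restr B (all_brk B1) \<preceq>\<^sub>K restr B (all_brk B2)"
    unfolding bracketing_le_def using s prec_AB by auto
  then show "B1 \<preceq>\<^sub>K B2" using r by simp
qed (rule le_all_brk)

lemma eq_iff: assumes "is_bracketing T B1" "B1 \<preceq>\<^sub>K B" "is_bracketing T B2" "B2 \<preceq>\<^sub>K B"
  shows "B1 = B2 \<longleftrightarrow> all_brk B1 = all_brk B2"
  using le_restr[OF assms(1,2)] le_restr[OF assms(3,4)] by metis

section \<open>The minimum bracketing and joins\<close>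

lemma triv_AB: "triv T \<subseteq> AB"
  using sing_AB ismx_AB unfolding triv_def by auto

lemma ismx_butlast: "ismx A \<Longrightarrow> 2 \<le> length A \<Longrightarrow> ismx (butlast A)"
proof -
  assume a: "ismx A" "2 \<le> length A"
  then obtain k where k: "k \<le> tree_depth T" "A = mx k" unfolding is_max_bracket_def by blast
  then obtain j where "k = Suc j" using a(2) by (cases k) auto
  then have "j \<le> tree_depth T" "butlast A = mx j" using k by auto
  then show ?thesis unfolding is_max_bracket_def by blast
qed

lemma over_triv_mx: assumes A: "A \<in> AB" "\<not> sing A" "X \<in> over B A" "X \<in> triv T"
  shows "ismx X"
proof -
  have "length X = Suc (length A)" "butlast X = A" "A \<noteq> []" using over_length over_iff A AB_ne by auto
  then have "2 \<le> length X" by (cases A) auto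
  then have "\<not> sing X" using sing_butlast A(2) \<open>butlast X = A\<close> by blast
  then show ?thesis using A(4) unfolding triv_def by blast
qed

lemma restr_triv: "is_bracketing T (restr B (triv T))"
proof (rule restr_bracketing)
  fix A assume A: "A \<in> AB" "A \<in> triv T" "2 \<le> length A"
  then show "butlast A \<in> triv T" unfolding triv_def using sing_butlast ismx_butlast by blast
next
  fix A X Y v
  assume a: "A \<in> AB" "\<not> sing A" "X \<in> over B A" "X \<in> triv T" "Y \<in> over B A" "Y \<in> triv T" "last Y \<subset> last X"
  then have "ismx X" "ismx Y" using over_triv_mx by blast+
  moreover obtain k where "A \<in> brk B k" using a(1) ABE by metis
  ultimately have "X = Y" using over_mx_last a by metis
  then show "\<exists>Z\<in>over B A. Z \<in> triv T \<and> v \<in> last Z \<and> last Z \<subset> last X" using a by blast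
qed (auto simp: triv_def nontrivial_def)

text \<open>A maximum meets every bracket of its level and is therefore comparable to none.
  Comparable trivial brackets are thus singletons of siblings, and axiom 5b fixes their order in
  every bracketing.\<close>

lemma prec_triv: assumes "(X, Y) \<in> prec B" "X \<in> triv T" "Y \<in> triv T" and B': "is_bracketing T B'"
  shows "(X, Y) \<in> prec B'"
proof -
  interpret B': bing T B' by unfold_locales (rule B')
  note P = prec_AB[OF assms(1)] precD[OF assms(1)] prec_over[OF assms(1)]
  obtain k where X: "X \<in> brk B (Suc k)" using P brk_iff[of X "length X - 2 + 1"] by auto
  have Y: "Y \<in> brk B (Suc k)" using X P brk_iff by simp
  have ne: "last X \<noteq> {}" "last Y \<noteq> {}" using last_ne P by blast+
  have "\<not> ismx X" "\<not> ismx Y"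
  proof -
    have "last X = lev (Suc k)" if "ismx X" using ismx_iff[OF br[OF X]] that by simp
    then show "\<not> ismx X" using last_lev[OF Y] ne P(4) by blast
    have "last Y = lev (Suc k)" if "ismx Y" using ismx_iff[OF br[OF Y]] that by simp
    then show "\<not> ismx Y" using last_lev[OF X] ne P(4) by blast
  qed
  then have s: "sing X" "sing Y" using assms unfolding triv_def by auto
  obtain u where u: "u \<in> lev (Suc k)" "X = sb u" "last X = {u}" using singE[OF s(1) br[OF X]] .
  obtain v where v: "v \<in> lev (Suc k)" "Y = sb v" "last Y = {v}" using singE[OF s(2) br[OF Y]] .
  have uv: "u \<in> set (ch (anc u k))" "v \<in> set (ch (anc v k))" "anc u k \<in> lev k" "anc v k \<in> lev k"
    using lev_Suc_anc u v by auto
  have "sb (anc u k) = sb (anc v k)" using butlast_sb_lev u v P(3) by metis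
  then have eq: "anc u k = anc v k" using sb_inj uv in_lev by blast
  have "u \<noteq> v" using P(4) u v by auto
  then have "precedes (ch (anc u k)) u v \<or> precedes (ch (anc u k)) v u"
    using precedes_total uv eq by metis
  moreover have "\<not> precedes (ch (anc u k)) v u"
    using prec_sb prec_asym[OF assms(1)] uv in_lev u v by blast
  ultimately show ?thesis using B'.prec_sb uv in_lev u v by blast
qed

lemma restr_triv_le: assumes B': "is_bracketing T B'" shows "restr B (triv T) \<preceq>\<^sub>K B'"
proof -
  interpret B': bing T B' by unfold_locales (rule B')
  have "brk B k \<inter> triv T \<subseteq> brk B' k" for k using brk_iff B'.brk_iff B'.triv_AB by blast
  moreover have "prec B \<inter> triv T \<times> triv T = prec B' \<inter> triv T \<times> triv T"
    using prec_triv[OF _ _ _ B'] B'.prec_triv[OF _ _ _ B] by auto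
  moreover have "AB \<inter> triv T = triv T" using triv_AB by blast
  ultimately show ?thesis unfolding bracketing_le_def by simp
qed

lemma min_eq: "min_bracketing T = restr B (triv T)"
  unfolding min_bracketing_def
proof (rule the_equality)
  show "restr B (triv T) \<in> bracketings T \<and> (\<forall>B'\<in>bracketings T. restr B (triv T) \<preceq>\<^sub>K B')"
    using restr_triv restr_triv_le unfolding bracketings_def by simp
next
  fix M assume M: "M \<in> bracketings T \<and> (\<forall>B'\<in>bracketings T. M \<preceq>\<^sub>K B')"
  then have "M \<preceq>\<^sub>K restr B (triv T)" using restr_triv unfolding bracketings_def by simp
  moreover have "restr B (triv T) \<preceq>\<^sub>K M" using restr_triv_le M unfolding bracketings_def by simp
  ultimately show "M = restr B (triv T)" by (rule le_antisym)
qed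

lemma min_bracketing: "is_bracketing T (min_bracketing T)"
  and min_le: "min_bracketing T \<preceq>\<^sub>K B"
  and all_brk_min: "all_brk (min_bracketing T) = triv T"
  using restr_triv restr_le[of "triv T"] triv_AB unfolding min_eq by auto

lemma nontrivial_triv: "nontrivial T A \<longleftrightarrow> A \<notin> triv T"
  unfolding nontrivial_def triv_def by auto

lemma min_iff: "B = min_bracketing T \<longleftrightarrow> (\<forall>A\<in>AB. \<not> nontrivial T A)"
proof
  assume "B = min_bracketing T"
  then show "\<forall>A\<in>AB. \<not> nontrivial T A" using all_brk_min nontrivial_triv by simp
next
  assume "\<forall>A\<in>AB. \<not> nontrivial T A"
  then have "AB = triv T" using triv_AB nontrivial_triv by blast
  then show "B = min_bracketing T"
    using eq_iff[OF B le_self min_bracketing min_le] all_brk_min by simp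
qed

text \<open>An upper bound of \<open>B1\<close> and \<open>B2\<close> has no freedom in ordering a
  bracket of one against a bracket of the other. Replace \<open>Y\<close> by the innermost bracket
  of \<open>B1\<close> around one of its vertices: the order is then visible inside
  \<open>B1\<close>, hence in \<open>J\<close>, where \<open>Y\<close> can be put back.\<close>

lemma prec_transfer: assumes B1: "is_bracketing T B1" "B1 \<preceq>\<^sub>K B" "B1 \<preceq>\<^sub>K J"
    and B2: "is_bracketing T B2" "B2 \<preceq>\<^sub>K B" "B2 \<preceq>\<^sub>K J" and J: "is_bracketing T J"
    and XY: "(X, Y) \<in> prec B" "X \<in> all_brk B1" "Y \<in> all_brk B2"
  shows "(X, Y) \<in> prec J"
proof -
  interpret B1: bing T B1 by unfold_locales (rule B1)
  interpret B2: bing T B2 by unfold_locales (rule B2)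
  interpret J: bing T J by unfold_locales (rule J)
  note P = prec_AB[OF XY(1)] precD[OF XY(1)] prec_over[OF XY(1)]
  let ?A = "butlast X"
  have A: "?A \<in> all_brk B1" "?A \<in> all_brk B2"
    using B1.butlast_AB[OF XY(2)] B2.butlast_AB[OF XY(3)] P by auto
  have AJ: "?A \<in> all_brk J" using A le_all_brk B1(3) by blast
  have X1: "X \<in> over B1 ?A" using B1.over_iff[OF A(1)] XY by blast
  have YJ: "Y \<in> over J ?A" using J.over_iff[OF AJ] XY P le_all_brk[OF B2(3)] by auto
  obtain u where u: "u \<in> last Y" using last_ne P by blast
  have uf: "u \<in> fib ?A" using over_fib P u by blast
  let ?Z = "B1.mb ?A u"
  have Z: "?Z \<in> over B1 ?A" "u \<in> last ?Z" using B1.mb_over B1.mb_in A uf by auto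
  have d: "last X \<inter> last ?Z = {}"
  proof (rule ccontr)
    assume "last X \<inter> last ?Z \<noteq> {}"
    then have "last ?Z \<subseteq> last X" using B1.mb_min[OF A(1) uf X1] by blast
    then show False using Z u P(4) by blast
  qed
  have ZB: "?Z \<in> over B ?A" "?Z \<in> over J ?A" using Z le_over B1 by blast+
  have "(X, ?Z) \<in> prec B" using prec_cong_right[OF XY(1)] ZB d Z u P by auto
  then have "(X, ?Z) \<in> prec B1" using le_prec[OF B1(2)] XY(2) B1.over_AB[OF A(1) Z(1)] by blast
  then have XZ: "(X, ?Z) \<in> prec J" using le_prec[OF B1(3)] by blast
  have "butlast ?Z = ?A" using J.over_iff[OF AJ] ZB by blast
  then show ?thesis using J.prec_cong_right[OF XZ, of Y] YJ Z u P by auto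
qed

text \<open>Below a common upper bound the join is a union of sets of brackets. The mixed instances
  of axiom 4b need an argument; that the union lies below every upper bound \<open>J\<close>, also
  one unrelated to \<open>B\<close>, is \<open>prec_transfer\<close>.\<close>

lemma join_eq:
  assumes B1: "is_bracketing T B1" "B1 \<preceq>\<^sub>K B" and B2: "is_bracketing T B2" "B2 \<preceq>\<^sub>K B"
  shows "is_bracketing T (restr B (all_brk B1 \<union> all_brk B2))"
    and "join T B1 B2 = restr B (all_brk B1 \<union> all_brk B2)"
proof -
  interpret B1: bing T B1 by unfold_locales (rule B1)
  interpret B2: bing T B2 by unfold_locales (rule B2)
  let ?U = "all_brk B1 \<union> all_brk B2"
  have half: "\<exists>Z\<in>over B A. Z \<in> ?U \<and> v \<in> last Z \<and> last Z \<subset> last X"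
    if Bi: "is_bracketing T Bi" "Bi \<preceq>\<^sub>K B" "is_bracketing T Bj" "Bj \<preceq>\<^sub>K B"
      and U: "all_brk Bi \<subseteq> ?U" "all_brk Bj \<subseteq> ?U"
      and A: "A \<in> AB" "X \<in> over B A" "Y \<in> over B A" and XY: "X \<in> all_brk Bi" "Y \<in> all_brk Bj"
      and v: "last Y \<subset> last X" "v \<in> last X" for Bi Bj A X Y v
  proof -
    interpret Bj: bing T Bj by unfold_locales (rule Bi)
    have "butlast Y = A" using over_iff A by blast
    have "length Y = Suc (length A)" "A \<noteq> []" using over_length A AB_ne[OF A(1)] by auto
    then have "2 \<le> length Y" by (cases A) auto
    note Y = \<open>butlast Y = A\<close> \<open>2 \<le> length Y\<close>
    then have Aj: "A \<in> all_brk Bj" using Bj.butlast_AB XY Y by blast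
    have vf: "v \<in> fib A" using over_fib A v by blast
    let ?Z = "Bj.mb A v"
    have Z: "?Z \<in> over Bj A" "v \<in> last ?Z" using Bj.mb_over Bj.mb_in Aj vf by auto
    have ZB: "?Z \<in> over B A" using Z le_over Bi by blast
    \<comment> \<open>Otherwise \<open>?Z\<close> would meet \<open>Y\<close>, lie inside it by
      minimality, and squeeze \<open>X\<close> into its proper subset \<open>Y\<close>.\<close>
    have "\<not> last X \<subseteq> last ?Z"
    proof
      assume s: "last X \<subseteq> last ?Z"
      have "last Y \<noteq> {}" using last_ne over_AB A by blast
      then have "last Y \<inter> last ?Z \<noteq> {}" using s v by blast
      then have "last ?Z \<subseteq> last Y"
        using Bj.mb_min[OF Aj vf, of Y] Bj.over_iff[OF Aj] XY \<open>butlast Y = A\<close> by blast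
      then show False using s v by blast
    qed
    then have "last ?Z \<subset> last X" using nested_over[OF A(1) ZB A(2)] Z v by blast
    then show ?thesis using ZB Z U(2) Bj.over_AB[OF Aj Z(1)] by blast
  qed
  show U: "is_bracketing T (restr B ?U)"
  proof (rule restr_bracketing)
    show "triv T \<subseteq> ?U" using B1.triv_AB by blast
  next
    fix A assume "A \<in> ?U" "2 \<le> length A"
    then show "butlast A \<in> ?U" using B1.butlast_AB B2.butlast_AB by blast
  next
    fix A v assume A: "A \<in> AB" "A \<in> ?U" "v \<in> fib A"
    then show "\<exists>X\<in>over B A. X \<in> ?U \<and> v \<in> last X"
      using B1.cover[of A v] B2.cover[of A v] le_over[OF B1(2), of A] le_over[OF B2(2), of A]
        B1.over_AB[of A] B2.over_AB[of A] by blast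
  next
    fix A X Y v
    assume a: "A \<in> AB" "X \<in> over B A" "X \<in> ?U" "Y \<in> over B A" "Y \<in> ?U" "last Y \<subset> last X" "v \<in> last X"
    then consider "X \<in> all_brk B1" "Y \<in> all_brk B1" | "X \<in> all_brk B1" "Y \<in> all_brk B2"
      | "X \<in> all_brk B2" "Y \<in> all_brk B1" | "X \<in> all_brk B2" "Y \<in> all_brk B2" by blast
    then show "\<exists>Z\<in>over B A. Z \<in> ?U \<and> v \<in> last Z \<and> last Z \<subset> last X"
    proof cases
      case 1 then show ?thesis using half[OF B1 B1 _ _ a(1,2,4)] a by blast
    next
      case 2 then show ?thesis using half[OF B1 B2 _ _ a(1,2,4)] a by blast
    next
      case 3 then show ?thesis using half[OF B2 B1 _ _ a(1,2,4)] a by blast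
    next
      case 4 then show ?thesis using half[OF B2 B2 _ _ a(1,2,4)] a by blast
    qed
  qed
  have sub: "all_brk B1 \<subseteq> AB" "all_brk B2 \<subseteq> AB" using le_all_brk B1 B2 by auto
  have ub: "B1 \<preceq>\<^sub>K restr B ?U" "B2 \<preceq>\<^sub>K restr B ?U"
    using le_iff[OF B1 U restr_le] le_iff[OF B2 U restr_le] sub by auto
  have lub: "restr B ?U \<preceq>\<^sub>K J" if J: "is_bracketing T J" "B1 \<preceq>\<^sub>K J" "B2 \<preceq>\<^sub>K J" for J
  proof -
    interpret J: bing T J by unfold_locales (rule J)
    have UJ: "?U \<subseteq> all_brk J" using le_all_brk J by blast
    have to: "(X, Y) \<in> prec J" if "(X, Y) \<in> prec B" "X \<in> ?U" "Y \<in> ?U" for X Y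
      using that prec_transfer[OF B1 J(2) B2 J(3) J(1)] prec_transfer[OF B2 J(3) B1 J(2) J(1)]
        prec_transfer[OF B1 J(2) B1 J(2) J(1)] prec_transfer[OF B2 J(3) B2 J(3) J(1)] by blast
    have from_J: "(X, Y) \<in> prec B" if "(X, Y) \<in> prec J" "X \<in> ?U" "Y \<in> ?U" for X Y
    proof -
      have "(X, Y) \<in> prec B \<or> (Y, X) \<in> prec B"
        using comparable_iff[of X Y] J.precD[OF that(1)] sub that by blast
      then show ?thesis using to that J.prec_asym by blast
    qed
    have "brk B k \<inter> ?U \<subseteq> brk J k" for k using brk_iff J.brk_iff UJ by blast
    moreover have "AB \<inter> ?U = ?U" using sub by blast
    ultimately show ?thesis unfolding bracketing_le_def using to from_J by auto
  qed
  show "join T B1 B2 = restr B ?U"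
    unfolding join_def
  proof (rule the_equality)
    show "restr B ?U \<in> bracketings T \<and> B1 \<preceq>\<^sub>K restr B ?U \<and> B2 \<preceq>\<^sub>K restr B ?U \<and>
        (\<forall>J'\<in>bracketings T. B1 \<preceq>\<^sub>K J' \<and> B2 \<preceq>\<^sub>K J' \<longrightarrow> restr B ?U \<preceq>\<^sub>K J')"
      using U ub lub unfolding bracketings_def by simp
  next
    fix J assume J: "J \<in> bracketings T \<and> B1 \<preceq>\<^sub>K J \<and> B2 \<preceq>\<^sub>K J \<and>
        (\<forall>J'\<in>bracketings T. B1 \<preceq>\<^sub>K J' \<and> B2 \<preceq>\<^sub>K J' \<longrightarrow> J \<preceq>\<^sub>K J')"
    then have "J \<preceq>\<^sub>K restr B ?U" using U ub unfolding bracketings_def by simp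
    moreover have "restr B ?U \<preceq>\<^sub>K J" using lub J unfolding bracketings_def by simp
    ultimately show "J = restr B ?U" by (rule le_antisym)
  qed
qed

end

section \<open>Weights and positions\<close>

context rpt
begin

text \<open>
  \<open>before B Y v\<close>: in every contraction of \<open>T\<close> whose vertices are brackets of \<open>B\<close>, among them \<open>Y\<close>,
  the vertex \<open>Y\<close> lies to the left of the image of \<open>v\<close>. Whether this happens does not depend on the
  contraction, which makes the position of the image of \<open>v\<close> linear in the chosen set of brackets.
\<close>

definition before :: "'a bracketing \<Rightarrow> 'a bracket \<Rightarrow> 'a \<Rightarrow> bool" where
  "before B Y v \<longleftrightarrow> (\<exists>j X. Suc j < length Y \<and> X \<in> over B (take (Suc j) Y) \<and>
     anc v (Suc j) \<in> last X \<and> (take (Suc (Suc j)) Y, X) \<in> prec B)"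

definition nsg :: "'a bracketing \<Rightarrow> nat \<Rightarrow> 'a \<Rightarrow> 'a bracket set" where
  "nsg B k z = {Y \<in> brk B k. \<not> sing Y \<and> z \<in> last Y}"

text \<open>Extends \<open>f\<close> to singleton brackets so that the values along each maximal chain add up to \<open>c\<close>.\<close>

definition wt :: "'a bracketing \<Rightarrow> real \<Rightarrow> ('a bracket \<Rightarrow> real) \<Rightarrow> 'a bracket \<Rightarrow> real" where
  "wt B c f A = (if sing A then c - (\<Sum>Y\<in>nsg B (length A - 1) (the_elem (last A)). f Y) else f A)"

text \<open>The total weight strictly to the left of \<open>v\<close>; with weight 1 on the vertices
  of a contraction this is a position minus one.\<close>

definition ypos :: "'a bracketing \<Rightarrow> ('a bracket \<Rightarrow> real) \<Rightarrow> nat \<Rightarrow> 'a \<Rightarrow> real" where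
  "ypos B w k v = (\<Sum>Y | Y \<in> brk B k \<and> before B Y v. w Y)"

text \<open>The constant 0 makes the formula linear in \<open>f\<close>. The summand 1 in
  \<open>rho\<close> comes back through \<open>Gam_shift\<close> when the constant is changed to
  1.\<close>

definition Gam :: "'a bracketing \<Rightarrow> ('a bracket \<Rightarrow> real) \<Rightarrow> vec" where
  "Gam B f k i = (if (k, i) \<in> coords T
     then ypos B (wt B 0 f) k (nth_vertex T k i) - ypos B (wt B 0 f) k (nth_vertex T k (i + 1)) else 0)"

text \<open>Conservation is stated at vertices rather than along maximal chains, so no ends of
  chains have to be named. Signs are left free so that differences of flows are flows.\<close>

definition flow :: "'a bracketing \<Rightarrow> ('a bracket \<Rightarrow> real) \<Rightarrow> bool" where
  "flow B f \<longleftrightarrow> (\<forall>A. A \<notin> all_brk B \<longrightarrow> f A = 0) \<and> (\<forall>A. sing A \<longrightarrow> f A = 0) \<and>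
     (\<forall>A\<in>all_brk B. \<not> sing A \<longrightarrow> (\<forall>v\<in>fib A. f A = (\<Sum>X | X \<in> over B A \<and> v \<in> last X. f X)))"

lemma wt_sb: "z \<in> lev k \<Longrightarrow> wt B c f (sb z) = c - (\<Sum>Y\<in>nsg B k z. f Y)"
  unfolding wt_def using sing_sb by (simp add: in_lev last_sb)

lemma wt_nonsing: "\<not> sing A \<Longrightarrow> wt B c f A = f A"
  unfolding wt_def by simp

lemma wt_add: "wt B 0 (\<lambda>A. f A + g A) A = wt B 0 f A + wt B 0 g A"
  unfolding wt_def by (simp add: sum.distrib)

lemma wt_scale: "wt B 0 (\<lambda>A. t * f A) A = t * wt B 0 f A"
  unfolding wt_def by (simp add: sum_distrib_left)

lemma Gam_add: "Gam B (\<lambda>A. f A + g A) k i = Gam B f k i + Gam B g k i"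
  unfolding Gam_def ypos_def wt_add by (simp add: sum.distrib)

lemma Gam_scale: "Gam B (\<lambda>A. t * f A) k i = t * Gam B f k i"
  unfolding Gam_def ypos_def wt_scale by (simp add: sum_distrib_left right_diff_distrib)

lemma Gam_sum: "finite I \<Longrightarrow> Gam B (\<lambda>A. \<Sum>r\<in>I. c r * f r A) k i = (\<Sum>r\<in>I. c r * Gam B (f r) k i)"
proof (induction I rule: finite_induct)
  case empty
  then show ?case using Gam_scale[of B 0 "\<lambda>A. 0"] by simp
next
  case (insert x F)
  then show ?case by (simp add: Gam_add Gam_scale)
qed

end

section \<open>Positions under passage to a sub-bracketing\<close>

context bing
begin

lemma butlast_take_brk: "Y \<in> brk B k \<Longrightarrow> Suc j \<le> k \<Longrightarrow> butlast (take (Suc (Suc j)) Y) = take (Suc j) Y"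
  using brk_iff by (simp add: butlast_take)

lemma take_over: "Y \<in> brk B k \<Longrightarrow> Suc j \<le> k \<Longrightarrow> take (Suc (Suc j)) Y \<in> over B (take (Suc j) Y)"
proof -
  assume Y: "Y \<in> brk B k" "Suc j \<le> k"
  have "take (Suc j) Y \<in> AB" "take (Suc (Suc j)) Y \<in> AB" using Y take_AB brk_iff by auto
  then show ?thesis using over_iff butlast_take_brk[OF Y] by blast
qed

lemma last_take: "Y \<in> brk B k \<Longrightarrow> j \<le> k \<Longrightarrow> last (take (Suc j) Y) = Y ! j"
  using brk_iff by (simp add: take_Suc_conv_app_nth)

lemma anc_in: "Y \<in> brk B k \<Longrightarrow> v \<in> last Y \<Longrightarrow> j \<le> k \<Longrightarrow> anc v j \<in> Y ! j"
  using br_anc[OF br order_refl] br_last[OF br] by metis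

text \<open>The independence announced at \<open>before\<close>. The witness \<open>X\<close> may be
  missing in \<open>B'\<close>, but the innermost bracket of \<open>B'\<close> around the same
  vertex overlaps it and avoids the prefix of \<open>Y\<close>, so it lies on the same side.\<close>

lemma before_sub: assumes B': "is_bracketing T B'" "B' \<preceq>\<^sub>K B" and Y: "Y \<in> brk B' k"
  shows "before B' Y v \<longleftrightarrow> before B Y v"
proof
  assume "before B' Y v"
  then show "before B Y v" unfolding before_def using le_over[OF B'(2)] le_prec[OF B'(2)] by blast
next
  interpret B': bing T B' by unfold_locales (rule B')
  assume "before B Y v"
  then obtain j X where j: "Suc j < length Y" and X: "X \<in> over B (take (Suc j) Y)"
    "anc v (Suc j) \<in> last X" "(take (Suc (Suc j)) Y, X) \<in> prec B"
    unfolding before_def by blast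
  let ?A = "take (Suc j) Y" and ?Y = "take (Suc (Suc j)) Y" and ?u = "anc v (Suc j)"
  have jk: "Suc j \<le> k" using j Y B'.brk_iff by simp
  have A: "?A \<in> all_brk B'" using B'.take_AB Y B'.brk_iff by simp
  then have AB: "?A \<in> AB" using le_all_brk B' by blast
  have u: "?u \<in> fib ?A" using over_fib[OF AB X(1)] X by blast
  let ?Z = "B'.mb ?A ?u"
  have Z: "?Z \<in> over B' ?A" "?u \<in> last ?Z" using B'.mb_over B'.mb_in A u by auto
  have Y': "?Y \<in> over B' ?A" using B'.take_over[OF Y jk] .
  have d: "last ?Y \<inter> last ?Z = {}"
  proof (rule ccontr)
    assume "last ?Y \<inter> last ?Z \<noteq> {}"
    then have "last ?Z \<subseteq> last ?Y" using B'.mb_min[OF A u Y'] by blast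
    then show False using Z X precD[OF X(3)] by blast
  qed
  have "butlast X = ?A" using over_iff[OF AB] X(1) by blast
  then have "?Z \<in> over B (butlast X)" using subsetD[OF le_over[OF B'(2)] Z(1)] by simp
  then have "(?Y, ?Z) \<in> prec B" using prec_cong_right[OF X(3) _ _ d] Z X by blast
  then have "(?Y, ?Z) \<in> prec B'"
    using le_prec[OF B'(2)] B'.over_AB[OF A Z(1)] B'.over_AB[OF A Y'] by blast
  then show "before B' Y v" unfolding before_def using j Z by blast
qed

text \<open>Witnesses over a singleton can be replaced by singletons of children, whose order is
  that of siblings. Hence the singletons counted in \<open>ypos\<close> measure a position in
  \<open>T\<close> itself.\<close>

lemma before_sb: assumes z: "z \<in> lev k" and v: "v \<in> lev k"
  shows "before B (sb z) v \<longleftrightarrow> lex_less T z v"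
proof -
  have zV: "z \<in> V" "dep z = k" and vV: "v \<in> V" using z v in_lev by auto
  have take_z: "take (Suc j) (sb z) = sb (anc z j)" if "j \<le> k" for j using take_sb zV that by simp
  show ?thesis
  proof
    assume "before B (sb z) v"
    then obtain j X where j: "Suc j < length (sb z)" and X: "X \<in> over B (take (Suc j) (sb z))"
      "anc v (Suc j) \<in> last X" "(take (Suc (Suc j)) (sb z), X) \<in> prec B"
      unfolding before_def by blast
    have jk: "Suc j \<le> k" using j zV by simp
    let ?p = "anc z j" and ?a = "anc z (Suc j)" and ?b = "anc v (Suc j)"
    have p: "?p \<in> lev j" "anc v j \<in> lev j" "?a \<in> lev (Suc j)" "?b \<in> lev (Suc j)"
      using anc_lev z v jk by auto
    have pAB: "sb ?p \<in> AB" using sb_AB p in_lev by blast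
    have X1: "X \<in> over B (sb ?p)" using X take_z jk by simp
    have "?b \<in> fib (sb ?p)" using over_fib[OF pAB X1] X by blast
    then have b: "?b \<in> set (ch ?p)" unfolding fib_def using last_sb p in_lev by simp
    have eq: "anc v j = ?p" using b anc_parent[OF p(1) b] anc_anc[OF vV, of j "Suc j"] by simp
    have a: "?a \<in> set (ch ?p)" using anc_Suc zV jk by simp
    have aX: "(sb ?a, X) \<in> prec B" using X take_z jk by simp
    have bX: "sb ?b \<in> over B (butlast X)" using over_iff[OF pAB] X1 butlast_sb sb_AB b p in_lev by metis
    have lb: "last (sb ?a) = {?a}" "last (sb ?b) = {?b}" using last_sb p in_lev by auto
    have "?a \<noteq> ?b" using X(2) precD(3)[OF aX] lb by auto
    then have "(sb ?a, sb ?b) \<in> prec B"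
      using prec_cong_right[OF aX bX] X(2) lb by simp
    moreover have "?p \<in> V" using p in_lev by blast
    ultimately have "precedes (ch ?p) ?a ?b"
      using precedes_total[OF a b] prec_sb prec_asym prec_neq by metis
    then show "lex_less T z v" using lex_anc[OF z v] eq jk by (metis Suc_le_eq)
  next
    assume "lex_less T z v"
    then obtain j where j: "j < k" and eq: "anc z j = anc v j"
      and pr: "precedes (ch (anc z j)) (anc z (Suc j)) (anc v (Suc j))"
      using lex_anc[OF z v] by blast
    let ?b = "anc v (Suc j)"
    have p: "anc z j \<in> V" using anc_V zV by blast
    have b: "?b \<in> set (ch (anc z j))" using precedes_in[OF pr] by blast
    have pr': "(sb (anc z (Suc j)), sb ?b) \<in> prec B" using prec_sb[OF p pr] .
    have "sb ?b \<in> over B (sb (anc z j))"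
      using over_iff[OF sb_AB[OF p]] butlast_sb[OF p b] sb_AB[OF anc_V[OF vV]] by blast
    then show "before B (sb z) v"
      unfolding before_def using pr' j zV take_z[of j] take_z[of "Suc j"] last_sb[OF anc_V[OF vV]]
      by (intro exI[of _ j] exI[of _ "sb ?b"]) auto
  qed
qed

lemma finite_nsg [simp]: "finite (nsg B k z)"
  unfolding nsg_def by simp

text \<open>The new case is a singleton \<open>sb u\<close>. The nonsingleton brackets through a
  child \<open>v\<close> are those directly above \<open>sb u\<close> (\<open>?P0\<close>) and those
  above a nonsingleton bracket through \<open>u\<close> (\<open>?P1\<close>). By conservation
  \<open>?P1\<close> adds up to the nonsingleton weight at \<open>u\<close>, so the values chosen in
  \<open>wt\<close> balance.\<close>

lemma wt_flow: assumes f: "flow B f" and A: "A \<in> AB" and v: "v \<in> fib A"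
  shows "wt B c f A = (\<Sum>X | X \<in> over B A \<and> v \<in> last X. wt B c f X)"
proof (cases "sing A")
  case False
  have "\<not> sing X" if X: "X \<in> over B A" for X
  proof -
    have "length X = Suc (length A)" "butlast X = A" "A \<noteq> []" using over_length over_iff A X AB_ne by auto
    then have "2 \<le> length X" by (cases A) auto
    then show ?thesis using sing_butlast False \<open>butlast X = A\<close> by blast
  qed
  then have "(\<Sum>X | X \<in> over B A \<and> v \<in> last X. wt B c f X) = (\<Sum>X | X \<in> over B A \<and> v \<in> last X. f X)"
    by (intro sum.cong) (auto simp: wt_nonsing)
  then show ?thesis using f A v False unfolding flow_def by (simp add: wt_nonsing)
next
  case True
  obtain k where k: "A \<in> brk B k" "is_bracket T k A" using A by (metis ABE)
  obtain u where u: "u \<in> lev k" "A = sb u" "last A = {u}" using singE[OF True k(2)] .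
  have uv: "v \<in> set (ch u)" using v u unfolding fib_def by simp
  have vl: "v \<in> lev (Suc k)" using uv u lev_Suc by blast
  let ?P0 = "{Y \<in> nsg B (Suc k) v. butlast Y = A}" and ?P1 = "{Y \<in> nsg B (Suc k) v. butlast Y \<noteq> A}"
  have bl: "butlast Y \<in> nsg B k u" if Y: "Y \<in> ?P1" for Y
  proof -
    have Yb: "Y \<in> brk B (Suc k)" "v \<in> last Y" using Y unfolding nsg_def by auto
    have b: "butlast Y \<in> brk B k" using butlast_brk Yb by blast
    have "v \<in> fib (butlast Y)" using over_fib[of "butlast Y" Y] over_brk[OF b] Yb b brk_iff by blast
    then have ub: "u \<in> last (butlast Y)" using fib_iff'[OF b] anc_parent[OF u(1) uv] by simp
    have "\<not> sing (butlast Y)"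
    proof
      assume "sing (butlast Y)"
      then obtain u' where "butlast Y = sb u'" "last (butlast Y) = {u'}" using singE br[OF b] by metis
      then show False using ub u Y by auto
    qed
    then show ?thesis using b ub unfolding nsg_def by blast
  qed
  have "(\<Sum>Y\<in>?P1. f Y) = (\<Sum>Q\<in>nsg B k u. \<Sum>Y | Y \<in> ?P1 \<and> butlast Y = Q. f Y)"
    using bl by (intro sum.group[symmetric]) auto
  also have "\<dots> = (\<Sum>Q\<in>nsg B k u. f Q)"
  proof (rule sum.cong[OF refl])
    fix Q assume Q: "Q \<in> nsg B k u"
    have Qb: "Q \<in> brk B k" "\<not> sing Q" "u \<in> last Q" using Q unfolding nsg_def by auto
    have QAB: "Q \<in> AB" using Qb brk_iff by blast
    have "{Y \<in> ?P1. butlast Y = Q} = {X \<in> over B Q. v \<in> last X}"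
    proof (intro equalityI subsetI)
      fix Y assume "Y \<in> {Y \<in> ?P1. butlast Y = Q}"
      then show "Y \<in> {X \<in> over B Q. v \<in> last X}" using over_brk[OF Qb(1)] unfolding nsg_def by blast
    next
      fix Y assume Y: "Y \<in> {X \<in> over B Q. v \<in> last X}"
      then have Y': "Y \<in> brk B (Suc k)" "butlast Y = Q" using over_brk[OF Qb(1)] by auto
      then have "\<not> sing Y" using sing_butlast[of Y] Qb brk_iff by auto
      then show "Y \<in> {Y \<in> ?P1. butlast Y = Q}" using Y Y' Qb True unfolding nsg_def by blast
    qed
    moreover have "v \<in> fib Q" using Qb(3) uv unfolding fib_def by blast
    ultimately show "(\<Sum>Y | Y \<in> ?P1 \<and> butlast Y = Q. f Y) = f Q"
      using f QAB Qb(2) unfolding flow_def by simp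
  qed
  finally have P1: "(\<Sum>Y\<in>?P1. f Y) = (\<Sum>Q\<in>nsg B k u. f Q)" .
  have "nsg B (Suc k) v = ?P0 \<union> ?P1" by blast
  then have split: "(\<Sum>Y\<in>nsg B (Suc k) v. f Y) = (\<Sum>Y\<in>?P0. f Y) + (\<Sum>Y\<in>?P1. f Y)"
    by (subst \<open>nsg B (Suc k) v = ?P0 \<union> ?P1\<close>, intro sum.union_disjoint) auto
  have sv: "sb v \<in> over B A" "v \<in> V" using sb_over[OF A True v] by auto
  have ov: "{X \<in> over B A. v \<in> last X} = insert (sb v) ?P0"
  proof (intro equalityI subsetI)
    fix X assume X: "X \<in> {X \<in> over B A. v \<in> last X}"
    then have X': "X \<in> brk B (Suc k)" "butlast X = A" "v \<in> last X" using over_brk[OF k(1)] by auto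
    show "X \<in> insert (sb v) ?P0"
    proof (cases "sing X")
      case True
      then obtain v' where "X = sb v'" "last X = {v'}" using singE br[OF X'(1)] by metis
      then show ?thesis using X' by auto
    next
      case False
      then show ?thesis using X' unfolding nsg_def by blast
    qed
  next
    fix X assume "X \<in> insert (sb v) ?P0"
    then show "X \<in> {X \<in> over B A. v \<in> last X}"
      using sv last_sb over_brk[OF k(1)] unfolding nsg_def by auto
  qed
  have nP: "sb v \<notin> ?P0" using sing_sb sv unfolding nsg_def by blast
  have "(\<Sum>X\<in>?P0. wt B c f X) = (\<Sum>X\<in>?P0. f X)"
    by (rule sum.cong) (auto simp: nsg_def wt_nonsing)
  then have "(\<Sum>X | X \<in> over B A \<and> v \<in> last X. wt B c f X) = wt B c f (sb v) + (\<Sum>X\<in>?P0. f X)"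
    unfolding ov using nP by simp
  also have "\<dots> = c - (\<Sum>Q\<in>nsg B k u. f Q)" using wt_sb[OF vl] split P1 by simp
  finally show ?thesis using wt_sb[OF u(1)] u by simp
qed

lemma wt_sub: assumes B': "is_bracketing T B'" "B' \<preceq>\<^sub>K B" and f: "\<And>A. A \<notin> all_brk B' \<Longrightarrow> f A = 0"
  shows "wt B' c f A = wt B c f A"
proof -
  interpret B': bing T B' by unfold_locales (rule B')
  have "(\<Sum>Y\<in>nsg B' k z. f Y) = (\<Sum>Y\<in>nsg B k z. f Y)" for k z
  proof (rule sum.mono_neutral_left)
    show "nsg B' k z \<subseteq> nsg B k z" using le_brk[OF B'(2)] unfolding nsg_def by blast
    show "\<forall>i\<in>nsg B k z - nsg B' k z. f i = 0" using f B'.brk_iff brk_iff unfolding nsg_def by blast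
  qed simp
  then show ?thesis unfolding wt_def by simp
qed

text \<open>A bracket of \<open>B\<close> missing in \<open>B'\<close> is not a singleton and
  carries no weight, while \<open>before\<close> agrees on the others. So the value does not depend
  on the cone in which \<open>f\<close> is considered.\<close>

lemma Gam_sub: assumes B': "is_bracketing T B'" "B' \<preceq>\<^sub>K B" and f: "\<And>A. A \<notin> all_brk B' \<Longrightarrow> f A = 0"
  shows "Gam B' f = Gam B f"
proof -
  interpret B': bing T B' by unfold_locales (rule B')
  have "ypos B' (wt B' 0 f) k v = ypos B (wt B 0 f) k v" for k v
    unfolding ypos_def
  proof (rule sum.mono_neutral_cong_left)
    show "{Y \<in> brk B' k. before B' Y v} \<subseteq> {Y \<in> brk B k. before B Y v}"
      using le_brk[OF B'(2)] before_sub[OF B'] by blast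
    show "\<forall>i\<in>{Y \<in> brk B k. before B Y v} - {Y \<in> brk B' k. before B' Y v}. wt B 0 f i = 0"
    proof
      fix Y assume Y: "Y \<in> {Y \<in> brk B k. before B Y v} - {Y \<in> brk B' k. before B' Y v}"
      then have n: "Y \<notin> brk B' k" using before_sub[OF B'] by blast
      then have "Y \<notin> all_brk B'" using Y brk_iff B'.brk_iff by blast
      then have "\<not> sing Y" "f Y = 0" using B'.sing_AB f by auto
      then show "wt B 0 f Y = 0" by (simp add: wt_nonsing)
    qed
  qed (use wt_sub[OF B' f] in auto)
  then show ?thesis unfolding Gam_def by (intro ext) simp
qed

text \<open>Only singletons feel \<open>c\<close>, and \<open>before_sb\<close> counts one of them
  for each vertex to the left of \<open>v\<close>.\<close>

lemma ypos_shift: assumes v: "v \<in> lev k"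
  shows "ypos B (wt B c f) k v = ypos B (wt B 0 f) k v + c * (real (pos T v) - 1)"
proof -
  let ?S = "{Y \<in> brk B k. before B Y v}" and ?L = "{z \<in> lev k. lex_less T z v}"
  have "wt B c f Y = wt B 0 f Y + (if sing Y then c else 0)" for Y unfolding wt_def by simp
  then have "ypos B (wt B c f) k v = ypos B (wt B 0 f) k v + (\<Sum>Y\<in>?S. if sing Y then c else 0)"
    unfolding ypos_def by (simp add: sum.distrib)
  also have "(\<Sum>Y\<in>?S. if sing Y then c else 0) = (\<Sum>Y | Y \<in> ?S \<and> sing Y. c)"
    by (subst sum.inter_filter[symmetric]) auto
  also have "{Y. Y \<in> ?S \<and> sing Y} = sb ` ?L"
  proof (intro equalityI subsetI)
    fix Y assume Y: "Y \<in> {Y. Y \<in> ?S \<and> sing Y}"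
    then obtain z where "z \<in> lev k" "Y = sb z" using singE[of Y k] br by blast
    then show "Y \<in> sb ` ?L" using Y before_sb v by blast
  next
    fix Y assume "Y \<in> sb ` ?L"
    then obtain z where z: "z \<in> lev k" "lex_less T z v" "Y = sb z" by blast
    then show "Y \<in> {Y. Y \<in> ?S \<and> sing Y}" using sb_brk before_sb[OF z(1) v] sing_sb in_lev by blast
  qed
  also have "(\<Sum>Y\<in>sb ` ?L. c) = c * real (card ?L)"
    using card_image[of sb ?L] sb_inj in_lev by (simp add: inj_on_def)
  finally show ?thesis using pos_lev[OF v] by simp
qed

lemma coords_nth: assumes "(k, i) \<in> coords T"
  shows "nth_vertex T k i \<in> lev k" "nth_vertex T k (i + 1) \<in> lev k"
    "pos T (nth_vertex T k i) = i" "pos T (nth_vertex T k (i + 1)) = i + 1"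
  using assms nth_vertex[of i k] nth_vertex[of "i + 1" k] unfolding coords_def by auto

lemma Gam_shift: assumes ki: "(k, i) \<in> coords T"
  shows "Gam B f k i =
    ypos B (wt B c f) k (nth_vertex T k i) - ypos B (wt B c f) k (nth_vertex T k (i + 1)) + c"
  using ki ypos_shift[OF coords_nth(1)[OF ki], of c f] ypos_shift[OF coords_nth(2)[OF ki], of c f]
    coords_nth(3,4)[OF ki] unfolding Gam_def by (simp add: algebra_simps)

end

section \<open>Metric bracketings as flows\<close>

context rpt
begin

text \<open>Maximum brackets may carry any sign; this is the line spanned by the vector of ones in
  \<open>tau\<close>.\<close>

definition cone :: "'a bracketing \<Rightarrow> ('a bracket \<Rightarrow> real) set" where
  "cone B = {f. flow B f \<and> (\<forall>A\<in>all_brk B. nontrivial T A \<longrightarrow> 0 \<le> f A)}"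

definition supp :: "'a bracketing \<Rightarrow> ('a bracket \<Rightarrow> real) \<Rightarrow> 'a bracketing" where
  "supp B f = restr B (triv T \<union> {A. 0 < f A})"

lemma coneD: assumes "f \<in> cone B"
  shows "flow B f" "\<And>A. nontrivial T A \<Longrightarrow> 0 \<le> f A" "\<And>A. A \<notin> all_brk B \<Longrightarrow> f A = 0" "\<And>A. sing A \<Longrightarrow> f A = 0"
proof -
  show "flow B f" using assms unfolding cone_def by blast
  show *: "A \<notin> all_brk B \<Longrightarrow> f A = 0" for A using assms unfolding cone_def flow_def by blast
  show "sing A \<Longrightarrow> f A = 0" for A using assms unfolding cone_def flow_def by blast
  show "nontrivial T A \<Longrightarrow> 0 \<le> f A" for A
    using assms * unfolding cone_def by (cases "A \<in> all_brk B") auto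
qed

lemma flowD: "flow B f \<Longrightarrow> A \<in> all_brk B \<Longrightarrow> \<not> sing A \<Longrightarrow> v \<in> fib A \<Longrightarrow>
    f A = (\<Sum>X | X \<in> over B A \<and> v \<in> last X. f X)"
  unfolding flow_def by blast

lemma flow_comb: assumes "flow B f" "flow B g" shows "flow B (\<lambda>A. a * f A + b * g A)"
proof -
  have "a * f A + b * g A = (\<Sum>X | X \<in> over B A \<and> v \<in> last X. a * f X + b * g X)"
    if "A \<in> all_brk B" "\<not> sing A" "v \<in> fib A" for A v
    using flowD[OF assms(1) that] flowD[OF assms(2) that] by (simp add: sum.distrib sum_distrib_left)
  then show ?thesis using assms unfolding flow_def by simp
qed

lemma cone_comb: assumes "f \<in> cone B" "g \<in> cone B" "0 \<le> a" "0 \<le> b"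
  shows "(\<lambda>A. a * f A + b * g A) \<in> cone B"
  using assms flow_comb coneD(2)[OF assms(1)] coneD(2)[OF assms(2)] unfolding cone_def by simp

lemma cone_add: "f \<in> cone B \<Longrightarrow> g \<in> cone B \<Longrightarrow> (\<lambda>A. f A + g A) \<in> cone B"
  using cone_comb[of f B g 1 1] by simp

lemma cone_scale: "f \<in> cone B \<Longrightarrow> 0 \<le> t \<Longrightarrow> (\<lambda>A. t * f A) \<in> cone B"
  using cone_comb[of f B f t 0] by simp

lemma cone_zero: "(\<lambda>A. 0) \<in> cone B"
  unfolding cone_def flow_def by simp

lemma all_brk_supp: "all_brk (supp B f) = all_brk B \<inter> (triv T \<union> {A. 0 < f A})"
  unfolding supp_def by simp

end

section \<open>Conservation, supports and pointwise addition\<close>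

context bing
begin

lemma over_nonsing: "A \<in> AB \<Longrightarrow> \<not> sing A \<Longrightarrow> X \<in> over B A \<Longrightarrow> \<not> sing X"
proof -
  assume A: "A \<in> AB" "\<not> sing A" "X \<in> over B A"
  have "length X = Suc (length A)" "butlast X = A" "A \<noteq> []" using over_length over_iff A AB_ne by auto
  then have "2 \<le> length X" by (cases A) auto
  then show ?thesis using sing_butlast A(2) \<open>butlast X = A\<close> by blast
qed

lemma over_nontriv: "A \<in> AB \<Longrightarrow> nontrivial T A \<Longrightarrow> X \<in> over B A \<Longrightarrow> nontrivial T X"
proof -
  assume A: "A \<in> AB" "nontrivial T A" "X \<in> over B A"
  have "length X = Suc (length A)" "butlast X = A" "A \<noteq> []" using over_length over_iff A AB_ne by auto
  then have "2 \<le> length X" by (cases A) auto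
  then show ?thesis
    using sing_butlast[of X] ismx_butlast[of X] A(2) \<open>butlast X = A\<close> unfolding nontrivial_def by blast
qed

text \<open>Brackets through a common vertex are nested, so every bracket through a point
  \<open>v\<close> of the minimal \<open>Y\<close> is squeezed between \<open>Y\<close> and the
  maximal \<open>X\<close>. A maximal chain is thus the same as a point.\<close>

lemma chain_eq:
  assumes A: "A \<in> AB" and X: "X \<in> over B A" "\<forall>Z\<in>over B A. \<not> X \<sqsubset>\<^sub>b Z"
    and Y: "Y \<in> over B A" "\<forall>Z\<in>over B A. \<not> Z \<sqsubset>\<^sub>b Y" and le: "Y \<sqsubseteq>\<^sub>b X" and v: "v \<in> last Y"
  shows "{Z. Z \<in> over B A \<and> Y \<sqsubseteq>\<^sub>b Z \<and> Z \<sqsubseteq>\<^sub>b X} = {Z. Z \<in> over B A \<and> v \<in> last Z}"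
proof (intro equalityI subsetI)
  fix Z assume "Z \<in> {Z. Z \<in> over B A \<and> Y \<sqsubseteq>\<^sub>b Z \<and> Z \<sqsubseteq>\<^sub>b X}"
  then show "Z \<in> {Z. Z \<in> over B A \<and> v \<in> last Z}" using over_sub[OF A Y(1)] v by blast
next
  fix Z assume "Z \<in> {Z. Z \<in> over B A \<and> v \<in> last Z}"
  then have Z: "Z \<in> over B A" "v \<in> last Z" by auto
  have "v \<in> last X" using le over_sub[OF A Y(1) X(1)] v by blast
  then have ZX: "Z \<sqsubseteq>\<^sub>b X \<or> X \<sqsubseteq>\<^sub>b Z" "Z \<sqsubseteq>\<^sub>b Y \<or> Y \<sqsubseteq>\<^sub>b Z"
    using nested_over[OF A Z(1) X(1)] nested_over[OF A Z(1) Y(1)] over_sub[OF A] X Y Z v by blast+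
  have "X \<sqsubseteq>\<^sub>b Z \<longrightarrow> X = Z" "Z \<sqsubseteq>\<^sub>b Y \<longrightarrow> Z = Y" using X(2) Y(2) Z(1) unfolding bracket_psub_def by blast+
  then show "Z \<in> {Z. Z \<in> over B A \<and> Y \<sqsubseteq>\<^sub>b Z \<and> Z \<sqsubseteq>\<^sub>b X}" using ZX Z by auto
qed

lemma ex_chain: assumes A: "A \<in> AB" and v: "v \<in> fib A"
  obtains X Y where "X \<in> over B A" "\<forall>Z\<in>over B A. \<not> X \<sqsubset>\<^sub>b Z" "Y \<in> over B A" "\<forall>Z\<in>over B A. \<not> Z \<sqsubset>\<^sub>b Y"
    "Y \<sqsubseteq>\<^sub>b X" "v \<in> last Y"
proof -
  let ?Y = "mb A v"
  have Y: "?Y \<in> over B A" "v \<in> last ?Y" using mb_over mb_in A v by auto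
  have "finite (over B A)" by simp
  define n where "n = Max ((\<lambda>X. card (last X)) ` {X \<in> over B A. v \<in> last X})"
  have "n \<in> (\<lambda>X. card (last X)) ` {X \<in> over B A. v \<in> last X}"
    unfolding n_def using Y by (intro Max_in) auto
  then obtain X where X: "X \<in> over B A" "v \<in> last X" "n = card (last X)" by blast
  have nle: "card (last Z) \<le> n" if "Z \<in> over B A" "v \<in> last Z" for Z
    unfolding n_def using that by (intro Max_ge) auto
  have "\<not> X \<sqsubset>\<^sub>b Z" if Z: "Z \<in> over B A" for Z
  proof
    assume "X \<sqsubset>\<^sub>b Z"
    then have s: "last X \<subset> last Z" using psub_over[OF A Z X(1)] by blast
    then have "card (last X) < card (last Z)"
      by (rule psubset_card_mono[OF finite_last[OF over_AB[OF A Z]]])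
    then show False using nle[OF Z] s X by auto
  qed
  moreover have "\<not> Z \<sqsubset>\<^sub>b ?Y" if Z: "Z \<in> over B A" for Z
  proof
    assume "Z \<sqsubset>\<^sub>b ?Y"
    then have s: "last Z \<subset> last ?Y" using psub_over[OF A Y(1) Z] by blast
    moreover have "last Z \<noteq> {}" using last_ne over_AB A Z by blast
    ultimately show False using mb_min[OF A v Z] by blast
  qed
  moreover have "?Y \<sqsubseteq>\<^sub>b X" using mb_le[OF A X(1,2)] over_sub[OF A Y(1) X(1)] by blast
  ultimately show thesis using that X Y by blast
qed

text \<open>By \<open>chain_eq\<close> the chain condition is conservation at a point of the lower
  end, and by \<open>ex_chain\<close> every point of the fibre is reached in this way.\<close>

lemma metric_iff: "is_metric T (B, f) \<longleftrightarrow> flow B f \<and> (\<forall>A\<in>AB. nontrivial T A \<longrightarrow> 0 < f A)"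
proof -
  have "(\<forall>A\<in>over B At. \<forall>A'\<in>over B At.
           (\<forall>X\<in>over B At. \<not> A \<sqsubset>\<^sub>b X) \<and> (\<forall>X\<in>over B At. \<not> X \<sqsubset>\<^sub>b A') \<and> A' \<sqsubseteq>\<^sub>b A \<longrightarrow>
           f At = (\<Sum>X | X \<in> over B At \<and> A' \<sqsubseteq>\<^sub>b X \<and> X \<sqsubseteq>\<^sub>b A. f X)) \<longleftrightarrow>
        (\<forall>v\<in>fib At. f At = (\<Sum>X | X \<in> over B At \<and> v \<in> last X. f X))" (is "?l \<longleftrightarrow> ?r")
    if At: "At \<in> AB" for At
  proof
    assume l: ?l
    show ?r
    proof
      fix v assume "v \<in> fib At"
      from ex_chain[OF At this] obtain X Y where XY: "X \<in> over B At" "\<forall>Z\<in>over B At. \<not> X \<sqsubset>\<^sub>b Z"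
        "Y \<in> over B At" "\<forall>Z\<in>over B At. \<not> Z \<sqsubset>\<^sub>b Y" "Y \<sqsubseteq>\<^sub>b X" "v \<in> last Y" .
      then have "f At = (\<Sum>Z | Z \<in> over B At \<and> Y \<sqsubseteq>\<^sub>b Z \<and> Z \<sqsubseteq>\<^sub>b X. f Z)" using l by blast
      then show "f At = (\<Sum>X | X \<in> over B At \<and> v \<in> last X. f X)" unfolding chain_eq[OF At XY] .
    qed
  next
    assume r: ?r
    show ?l
    proof (intro ballI impI, elim conjE)
      fix X Y assume XY: "X \<in> over B At" "Y \<in> over B At" "\<forall>Z\<in>over B At. \<not> X \<sqsubset>\<^sub>b Z"
        "\<forall>Z\<in>over B At. \<not> Z \<sqsubset>\<^sub>b Y" "Y \<sqsubseteq>\<^sub>b X"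
      obtain v where v: "v \<in> last Y" using last_ne over_AB[OF At XY(2)] by blast
      then have "v \<in> fib At" using over_fib[OF At XY(2)] by blast
      then have "f At = (\<Sum>X | X \<in> over B At \<and> v \<in> last X. f X)" using r by blast
      then show "f At = (\<Sum>Z | Z \<in> over B At \<and> Y \<sqsubseteq>\<^sub>b Z \<and> Z \<sqsubseteq>\<^sub>b X. f Z)"
        unfolding chain_eq[OF At XY(1,3,2,4,5) v] .
    qed
  qed
  then have "(\<forall>At\<in>AB. \<not> sing At \<longrightarrow> (\<forall>A\<in>over B At. \<forall>A'\<in>over B At.
           (\<forall>X\<in>over B At. \<not> A \<sqsubset>\<^sub>b X) \<and> (\<forall>X\<in>over B At. \<not> X \<sqsubset>\<^sub>b A') \<and> A' \<sqsubseteq>\<^sub>b A \<longrightarrow>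
           f At = (\<Sum>X | X \<in> over B At \<and> A' \<sqsubseteq>\<^sub>b X \<and> X \<sqsubseteq>\<^sub>b A. f X))) \<longleftrightarrow>
      (\<forall>At\<in>AB. \<not> sing At \<longrightarrow> (\<forall>v\<in>fib At. f At = (\<Sum>X | X \<in> over B At \<and> v \<in> last X. f X)))"
    by blast
  then show ?thesis unfolding is_metric_def flow_def using B unfolding bracketings_def by auto
qed

text \<open>Over a bracket missing in \<open>B'\<close> there is no bracket of \<open>B'\<close> at
  all, by axiom 2, so extension by zero remains conserved.\<close>

lemma flow_extend:
  assumes B': "is_bracketing T B'" "B' \<preceq>\<^sub>K B" and f: "flow B' f"
  shows "flow B f"
proof -
  interpret B': bing T B' by unfold_locales (rule B')
  have z: "f A = 0" if "A \<notin> all_brk B'" for A using f that unfolding flow_def by blast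
  have "f A = (\<Sum>X | X \<in> over B A \<and> v \<in> last X. f X)" if A: "A \<in> AB" "\<not> sing A" "v \<in> fib A" for A v
  proof (cases "A \<in> all_brk B'")
    case True
    have "f A = (\<Sum>X | X \<in> over B' A \<and> v \<in> last X. f X)" using flowD[OF f True A(2,3)] .
    also have "\<dots> = (\<Sum>X | X \<in> over B A \<and> v \<in> last X. f X)"
    proof (rule sum.mono_neutral_left)
      show "{X. X \<in> over B' A \<and> v \<in> last X} \<subseteq> {X. X \<in> over B A \<and> v \<in> last X}" using le_over[OF B'(2)] by blast
      show "\<forall>i\<in>{X. X \<in> over B A \<and> v \<in> last X} - {X. X \<in> over B' A \<and> v \<in> last X}. f i = 0"
        using z B'.over_iff[OF True] over_iff[OF A(1)] by blast
    qed simp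
    finally show ?thesis .
  next
    case False
    have "f X = 0" if X: "X \<in> over B A" for X
    proof (rule z, rule notI)
      assume "X \<in> all_brk B'"
      moreover have "length X = Suc (length A)" "butlast X = A" "A \<noteq> []"
        using over_length over_iff A(1) X AB_ne by auto
      moreover from this have "2 \<le> length X" by (cases A) auto
      ultimately show False using B'.butlast_AB[of X] False by simp
    qed
    then show ?thesis using z False by simp
  qed
  then show ?thesis using f z B'.B le_all_brk[OF B'(2)] unfolding flow_def by blast
qed

lemma cone_extend:
  assumes B': "is_bracketing T B'" "B' \<preceq>\<^sub>K B" and f: "f \<in> cone B'"
  shows "f \<in> cone B"
  using flow_extend[OF B' coneD(1)[OF f]] coneD(2)[OF f] unfolding cone_def by blast

text \<open>Conservation yields each closure property. For axiom 4b compare the sums at a point of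
  \<open>Y\<close> and at \<open>v\<close>: brackets containing \<open>X\<close> occur in both, so
  if nothing positive around \<open>v\<close> were properly inside \<open>X\<close>, the point of
  \<open>Y\<close> would have strictly more.\<close>

lemma supp_bracketing: assumes f: "f \<in> cone B" shows "is_bracketing T (supp B f)"
  unfolding supp_def
proof (rule restr_bracketing)
  note c = coneD[OF f]
  let ?D = "triv T \<union> {A. 0 < f A}"
  have nn: "0 \<le> f X" if "A \<in> AB" "nontrivial T A" "X \<in> over B A" for A X
    using c(2) over_nontriv that by blast
  show "butlast A \<in> ?D" if A: "A \<in> AB" "A \<in> ?D" "2 \<le> length A" for A
  proof (cases "butlast A \<in> triv T")
    case False
    have bA: "butlast A \<in> AB" using butlast_AB A by blast
    have nb: "nontrivial T (butlast A)" using False nontrivial_triv by blast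
    have Ao: "A \<in> over B (butlast A)" using over_iff[OF bA] A by blast
    have nt: "nontrivial T A" using over_nontriv[OF bA nb Ao] .
    then have fA: "0 < f A" using A(2) nontrivial_triv by blast
    obtain v where v: "v \<in> last A" using last_ne A by blast
    then have "v \<in> fib (butlast A)" using over_fib[OF bA Ao] by blast
    then have "f (butlast A) = (\<Sum>X | X \<in> over B (butlast A) \<and> v \<in> last X. f X)"
      using flowD[OF c(1) bA] nb unfolding nontrivial_def by blast
    also have "\<dots> \<ge> f A" using nn[OF bA nb] Ao v by (intro member_le_sum) auto
    finally show ?thesis using fA by simp
  qed simp
  show "\<exists>X\<in>over B A. X \<in> ?D \<and> v \<in> last X" if A: "A \<in> AB" "A \<in> ?D" "nontrivial T A" "v \<in> fib A" for A v
  proof (rule ccontr)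
    assume n: "\<not> ?thesis"
    have "f A = (\<Sum>X | X \<in> over B A \<and> v \<in> last X. f X)"
      using flowD[OF c(1) A(1) _ A(4)] A(3) unfolding nontrivial_def by blast
    also have "\<dots> \<le> 0" using n by (intro sum_nonpos) force
    finally show False using A(2,3) nontrivial_triv by force
  qed
  show "\<exists>Z\<in>over B A. Z \<in> ?D \<and> v \<in> last Z \<and> last Z \<subset> last X"
    if A: "A \<in> AB" "A \<in> ?D" "\<not> sing A" and X: "X \<in> over B A" "X \<in> ?D" and Y: "Y \<in> over B A" "Y \<in> ?D"
      and YX: "last Y \<subset> last X" and v: "v \<in> last X" for A X Y v
  proof (rule ccontr)
    assume n: "\<not> ?thesis"
    obtain k where k: "A \<in> brk B k" using A(1) by (metis ABE)
    \<comment> \<open>The only trivial bracket over a nonsingleton one is the maximum, and its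
      weight may be negative. It contains \<open>X\<close>, so it cancels in the comparison.\<close>
    have big: "Z \<in> triv T \<Longrightarrow> last X \<subseteq> last Z" if "Z \<in> over B A" for Z
    proof -
      assume "Z \<in> triv T"
      then have "Z = mx (Suc k)" using over_triv_mx[OF A(1,3) that] over_mx_last[OF k that] by blast
      then show ?thesis using last_lev X(1) over_brk[OF k] by simp
    qed
    have small_nt: "nontrivial T Z" if "Z \<in> over B A" "\<not> last X \<subseteq> last Z" for Z
      using big that nontrivial_triv by blast
    obtain u where u: "u \<in> last Y" using last_ne over_AB[OF A(1) Y(1)] by blast
    have uv: "u \<in> fib A" "v \<in> fib A" using over_fib[OF A(1)] X(1) Y(1) u v by blast+
    let ?C = "{Z. Z \<in> over B A \<and> last X \<subseteq> last Z}"
    have sub: "?C \<subseteq> {Z. Z \<in> over B A \<and> x \<in> last Z}" if "x \<in> last X" for x using that by blast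
    have eq: "(\<Sum>Z | Z \<in> over B A \<and> x \<in> last Z. f Z) =
        (\<Sum>Z\<in>?C. f Z) + (\<Sum>Z | Z \<in> over B A \<and> x \<in> last Z \<and> \<not> last X \<subseteq> last Z. f Z)"
      if "x \<in> last X" for x
      using that by (subst sum.union_disjoint[symmetric]) (auto intro!: sum.cong)
    have v0: "(\<Sum>Z | Z \<in> over B A \<and> v \<in> last Z \<and> \<not> last X \<subseteq> last Z. f Z) = 0"
    proof (rule sum.neutral, rule ballI)
      fix Z assume "Z \<in> {Z. Z \<in> over B A \<and> v \<in> last Z \<and> \<not> last X \<subseteq> last Z}"
      then have Z: "Z \<in> over B A" "v \<in> last Z" "\<not> last X \<subseteq> last Z" by auto
      then have "last Z \<subset> last X" using nested_over[OF A(1) Z(1) X(1)] v by blast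
      then have "Z \<notin> ?D" using n Z by blast
      moreover have "0 \<le> f Z" using small_nt Z c(2) by blast
      ultimately show "f Z = 0" by simp
    qed
    have "f Y \<le> (\<Sum>Z | Z \<in> over B A \<and> u \<in> last Z \<and> \<not> last X \<subseteq> last Z. f Z)"
      using Y u YX small_nt c(2) by (intro member_le_sum) auto
    moreover have "0 < f Y" using small_nt[OF Y(1)] YX Y(2) nontrivial_triv by blast
    moreover have "u \<in> last X" using u YX by blast
    ultimately show False
      using flowD[OF c(1) A(1,3) uv(1)] flowD[OF c(1) A(1,3) uv(2)] eq[of u] eq[of v] v0 v by simp
  qed
qed (simp add: triv_def)

lemma supp_le: "supp B f \<preceq>\<^sub>K B"
  unfolding supp_def by (rule restr_le)

lemma supp_metric: assumes f: "f \<in> cone B" shows "is_metric T (supp B f, f)"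
proof -
  interpret S: bing T "supp B f" by unfold_locales (rule supp_bracketing[OF f])
  note c = coneD[OF f]
  have z: "f A = 0" if "A \<notin> all_brk (supp B f)" for A
  proof (cases "A \<in> AB")
    case True
    then have "A \<notin> triv T" "\<not> 0 < f A" using that unfolding all_brk_supp by auto
    then show ?thesis using c(2)[of A] nontrivial_triv by simp
  qed (rule c(3))
  have "f A = (\<Sum>X | X \<in> over (supp B f) A \<and> v \<in> last X. f X)"
    if A: "A \<in> all_brk (supp B f)" "\<not> sing A" "v \<in> fib A" for A v
  proof -
    have AB: "A \<in> AB" using A all_brk_supp by blast
    have "f A = (\<Sum>X | X \<in> over B A \<and> v \<in> last X. f X)" using flowD[OF c(1) AB A(2,3)] .
    also have "\<dots> = (\<Sum>X | X \<in> over (supp B f) A \<and> v \<in> last X. f X)"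
    proof (rule sum.mono_neutral_right)
      show "{X. X \<in> over (supp B f) A \<and> v \<in> last X} \<subseteq> {X. X \<in> over B A \<and> v \<in> last X}"
        using le_over[OF supp_le] by blast
      show "\<forall>i\<in>{X. X \<in> over B A \<and> v \<in> last X} - {X. X \<in> over (supp B f) A \<and> v \<in> last X}. f i = 0"
        using z S.over_iff[OF A(1)] over_iff[OF AB] by blast
    qed simp
    finally show ?thesis .
  qed
  then have "flow (supp B f) f" using z c(4) unfolding flow_def by blast
  moreover have "\<forall>A\<in>all_brk (supp B f). nontrivial T A \<longrightarrow> 0 < f A"
    unfolding all_brk_supp using nontrivial_triv by blast
  ultimately show ?thesis using S.metric_iff by blast
qed

lemma metric_supp: assumes M: "is_metric T M" "fst M \<preceq>\<^sub>K B"
  shows "snd M \<in> cone B" "fst M = supp B (snd M)"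
proof -
  obtain B' f where Bf: "M = (B', f)" by (cases M)
  have B': "is_bracketing T B'" using M Bf unfolding is_metric_def bracketings_def by auto
  interpret B': bing T B' by unfold_locales (rule B')
  have fl: "flow B' f" "\<forall>A\<in>all_brk B'. nontrivial T A \<longrightarrow> 0 < f A" using B'.metric_iff M Bf by auto
  then have "f \<in> cone B'" unfolding cone_def by force
  then have c: "f \<in> cone B" using cone_extend[OF B'] M Bf by simp
  then show "snd M \<in> cone B" using Bf by simp
  have "A \<in> all_brk B' \<longleftrightarrow> A \<in> AB \<and> (A \<in> triv T \<or> 0 < f A)" for A
  proof
    assume A: "A \<in> all_brk B'"
    then show "A \<in> AB \<and> (A \<in> triv T \<or> 0 < f A)"
      using le_all_brk[of B' B] M Bf fl nontrivial_triv by auto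
  next
    assume A: "A \<in> AB \<and> (A \<in> triv T \<or> 0 < f A)"
    then show "A \<in> all_brk B'" using B'.triv_AB fl(1) unfolding flow_def by force
  qed
  then have "all_brk B' = all_brk (supp B f)" unfolding all_brk_supp by blast
  then have "B' = supp B f"
    using eq_iff[OF B' _ supp_bracketing[OF c] supp_le] M Bf by simp
  then show "fst M = supp B (snd M)" using Bf by simp
qed

lemma tau_met_eq: "tau_met T B = (\<lambda>f. (supp B f, f)) ` cone B"
proof (intro equalityI subsetI)
  fix M assume "M \<in> tau_met T B"
  then have M: "is_metric T M" "fst M \<preceq>\<^sub>K B" unfolding tau_met_def by auto
  then have "M = (\<lambda>f. (supp B f, f)) (snd M)" using metric_supp(2)[OF M] by (metis prod.collapse)
  then show "M \<in> (\<lambda>f. (supp B f, f)) ` cone B" using metric_supp(1)[OF M] by blast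
next
  fix M assume "M \<in> (\<lambda>f. (supp B f, f)) ` cone B"
  then show "M \<in> tau_met T B" unfolding tau_met_def using supp_metric supp_le by auto
qed

lemma restr_AB: "restr B (AB \<inter> D) = restr B D"
  using prec_AB unfolding restr_def all_brk_def by auto

text \<open>On nontrivial brackets both summands are nonnegative, so nothing cancels and the
  supports unite. This makes the addition of metric bracketings pointwise.\<close>

lemma supp_add: assumes f: "f \<in> cone B" and g: "g \<in> cone B"
  shows "join T (supp B f) (supp B g) = supp B (\<lambda>A. f A + g A)"
proof -
  have "all_brk (supp B f) \<union> all_brk (supp B g) = AB \<inter> (triv T \<union> {A. 0 < f A + g A})"
  proof -
    have "A \<in> triv T \<or> 0 < f A \<or> 0 < g A \<longleftrightarrow> A \<in> triv T \<or> 0 < f A + g A" for A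
      using coneD(2)[OF f, of A] coneD(2)[OF g, of A] nontrivial_triv[of A] by auto
    then show ?thesis unfolding all_brk_supp by blast
  qed
  then show ?thesis
    using join_eq(2)[OF supp_bracketing[OF f] supp_le supp_bracketing[OF g] supp_le] restr_AB
    unfolding supp_def by simp
qed

lemma met_add_supp: "f \<in> cone B \<Longrightarrow> g \<in> cone B \<Longrightarrow>
    met_add T (supp B f, f) (supp B g, g) = (supp B (\<lambda>A. f A + g A), \<lambda>A. f A + g A)"
  unfolding met_add_def using supp_add by simp

lemma supp_zero: "supp B (\<lambda>A. 0) = min_bracketing T"
  unfolding supp_def min_eq by simp

lemma supp_scale: "0 < t \<Longrightarrow> supp B (\<lambda>A. t * f A) = supp B f"
  unfolding supp_def by (simp add: zero_less_mult_iff)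

lemma met_scale_supp: "0 \<le> t \<Longrightarrow> met_scale T t (supp B f, f) = (supp B (\<lambda>A. t * f A), \<lambda>A. t * f A)"
  unfolding met_scale_def using supp_zero supp_scale by auto

end

section \<open>Collisions as slices\<close>

lemma funpow_butlast: "(butlast ^^ l) xs = take (length xs - l) xs"
proof (induction l)
  case (Suc l)
  then show ?case by (simp add: butlast_take)
qed simp

context rpt
begin

text \<open>
  A slice consists of \<open>E0\<close> and brackets above it such that every member is partitioned by the
  members directly above it. These are the sets of essential brackets of collisions.
\<close>

definition slice :: "'a bracketing \<Rightarrow> 'a bracket \<Rightarrow> 'a bracket set \<Rightarrow> bool" where
  "slice B E0 F \<longleftrightarrow> E0 \<in> F \<and> F \<subseteq> all_brk B \<and> \<not> sing E0 \<and> sing (butlast E0) \<and>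
     (\<forall>E\<in>F. E = E0 \<or> butlast E \<in> F) \<and>
     (\<forall>E\<in>F. \<forall>v\<in>fib E. \<exists>!X. X \<in> F \<and> butlast X = E \<and> v \<in> last X)"

definition ind :: "'a bracket set \<Rightarrow> 'a bracket \<Rightarrow> real" where
  "ind F A = (if A \<in> F then 1 else 0)"

definition mxs :: "'a bracket set" where
  "mxs = {A. ismx A \<and> \<not> sing A}"

lemma sing_ne: "sing A \<Longrightarrow> A \<noteq> []"
  unfolding is_singleton_bracket_def by auto

end

section \<open>The collision spanned by a slice\<close>

locale sliced = bing T B for T :: "'a plane_tree" and B :: "'a bracketing" +
  fixes E0 :: "'a bracket" and F :: "'a bracket set"
  assumes sl: "slice B E0 F"
begin

lemma E0_in: "E0 \<in> F" and F_AB: "F \<subseteq> AB" and E0_ns: "\<not> sing E0" and E0_pr: "sing (butlast E0)"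
  and F_cl: "E \<in> F \<Longrightarrow> E = E0 \<or> butlast E \<in> F"
  and F_ex1: "E \<in> F \<Longrightarrow> v \<in> fib E \<Longrightarrow> \<exists>!X. X \<in> F \<and> butlast X = E \<and> v \<in> last X"
  using sl unfolding slice_def by blast+

lemma E0_len: "2 \<le> length E0"
  using sing_ne[OF E0_pr] by (cases E0 rule: rev_cases) (auto simp: Suc_le_eq)

lemma F_len: "E \<in> F \<Longrightarrow> length E0 \<le> length E \<and> take (length E0) E = E0"
proof (induction "length E" arbitrary: E rule: less_induct)
  case less
  show ?case
  proof (cases "E = E0")
    case False
    then have b: "butlast E \<in> F" using F_cl less.prems by blast
    have ne: "E \<noteq> []" "butlast E \<noteq> []" using F_AB AB_ne b less.prems by blast+
    then have lt: "length (butlast E) < length E" by (cases E) auto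
    have l: "length E0 \<le> length (butlast E)" "take (length E0) (butlast E) = E0"
      using less.hyps[OF lt b] by blast+
    then show ?thesis using ne by (cases E rule: rev_cases) auto
  qed simp
qed

lemma F_ns: "E \<in> F \<Longrightarrow> \<not> sing E"
  using F_len sing_take[of E "length E0"] E0_ns E0_len by fastforce

lemma F_over: "E \<in> F \<Longrightarrow> E \<noteq> E0 \<Longrightarrow> E \<in> over B (butlast E) \<and> butlast E \<in> AB"
  using F_cl F_AB over_iff by blast

lemma F_take: "E \<in> F \<Longrightarrow> length E0 \<le> i \<Longrightarrow> i \<le> length E \<Longrightarrow> take i E \<in> F"
proof (induction "length E" arbitrary: E rule: less_induct)
  case less
  show ?case
  proof (cases "i = length E")
    case False
    then have "E \<noteq> E0" using less.prems by auto
    then have b: "butlast E \<in> F" using F_cl less.prems by blast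
    have ne: "E \<noteq> []" using F_AB AB_ne less.prems by blast
    then have "take i (butlast E) \<in> F" using less.prems False b by (intro less.hyps) auto
    moreover have "take i (butlast E) = take i E" using less.prems False by (intro take_butlast) auto
    ultimately show ?thesis by simp
  qed (use less.prems in simp)
qed

text \<open>Members with different projections have disjoint fibres below them by induction, and
  those with the same projection partition its fibre. So on each level a slice passes through every
  vertex at most once, as the map to the contraction requires.\<close>

lemma F_unique: "E \<in> F \<Longrightarrow> E' \<in> F \<Longrightarrow> length E = length E' \<Longrightarrow> last E \<inter> last E' \<noteq> {} \<Longrightarrow> E = E'"
proof (induction "length E" arbitrary: E E' rule: less_induct)
  case less
  show ?case
  proof (cases "E = E0 \<or> E' = E0")
    case True
    then show ?thesis using F_len less.prems by (metis order_refl take_all)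
  next
    case False
    then have b: "butlast E \<in> F" "butlast E' \<in> F" using F_cl less.prems by blast+
    have o: "E \<in> over B (butlast E)" "E' \<in> over B (butlast E')" "butlast E \<in> AB" "butlast E' \<in> AB"
      using F_over less.prems False by auto
    obtain v where v: "v \<in> last E" "v \<in> last E'" using less.prems by blast
    have vf: "v \<in> fib (butlast E)" "v \<in> fib (butlast E')" using over_fib o v by blast+
    obtain k where k: "butlast E \<in> brk B k" using o ABE by metis
    have k': "butlast E' \<in> brk B k" using k o brk_iff less.prems by simp
    have "anc v k \<in> last (butlast E) \<inter> last (butlast E')" using fib_iff' k k' vf by blast
    moreover have "length (butlast E) < length E"
      using F_AB AB_ne less.prems by (cases E) auto
    ultimately have "butlast E = butlast E'"
      using less.hyps[of "butlast E" "butlast E'"] b less.prems by auto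
    then show ?thesis using F_ex1[OF b(1) vf(1)] less.prems v by metis
  qed
qed

text \<open>Above a member exactly one member passes through each point. Above any other
  nonsingleton bracket there is none, because going down inside \<open>F\<close> ends at
  \<open>E0\<close>, whose projection is a singleton.\<close>

lemma ind_flow: "flow B (ind F)"
proof -
  have "ind F A = (\<Sum>X | X \<in> over B A \<and> v \<in> last X. ind F X)"
    if A: "A \<in> AB" "\<not> sing A" "v \<in> fib A" for A v
  proof (cases "A \<in> F")
    case True
    then obtain X where X: "X \<in> F" "butlast X = A" "v \<in> last X"
      and u: "\<And>Y. Y \<in> F \<Longrightarrow> butlast Y = A \<Longrightarrow> v \<in> last Y \<Longrightarrow> Y = X"
      using F_ex1[OF True A(3)] by blast
    have Xo: "X \<in> over B A" using over_iff[OF A(1)] X F_AB by blast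
    have "(\<Sum>Y | Y \<in> over B A \<and> v \<in> last Y. ind F Y) = (\<Sum>Y\<in>{X}. ind F Y)"
    proof (rule sum.mono_neutral_right)
      show "\<forall>Y\<in>{Y. Y \<in> over B A \<and> v \<in> last Y} - {X}. ind F Y = 0"
        using u over_iff[OF A(1)] unfolding ind_def by auto
    qed (use Xo X in auto)
    then show ?thesis using True X unfolding ind_def by simp
  next
    case False
    have "X \<notin> F" if X: "X \<in> over B A" for X
    proof
      assume XF: "X \<in> F"
      have "butlast X = A" using over_iff[OF A(1)] X by blast
      then show False using F_cl[OF XF] False E0_pr A(2) by auto
    qed
    then show ?thesis using False unfolding ind_def by simp
  qed
  moreover have "ind F A = 0" if "sing A" for A using F_ns that unfolding ind_def by auto
  moreover have "ind F A = 0" if "A \<notin> AB" for A using F_AB that unfolding ind_def by auto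
  ultimately show ?thesis unfolding flow_def by blast
qed

lemma ind_cone: "ind F \<in> cone B"
  using ind_flow unfolding cone_def ind_def by simp

abbreviation "CF \<equiv> restr B (triv T \<union> F)"

lemma CF_supp: "CF = supp B (ind F)"
proof -
  have "{A. 0 < ind F A} = F" unfolding ind_def by auto
  then show ?thesis unfolding supp_def by simp
qed

lemma CF_bracketing: "is_bracketing T CF"
  unfolding CF_supp using supp_bracketing ind_cone by blast

lemma CF_le: "CF \<preceq>\<^sub>K B"
  by (rule restr_le)

lemma all_brk_CF: "all_brk CF = triv T \<union> F"
  using triv_AB F_AB by auto

text \<open>A slice may contain maximum brackets, for instance when the fused set is a whole level.
  A maximum meets everything on its level, so it is the only member there and a prefix of all longer
  members.\<close>

lemma mx_unique: assumes "E \<in> F" "A \<in> F" "ismx E" "length E \<le> length A" shows "take (length E) A = E"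
proof (rule F_unique)
  have l: "length E0 \<le> length E" using F_len assms by blast
  show A: "take (length E) A \<in> F" using F_take assms l by blast
  show "length (take (length E) A) = length E" using assms by simp
  obtain k where k: "E \<in> brk B k" using assms(1) F_AB ABE by (metis subsetD)
  then have "take (length E) A \<in> brk B k" using brk_iff A F_AB assms(4) by auto
  then have "last (take (length E) A) \<subseteq> lev k" by (rule last_lev)
  moreover have "last E = lev k" using ismx_iff[OF br[OF k]] assms by simp
  moreover have "last (take (length E) A) \<noteq> {}" using last_ne A F_AB by blast
  ultimately show "last (take (length E) A) \<inter> last E \<noteq> {}" by blast
qed (rule assms)

lemma ismx_take: "ismx E \<Longrightarrow> 0 < i \<Longrightarrow> ismx (take i E)"
proof -
  assume "ismx E" "0 < i"
  then obtain k where k: "k \<le> tree_depth T" "E = mx k" unfolding is_max_bracket_def by blast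
  obtain j where j: "i = Suc j" using \<open>0 < i\<close> by (cases i) auto
  show ?thesis
  proof (cases "j \<le> k")
    case True
    then have "take i E = mx j" "j \<le> tree_depth T" using take_mx k j by auto
    then show ?thesis unfolding is_max_bracket_def by blast
  next
    case False
    then show ?thesis using k j \<open>ismx E\<close> by simp
  qed
qed

text \<open>If \<open>E\<close> were longer than \<open>A\<close>, its truncation would be a maximum
  on the level of \<open>A\<close>, and \<open>A\<close> would have to equal it.\<close>

lemma mx_prefix: assumes "E \<in> F" "A \<in> F" "ismx E" "nontrivial T A" shows "take (length E) A = E"
proof (cases "length E \<le> length A")
  case False
  then have "take (length A) E \<in> F" using F_take F_len assms by simp
  moreover have "ismx (take (length A) E)" using ismx_take assms AB_ne F_AB by (metis length_greater_0_conv subsetD)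
  ultimately have "take (length A) A = take (length A) E"
    using mx_unique[of "take (length A) E" A] assms False by simp
  then show ?thesis using \<open>ismx (take (length A) E)\<close> assms(4) unfolding nontrivial_def by simp
qed (use mx_unique assms in blast)

context
  assumes nt: "\<exists>A\<in>F. nontrivial T A"
begin

lemma CF_ne_min: "CF \<noteq> min_bracketing T"
proof
  assume "CF = min_bracketing T"
  then have "triv T \<union> F = triv T" using all_brk_CF all_brk_min by metis
  then show False using nt nontrivial_triv by blast
qed

text \<open>A nontrivial bracket \<open>A\<close> of \<open>B'\<close> belongs to \<open>F\<close>,
  so its prefix \<open>E0\<close> is in \<open>B'\<close>. From there axiom 4a in \<open>B'\<close>
  forces the members of \<open>F\<close> level by level, as \<open>F\<close> has a single candidate
  around each vertex. Only a maximum outside \<open>F\<close> could step in; then the prefix of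
  \<open>A\<close> of the same length, which lies in \<open>F\<close> and in \<open>B'\<close>, has
  to coincide with it.\<close>

lemma CF_atom: assumes B': "is_bracketing T B'" "B' \<noteq> min_bracketing T" "B' \<preceq>\<^sub>K CF"
  shows "B' = CF"
proof -
  interpret B': bing T B' by unfold_locales (rule B')
  have B'B: "B' \<preceq>\<^sub>K B" using le_trans[OF B'(3) CF_le] .
  have sub: "all_brk B' \<subseteq> triv T \<union> F" using le_all_brk[OF B'(3)] all_brk_CF by simp
  obtain A where A: "A \<in> all_brk B'" "nontrivial T A" using B'(2) B'.min_iff by blast
  have AF: "A \<in> F" using A sub nontrivial_triv by blast
  have "E \<in> all_brk B'" if "E \<in> F" for E
    using that
  proof (induction "length E" arbitrary: E rule: less_induct)
    case less
    show ?case
    proof (cases "E = E0")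
      case True
      have "0 < length E0" using E0_len by linarith
      then show ?thesis using True B'.take_AB[OF A(1), of "length E0"] F_len[OF AF] by metis
    next
      case False
      let ?Q = "butlast E"
      have Q: "?Q \<in> F" "E \<in> over B ?Q" "?Q \<in> AB" using F_cl F_over False less.prems by auto
      have "length ?Q < length E" using F_AB AB_ne less.prems by (cases E) auto
      then have QB': "?Q \<in> all_brk B'" using less.hyps Q by blast
      obtain v where v: "v \<in> last E" using last_ne F_AB less.prems by blast
      have vf: "v \<in> fib ?Q" using over_fib Q v by blast
      let ?Z = "B'.mb ?Q v"
      have Z: "?Z \<in> over B' ?Q" "v \<in> last ?Z" using B'.mb_over B'.mb_in QB' vf by auto
      have ZB: "?Z \<in> over B ?Q" using Z le_over[OF B'B] by blast
      have Zb: "butlast ?Z = ?Q" "?Z \<in> all_brk B'" using B'.over_iff[OF QB'] Z by auto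
      have lZ: "length ?Z = length E" using over_length[OF Q(3)] ZB Q(2) by metis
      have "?Z \<in> F"
      proof (rule ccontr)
        assume n: "?Z \<notin> F"
        then have "?Z \<in> triv T" using sub Zb by blast
        then have m: "ismx ?Z" using over_triv_mx[OF Q(3) F_ns[OF Q(1)] ZB] by blast
        have "2 \<le> length ?Z" using over_length[OF Q(3) ZB] AB_ne[OF Q(3)] by (cases ?Q) auto
        then have "ismx ?Q" using ismx_butlast m Zb by metis
        then have p: "take (length ?Q) A = ?Q" using mx_prefix Q(1) AF A(2) by blast
        have "\<not> ismx A" using A(2) unfolding nontrivial_def by blast
        have lA: "length ?Z \<le> length A"
        proof (rule ccontr)
          assume "\<not> length ?Z \<le> length A"
          then have "length A \<le> length ?Q" using over_length[OF Q(3) ZB] by simp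
          then have "A = ?Q" using p by simp
          then show False using \<open>ismx ?Q\<close> \<open>\<not> ismx A\<close> by simp
        qed
        let ?A = "take (length ?Z) A"
        have AF': "?A \<in> F" using F_take[OF AF _ lA] F_len[OF less.prems] lZ by simp
        have "butlast ?A = take (length ?Z - 1) A" using lA by (simp add: butlast_take)
        then have bA: "butlast ?A = ?Q" using p over_length[OF Q(3) ZB] by simp
        have AB': "?A \<in> over B' ?Q"
          using B'.over_iff[OF QB'] bA B'.take_AB[OF A(1)] Zb B'.AB_ne[OF Zb(2)] by simp
        obtain k where k: "?Q \<in> brk B k" using Q ABE by metis
        have Zm: "?Z = mx (Suc k)" using over_mx_last[OF k ZB m] .
        have "?A \<in> brk B (Suc k)" using over_brk[OF k] AB' le_over[OF B'B] by blast
        then have lA': "last ?A \<subseteq> last ?Z" "last ?A \<noteq> {}" using last_lev Zm last_ne brk_iff by auto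
        then have "last ?Z \<subseteq> last ?A" using B'.mb_min[OF QB' vf AB'] by blast
        then have "?A = ?Z" using B'.over_last_inj[OF QB' AB' Z(1)] lA' by blast
        then show False using AF' n by simp
      qed
      then have "?Z = E" using F_ex1[OF Q(1) vf] Zb Z v less.prems by metis
      then show ?thesis using Zb by simp
    qed
  qed
  then have "all_brk B' = all_brk CF" using sub B'.triv_AB all_brk_CF by blast
  then show ?thesis using eq_iff[OF B'(1) B'B CF_bracketing CF_le] by blast
qed

lemma CF_collision: "CF \<in> collisions T"
  unfolding collisions_def bracketings_def using CF_bracketing CF_ne_min CF_atom by blast

lemma under_CF: assumes "E \<in> all_brk CF" "E \<noteq> []"
  shows "under_nontrivial T CF E \<longleftrightarrow> (\<exists>A\<in>F. nontrivial T A \<and> length E \<le> length A \<and> E = take (length E) A)"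
proof
  assume "under_nontrivial T CF E"
  then obtain A l where A: "A \<in> all_brk CF" "nontrivial T A" "E = (butlast ^^ l) A"
    unfolding under_nontrivial_def by blast
  then have "A \<in> F" using all_brk_CF nontrivial_triv by blast
  moreover have "E = take (length A - l) A" using A(3) funpow_butlast by metis
  ultimately show "\<exists>A\<in>F. nontrivial T A \<and> length E \<le> length A \<and> E = take (length E) A"
    using A(2) by (intro bexI[of _ A]) auto
next
  assume "\<exists>A\<in>F. nontrivial T A \<and> length E \<le> length A \<and> E = take (length E) A"
  then obtain A where A: "A \<in> F" "nontrivial T A" "length E \<le> length A" "E = take (length E) A" by blast
  then have "E = (butlast ^^ (length A - length E)) A" using funpow_butlast by (metis diff_diff_cancel)
  then show "under_nontrivial T CF E" unfolding under_nontrivial_def using A all_brk_CF by blast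
qed

lemma F_under: assumes E: "E \<in> F" shows "under_nontrivial T CF E"
proof -
  have EC: "E \<in> all_brk CF" "E \<noteq> []" using E all_brk_CF F_AB AB_ne by auto
  show ?thesis
  proof (cases "nontrivial T E")
    case True
    then show ?thesis using under_CF[OF EC] E by (metis order_refl take_all)
  next
    case False
    then have m: "ismx E" using F_ns[OF E] unfolding nontrivial_def by blast
    obtain A where A: "A \<in> F" "nontrivial T A" using nt by blast
    have t: "take (length E) A = E" using mx_prefix[OF E A(1) m A(2)] .
    then have "length E \<le> length A" by (metis length_take min.cobounded1)
    then show ?thesis using under_CF[OF EC] A t by metis
  qed
qed

text \<open>Prefixes of members of \<open>F\<close> shorter than \<open>E0\<close> are singletons,
  and the others lie in \<open>F\<close>, where only \<open>E0\<close> projects to a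
  singleton.\<close>

lemma fusion_CF: "fusion_bracket T CF = E0"
  unfolding fusion_bracket_def
proof (rule the_equality)
  show "E0 \<in> all_brk CF \<and> \<not> sing E0 \<and> sing (butlast E0) \<and> under_nontrivial T CF E0"
    using E0_in all_brk_CF E0_ns E0_pr F_under by blast
next
  fix E assume E: "E \<in> all_brk CF \<and> \<not> sing E \<and> sing (butlast E) \<and> under_nontrivial T CF E"
  have ne: "E \<noteq> []" using sing_ne E by auto
  then obtain A where A: "A \<in> F" "length E \<le> length A" "E = take (length E) A"
    using under_CF E by blast
  have lb: "length (butlast E0) = length E0 - 1" by simp
  show "E = E0"
  proof (cases "length E < length E0")
    case True
    have "E = take (length E) (take (length E0) A)" using A True by simp
    also have "\<dots> = take (length E) E0" using F_len[OF A(1)] by simp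
    also have "\<dots> = take (length E) (butlast E0)" using True by (simp add: take_butlast)
    finally have "E = take (length E) (butlast E0)" .
    moreover have "sing (take (length E) (butlast E0))" by (rule sing_take[OF E0_pr]) (use ne in simp)
    ultimately show ?thesis using E by simp
  next
    case False
    then have "E \<in> F" using F_take[OF A(1), of "length E"] A by simp
    then show ?thesis using F_cl F_ns E by blast
  qed
qed

lemma essential_CF: "essential T CF = F"
proof (intro equalityI subsetI)
  fix E assume "E \<in> essential T CF"
  then have E: "E \<in> all_brk CF" "under_nontrivial T CF E" and "\<exists>j. (butlast ^^ j) E = E0"
    unfolding essential_def fusion_CF by auto
  then have l: "length E0 \<le> length E" unfolding funpow_butlast by (metis diff_le_self length_take min.bounded_iff min.cobounded1)
  then have "E \<noteq> []" using E0_len by auto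
  then obtain A where "A \<in> F" "length E \<le> length A" "E = take (length E) A" using under_CF E by blast
  then show "E \<in> F" using F_take[of A "length E"] l by simp
next
  fix E assume E: "E \<in> F"
  have "(butlast ^^ (length E - length E0)) E = E0"
    using F_len[OF E] unfolding funpow_butlast by simp
  then show "E \<in> essential T CF" unfolding essential_def fusion_CF using E F_under all_brk_CF by blast
qed

lemma ell_CF: "ell T CF = (CF, ind F)"
  unfolding ell_def ind_def essential_CF using CF_ne_min by auto

end

end

section \<open>Existence of slices\<close>

context bing
begin

text \<open>\<open>E0\<close> is the shortest nonsingleton prefix of \<open>A\<close>; its length is
  at least 2 since level 0 has only the singleton of the root. Above it \<open>F\<close> continues
  with innermost brackets only, and these partition every fibre.\<close>

lemma ex_slice: assumes A: "A \<in> AB" "nontrivial T A"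
  shows "\<exists>E0 F. slice B E0 F \<and> (\<exists>A\<in>F. nontrivial T A)"
proof -
  obtain n where n: "A \<in> brk B n" "length A = Suc n" using A(1) by (metis ABE)
  define l0 where "l0 = (LEAST l. 0 < l \<and> \<not> sing (take l A))"
  have ex: "0 < Suc n \<and> \<not> sing (take (Suc n) A)" using A n unfolding nontrivial_def by simp
  have l0: "0 < l0" "\<not> sing (take l0 A)"
    using LeastI[of "\<lambda>l. 0 < l \<and> \<not> sing (take l A)", OF ex] unfolding l0_def by auto
  have lmin: "sing (take l A)" if "0 < l" "l < l0" for l
    using not_less_Least[of l "\<lambda>l. 0 < l \<and> \<not> sing (take l A)"] that unfolding l0_def by blast
  have l0n: "l0 \<le> Suc n" using Least_le[of "\<lambda>l. 0 < l \<and> \<not> sing (take l A)", OF ex] unfolding l0_def .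
  have "take 1 A = sb rt"
    using br_rt[OF br[OF n(1)]] n(2) sb_nth[of 0 rt] by (intro nth_equalityI) auto
  then have "l0 \<noteq> 1" using l0 sing_sb[OF rt_in] by auto
  then have l02: "2 \<le> l0" using l0 by simp
  define E0 where "E0 = take l0 A"
  have lE0: "length E0 = l0" using l0n n unfolding E0_def by simp
  have E0: "E0 \<in> AB" using take_AB A(1) l0 unfolding E0_def by blast
  have "butlast E0 = take (l0 - 1) A" using l0n n unfolding E0_def by (simp add: butlast_take)
  then have pE0: "sing (butlast E0)" using lmin[of "l0 - 1"] l02 by simp
  define mini where "mini Q X \<longleftrightarrow> (\<forall>Z\<in>over B Q. last Z \<inter> last X \<noteq> {} \<longrightarrow> last X \<subseteq> last Z)" for Q X
  define F where "F = {E \<in> AB. l0 \<le> length E \<and> take l0 E = E0 \<and>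
      (\<forall>i. l0 \<le> i \<and> i < length E \<longrightarrow> mini (take i E) (take (Suc i) E))}"
  have E0F: "E0 \<in> F" using E0 lE0 unfolding F_def by auto
  have stepF: "X \<in> F \<longleftrightarrow> mini E X" if E: "E \<in> F" and X: "X \<in> over B E" for E X
  proof -
    have EAB: "E \<in> AB" "l0 \<le> length E" "take l0 E = E0" using E unfolding F_def by auto
    have XE: "X = E @ [last X]" "X \<in> AB" using over_eq[OF EAB(1) X] over_AB[OF EAB(1) X] by auto
    have lX: "length X = Suc (length E)" using over_length[OF EAB(1) X] .
    have t: "take i X = take i E" if "i \<le> length E" for i
      using that by (subst XE(1)) simp
    have "X \<in> F \<longleftrightarrow> (\<forall>i. l0 \<le> i \<and> i < Suc (length E) \<longrightarrow> mini (take i X) (take (Suc i) X))"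
      using XE(2) lX EAB t[of l0] unfolding F_def by simp
    also have "\<dots> \<longleftrightarrow> (\<forall>i. l0 \<le> i \<and> i < length E \<longrightarrow> mini (take i E) (take (Suc i) E)) \<and> mini E X"
      using t lX EAB(2) by (auto simp: less_Suc_eq)
    also have "\<dots> \<longleftrightarrow> mini E X" using E unfolding F_def by blast
    finally show ?thesis .
  qed
  have Fcl: "E = E0 \<or> butlast E \<in> F" if E: "E \<in> F" for E
  proof (cases "length E = l0")
    case True
    then show ?thesis using E unfolding F_def by simp
  next
    case False
    have EE: "E \<in> AB" "l0 \<le> length E" "take l0 E = E0"
      "\<And>i. l0 \<le> i \<Longrightarrow> i < length E \<Longrightarrow> mini (take i E) (take (Suc i) E)" using E unfolding F_def by auto
    have t: "take i (butlast E) = take i E" if "i \<le> length E - 1" for i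
      using that EE(2) l02 by (intro take_butlast) linarith
    have "butlast E \<in> AB" using butlast_AB[OF EE(1)] EE(2) l02 by simp
    moreover have "l0 \<le> length (butlast E)" using EE(2) False by simp
    ultimately show ?thesis using EE(3,4) t unfolding F_def by auto
  qed
  have ex1: "\<exists>!X. X \<in> F \<and> butlast X = E \<and> v \<in> last X" if E: "E \<in> F" and v: "v \<in> fib E" for E v
  proof -
    have EAB: "E \<in> AB" using E unfolding F_def by blast
    show ?thesis
    proof (rule ex1I)
      have "mini E (mb E v)" using mb_min[OF EAB v] unfolding mini_def by blast
      then show "mb E v \<in> F \<and> butlast (mb E v) = E \<and> v \<in> last (mb E v)"
        using stepF[OF E mb_over[OF EAB v]] mb_in[OF EAB v] over_iff[OF EAB] mb_over[OF EAB v] by blast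
    next
      fix X assume X: "X \<in> F \<and> butlast X = E \<and> v \<in> last X"
      then have Xo: "X \<in> over B E" using over_iff[OF EAB] unfolding F_def by blast
      then have "mini E X" using stepF[OF E Xo] X by blast
      then have "last X \<subseteq> last (mb E v)"
        using mb_over[OF EAB v] mb_in[OF EAB v] X unfolding mini_def by blast
      moreover have "last (mb E v) \<subseteq> last X" using mb_le[OF EAB Xo] X by blast
      ultimately show "X = mb E v" using over_last_inj[OF EAB Xo mb_over[OF EAB v]] by blast
    qed
  qed
  have "F \<subseteq> AB" unfolding F_def by blast
  then have S: "slice B E0 F" unfolding slice_def using E0F l0 pE0 Fcl ex1 unfolding E0_def by blast
  interpret S: sliced T B E0 F by unfold_locales (rule S)
  have "\<exists>A\<in>F. nontrivial T A"
  proof (rule ccontr)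
    \<comment> \<open>If all of \<open>F\<close> were maxima, then each innermost bracket would
      already be a maximum and would leave no other bracket over its projection. The prefixes of
      \<open>A\<close> would never leave \<open>F\<close>, making \<open>A\<close> itself
      trivial.\<close>
    assume n0: "\<not> ?thesis"
    have "take l A \<in> F" if "l0 \<le> l" "l \<le> Suc n" for l
      using that
    proof (induction l rule: dec_induct)
      case base
      then show ?case using E0F unfolding E0_def by simp
    next
      case (step m)
      let ?E = "take m A" and ?X = "take (Suc m) A"
      have E: "?E \<in> F" using step by simp
      have EAB: "?E \<in> AB" using E \<open>F \<subseteq> AB\<close> by blast
      have Xo: "?X \<in> over B ?E"
        using over_iff[OF EAB] take_AB[OF A(1), of "Suc m"] step n by (simp add: butlast_take)
      obtain v where v: "v \<in> last ?X" using last_ne over_AB[OF EAB Xo] by blast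
      have vf: "v \<in> fib ?E" using over_fib[OF EAB Xo] v by blast
      obtain Y where Y: "Y \<in> F" "butlast Y = ?E" "v \<in> last Y" using ex1[OF E vf] by blast
      have Yo: "Y \<in> over B ?E" using over_iff[OF EAB] Y \<open>F \<subseteq> AB\<close> by blast
      have "ismx Y" using n0 Y(1) S.F_ns unfolding nontrivial_def by blast
      moreover obtain k where k: "?E \<in> brk B k" using EAB by (metis ABE)
      ultimately have "Y = mx (Suc k)" using over_mx_last Yo by blast
      then have XY: "last ?X \<subseteq> last Y" using last_lev[of ?X "Suc k"] over_brk[OF k] Xo by simp
      have "mini ?E Y" using stepF[OF E Yo] Y(1) by blast
      then have "last Y \<subseteq> last ?X" using Xo XY v Y(3) unfolding mini_def by blast
      then have "?X = Y" using over_last_inj[OF EAB Xo Yo] XY by blast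
      then show ?case using Y(1) by simp
    qed
    then have "A \<in> F" using l0n n by (metis order_refl take_all)
    then show False using n0 A by blast
  qed
  then show ?thesis using S by blast
qed

end

text \<open>A slice with a nontrivial member spans a nonminimal bracketing below \<open>C\<close>;
  since \<open>C\<close> is an atom, it is \<open>C\<close>.\<close>

lemma (in rpt) collision_slice: assumes C: "C \<in> collisions T"
  obtains E0 F where "sliced T C E0 F" "\<exists>A\<in>F. nontrivial T A" "restr C (triv T \<union> F) = C"
proof -
  have Cb: "is_bracketing T C" "C \<noteq> min_bracketing T" using C unfolding collisions_def bracketings_def by auto
  interpret C: bing T C by unfold_locales (rule Cb)
  obtain A where "A \<in> all_brk C" "nontrivial T A" using C.min_iff Cb by blast
  then obtain E0 F where S: "slice C E0 F" "\<exists>A\<in>F. nontrivial T A" using C.ex_slice by blast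
  interpret S: sliced T C E0 F by unfold_locales (rule S)
  have "S.CF = C"
    using C S.CF_bracketing S.CF_ne_min[OF S(2)] S.CF_le unfolding collisions_def bracketings_def by blast
  then show thesis using that S S.sliced_axioms by blast
qed

section \<open>Decomposition into collisions\<close>

lemma (in rpt) snd_ell_min: "snd (ell T (min_bracketing T)) = ind mxs"
  unfolding ell_def ind_def mxs_def by auto

context bing
begin

lemma mxs_cone: "ind mxs \<in> cone B"
proof -
  have "ind mxs A = (\<Sum>X | X \<in> over B A \<and> v \<in> last X. ind mxs X)"
    if A: "A \<in> AB" "\<not> sing A" "v \<in> fib A" for A v
  proof -
    obtain k where k: "A \<in> brk B k" using A by (metis ABE)
    show ?thesis
    proof (cases "ismx A")
      case True
      have m: "mx (Suc k) \<in> over B A" "v \<in> lev (Suc k)" using mx_over[OF k True A(3)] by auto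
      have "ismx (mx (Suc k))" using m lev_le unfolding is_max_bracket_def by blast
      then have "mx (Suc k) \<in> mxs" using over_nonsing[OF A(1,2) m(1)] unfolding mxs_def by blast
      moreover have "(\<Sum>X | X \<in> over B A \<and> v \<in> last X. ind mxs X) = (\<Sum>X\<in>{mx (Suc k)}. ind mxs X)"
        using m over_mx_last[OF k] by (intro sum.mono_neutral_right) (auto simp: ind_def mxs_def)
      ultimately show ?thesis using True A(2) unfolding ind_def mxs_def by simp
    next
      case False
      have "X \<notin> mxs" if X: "X \<in> over B A" for X
      proof
        assume "X \<in> mxs"
        then have "ismx X" unfolding mxs_def by blast
        moreover have "length X = Suc (length A)" "butlast X = A" "A \<noteq> []"
          using over_length over_iff A X AB_ne by auto
        moreover from this have "2 \<le> length X" by (cases A) auto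
        ultimately show False using ismx_butlast False by blast
      qed
      then have "(\<Sum>X | X \<in> over B A \<and> v \<in> last X. ind mxs X) = 0"
        by (intro sum.neutral) (simp add: ind_def)
      then show ?thesis using False unfolding ind_def mxs_def by simp
    qed
  qed
  moreover have "A \<notin> mxs" if "A \<notin> AB" for A using ismx_AB that unfolding mxs_def by blast
  ultimately show ?thesis unfolding cone_def flow_def by (auto simp: ind_def mxs_def)
qed

text \<open>Without nontrivial weights, conservation only hands the weight of one maximum to the
  next. Hence all nonsingleton maxima share the weight of the deepest one.\<close>

lemma flow_mxs: assumes f: "flow B f" and z: "\<And>A. nontrivial T A \<Longrightarrow> f A = 0"
  shows "f = (\<lambda>A. f (mx (tree_depth T)) * ind mxs A)"
proof
  fix A
  have stepm: "f (mx k) = f (mx (Suc k)) \<and> \<not> sing (mx (Suc k))"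
    if k: "Suc k \<le> tree_depth T" and ns: "\<not> sing (mx k)" for k
  proof -
    have m: "mx k \<in> brk B k" "mx k \<in> AB" using mx_brk[of k] k brk_iff by auto
    obtain v where v: "v \<in> lev (Suc k)" using k lev_ne by blast
    then have "v \<in> fib (mx k)" using fib_iff'[OF m(1)] anc_lev[OF v, of k] by simp
    then have "f (mx k) = (\<Sum>X | X \<in> over B (mx k) \<and> v \<in> last X. f X)" using flowD[OF f m(2) ns] by blast
    also have "\<dots> = (\<Sum>X\<in>{mx (Suc k)}. f X)"
    proof (rule sum.mono_neutral_right)
      show "{mx (Suc k)} \<subseteq> {X. X \<in> over B (mx k) \<and> v \<in> last X}"
        using over_brk[OF m(1)] mx_brk k v by simp
      show "\<forall>X\<in>{X. X \<in> over B (mx k) \<and> v \<in> last X} - {mx (Suc k)}. f X = 0"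
        using over_mx_last[OF m(1)] over_nonsing[OF m(2) ns] z unfolding nontrivial_def by blast
    qed simp
    finally have "f (mx k) = f (mx (Suc k))" by simp
    moreover have "mx (Suc k) \<in> over B (mx k)" using over_brk[OF m(1)] mx_brk k by simp
    ultimately show ?thesis using over_nonsing[OF m(2) ns] by blast
  qed
  show "f A = f (mx (tree_depth T)) * ind mxs A"
  proof (cases "A \<in> mxs")
    case True
    then obtain k where k: "k \<le> tree_depth T" "A = mx k" "\<not> sing (mx k)"
      unfolding mxs_def is_max_bracket_def by blast
    have "f (mx k) = f (mx l) \<and> \<not> sing (mx l)" if "k \<le> l" "l \<le> tree_depth T" for l
      using that
    proof (induction l rule: dec_induct)
      case base
      then show ?case using k by simp
    next
      case (step m)
      then show ?case using stepm[of m] by simp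
    qed
    then show ?thesis using True k unfolding ind_def by simp
  next
    case False
    then have "sing A \<or> nontrivial T A" unfolding mxs_def nontrivial_def by blast
    then show ?thesis using False f z unfolding ind_def flow_def by auto
  qed
qed

text \<open>Subtracting from a slice in the support the least weight of its nontrivial members
  empties at least one bracket and keeps the others nonnegative. The collisions are placed below
  \<open>supp B f\<close>, not only below \<open>B\<close>, because a decomposition may use only
  collisions below the metric bracketing's own bracketing.\<close>

lemma decompose: assumes f: "f \<in> cone B"
  shows "\<exists>c L. (\<forall>(l, C)\<in>set L. 0 \<le> l \<and> C \<in> collisions T \<and> C \<preceq>\<^sub>K supp B f) \<and>
    f = (\<lambda>A. c * ind mxs A + (\<Sum>(l, C)\<leftarrow>L. l * snd (ell T C) A))"
  using f
proof (induction "card {A \<in> AB. nontrivial T A \<and> 0 < f A}" arbitrary: f rule: less_induct)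
  case less
  note c = coneD[OF less.prems]
  show ?case
  proof (cases "\<exists>A. nontrivial T A \<and> f A \<noteq> 0")
    case False
    then have "f = (\<lambda>A. f (mx (tree_depth T)) * ind mxs A)" using flow_mxs[OF c(1)] by blast
    then show ?thesis by (intro exI[of _ "f (mx (tree_depth T))"] exI[of _ "[]"]) auto
  next
    case True
    then obtain A where A: "nontrivial T A" "f A \<noteq> 0" by blast
    then have "0 < f A" "A \<in> AB" using c(2,3) by fastforce+
    then have AS: "A \<in> all_brk (supp B f)" unfolding all_brk_supp by blast
    let ?S = "supp B f"
    interpret S: bing T ?S by unfold_locales (rule supp_bracketing[OF less.prems])
    obtain E0 F where F: "slice ?S E0 F" "\<exists>A\<in>F. nontrivial T A" using S.ex_slice[OF AS A(1)] by blast
    interpret F: sliced T ?S E0 F by unfold_locales (rule F)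
    let ?N = "{A \<in> F. nontrivial T A}"
    have finF: "finite F" using F.F_AB S.finite_AB finite_subset by blast
    have Fpos: "0 < f X \<and> X \<in> AB" if "X \<in> ?N" for X
      using that F.F_AB nontrivial_triv unfolding all_brk_supp by blast
    define e where "e = Min (f ` ?N)"
    have "e \<in> f ` ?N" unfolding e_def using finF F(2) by (intro Min_in) auto
    then obtain X where X: "X \<in> ?N" "e = f X" by blast
    have e0: "0 < e" using X Fpos by simp
    have eF: "e \<le> f Y" if "Y \<in> ?N" for Y unfolding e_def using that finF by (intro Min_le) auto
    define g where "g = (\<lambda>A. 1 * f A + (- e) * ind F A)"
    have gflow: "flow B g" unfolding g_def
      by (rule flow_comb[OF c(1) flow_extend[OF S.B supp_le F.ind_flow]])
    have gpos: "0 \<le> g Y" if "nontrivial T Y" for Y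
      using that eF c(2) unfolding g_def ind_def by auto
    have gc: "g \<in> cone B" using gflow gpos unfolding cone_def by blast
    have gf: "g Y \<le> f Y" for Y using e0 unfolding g_def ind_def by simp
    have "{A \<in> AB. nontrivial T A \<and> 0 < g A} \<subset> {A \<in> AB. nontrivial T A \<and> 0 < f A}"
    proof (rule psubsetI)
      show "{A \<in> AB. nontrivial T A \<and> 0 < g A} \<subseteq> {A \<in> AB. nontrivial T A \<and> 0 < f A}"
        using gf less_le_trans by blast
      have "g X = 0" using X unfolding g_def ind_def by simp
      moreover have "X \<in> {A \<in> AB. nontrivial T A \<and> 0 < f A}" using X Fpos by blast
      ultimately show "{A \<in> AB. nontrivial T A \<and> 0 < g A} \<noteq> {A \<in> AB. nontrivial T A \<and> 0 < f A}"
        by force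
    qed
    then have "card {A \<in> AB. nontrivial T A \<and> 0 < g A} < card {A \<in> AB. nontrivial T A \<and> 0 < f A}"
      by (rule psubset_card_mono[rotated]) simp
    then obtain c' L where L: "\<forall>(l, C)\<in>set L. 0 \<le> l \<and> C \<in> collisions T \<and> C \<preceq>\<^sub>K supp B g"
      "g = (\<lambda>A. c' * ind mxs A + (\<Sum>(l, C)\<leftarrow>L. l * snd (ell T C) A))"
      using less.hyps[OF _ gc] by blast
    have "all_brk (supp B g) \<subseteq> all_brk ?S" unfolding all_brk_supp using gf less_le_trans by blast
    then have "supp B g \<preceq>\<^sub>K ?S"
      using le_iff[OF supp_bracketing[OF gc] supp_le supp_bracketing[OF less.prems] supp_le] by blast
    then have "\<forall>(l, C)\<in>set ((e, F.CF) # L). 0 \<le> l \<and> C \<in> collisions T \<and> C \<preceq>\<^sub>K ?S"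
      using L(1) le_trans e0 F.CF_collision[OF F(2)] F.CF_le by fastforce
    moreover have "f = (\<lambda>A. c' * ind mxs A + (\<Sum>(l, C)\<leftarrow>(e, F.CF) # L. l * snd (ell T C) A))"
    proof
      fix A
      have "f A = g A + e * ind F A" unfolding g_def by simp
      also have "g A = c' * ind mxs A + (\<Sum>(l, C)\<leftarrow>L. l * snd (ell T C) A)" using L(2) by metis
      finally show "f A = c' * ind mxs A + (\<Sum>(l, C)\<leftarrow>(e, F.CF) # L. l * snd (ell T C) A)"
        using F.ell_CF[OF F(2)] by simp
    qed
    ultimately show ?thesis by blast
  qed
qed

end

section \<open>The contracted tree\<close>

text \<open>Together with \<open>sorted_wrt_list_unique\<close> this evaluates the definite
  description for the children of a new vertex in \<open>contract\<close>.\<close>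

lemma sorted_wrt_list_ex:
  assumes "finite A" and tot: "\<And>x y. x \<in> A \<Longrightarrow> y \<in> A \<Longrightarrow> x \<noteq> y \<Longrightarrow> R x y \<or> R y x"
    and tr: "\<And>x y z. R x y \<Longrightarrow> R y z \<Longrightarrow> R x z"
  shows "\<exists>xs. distinct xs \<and> set xs = A \<and> sorted_wrt R xs"
  using assms(1) tot
proof (induction A rule: finite_induct)
  case (insert a A)
  then obtain xs where xs: "distinct xs" "set xs = A" "sorted_wrt R xs" by blast
  let ?l = "filter (\<lambda>x. R x a) xs" and ?r = "filter (\<lambda>x. \<not> R x a) xs"
  have r: "R a x" if "x \<in> set ?r" for x using that insert.prems[of x a] insert.hyps xs by auto
  have "sorted_wrt R (?l @ [a] @ ?r)"
    using xs(3) r tr by (auto simp: sorted_wrt_append sorted_wrt_filter)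
  moreover have "distinct (?l @ [a] @ ?r)" "set (?l @ [a] @ ?r) = insert a A" using xs insert.hyps by auto
  ultimately show ?case by blast
qed simp

lemma sorted_wrt_list_unique:
  assumes "\<And>x y. R x y \<Longrightarrow> \<not> R y x" "distinct xs" "distinct ys" "set xs = set ys" "sorted_wrt R xs" "sorted_wrt R ys"
  shows "xs = ys"
  using assms(2-)
proof (induction xs arbitrary: ys)
  case (Cons x xs)
  then obtain y ys' where y: "ys = y # ys'" by (cases ys) auto
  have "x = y"
  proof (rule ccontr)
    assume n: "x \<noteq> y"
    then have "R y x" "R x y" using Cons.prems y by auto
    then show False using assms(1) by blast
  qed
  moreover have "xs = ys'" using Cons.prems y calculation by (intro Cons.IH) auto
  ultimately show ?case using y by simp
qed simp

section \<open>Vertices and children of the contraction\<close>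

locale collided = sliced T C E0 F for T :: "'a plane_tree" and C :: "'a bracketing" and E0 F +
  assumes nt: "\<exists>A\<in>F. nontrivial T A" and CFC: "restr C (triv T \<union> F) = C"
begin

lemma AC: "AB = triv T \<union> F"
  using all_brk_CF CFC by simp

lemma ess: "essential T C = F" and fus: "fusion_bracket T C = E0"
  using essential_CF[OF nt] fusion_CF[OF nt] CFC by simp_all

lemma C_ne_min: "C \<noteq> min_bracketing T"
  using CF_ne_min[OF nt] CFC by simp

text \<open>The level of \<open>w\<close>: a bracket of length l has level l - 1, and
  \<open>w\<close> is one level below \<open>E0\<close>.\<close>

definition p0 :: nat where "p0 = length E0 - 2"
definition w :: 'a where "w = (THE w. w \<in> V \<and> butlast E0 = sb w)"
abbreviation "W \<equiv> last E0"
definition low :: "'a set" where "low = {v \<in> V. Suc p0 \<le> dep v \<and> anc v (Suc p0) \<in> W}"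

lemma E0_brk: "E0 \<in> brk C (Suc p0)"
  using E0_in F_AB E0_len brk_iff unfolding p0_def by auto

lemma w: "w \<in> V" "butlast E0 = sb w" "w \<in> lev p0"
proof -
  obtain x where x: "x \<in> V" "butlast E0 = sb x" using E0_pr unfolding is_singleton_bracket_def by blast
  then have "w = x" unfolding w_def using sb_inj by auto
  then show *: "w \<in> V" "butlast E0 = sb w" using x by auto
  have "length (butlast E0) = Suc (dep w)" using *(2) by simp
  then have "dep w = p0" using E0_len unfolding p0_def by simp
  then show "w \<in> lev p0" using * in_lev by simp
qed

lemma fset: "fused_set T C = W" and fpar: "fused_parent T C = w"
  unfolding fused_set_def fused_parent_def fus w_def by simp_all

lemma W_lev: "W \<subseteq> lev (Suc p0)"
  using last_lev[OF E0_brk] .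

lemma E0_over: "E0 \<in> over C (sb w)"
  using over_iff[OF sb_AB[OF w(1)]] w(2) E0_in F_AB by blast

lemma W_ch: "W \<subseteq> set (ch w)"
  using over_fib[OF sb_AB[OF w(1)] E0_over] last_sb[OF w(1)] unfolding fib_def by simp

lemma low_eq: "in_or_below T W = low"
proof -
  have d: "u \<in> V \<and> dep u = Suc p0" if "u \<in> W" for u using W_lev that in_lev by blast
  have "v \<in> in_or_below T W \<longleftrightarrow> v \<in> V \<and> (\<exists>u\<in>W. dep u \<le> dep v \<and> anc v (dep u) = u)" for v
    unfolding in_or_below_def using walk_anc d by blast
  moreover have "(\<exists>u\<in>W. dep u \<le> dep v \<and> anc v (dep u) = u) \<longleftrightarrow> Suc p0 \<le> dep v \<and> anc v (Suc p0) \<in> W" for v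
    using d by metis
  ultimately show ?thesis unfolding low_def by blast
qed

lemma low_ch: assumes "u \<in> V" "v \<in> set (ch u)" "u \<noteq> w"
  shows "v \<in> low \<longleftrightarrow> u \<in> low"
proof -
  have v: "v \<in> V" "dep v = Suc (dep u)" using assms ch_in dep_ch by auto
  show ?thesis
  proof (cases "Suc p0 \<le> dep u")
    case True
    then show ?thesis using anc_ch[OF assms(1,2) True] v assms(1) unfolding low_def by simp
  next
    case False
    have "v \<notin> low"
    proof
      assume l: "v \<in> low"
      then have "dep v = Suc p0" using False v unfolding low_def by simp
      then have "v \<in> W" using l v anc_dep[of v] unfolding low_def by simp
      then show False using W_ch ch_unique[OF assms(1) w(1) assms(2)] assms(3) by blast
    qed
    then show ?thesis using False unfolding low_def by simp
  qed
qed

lemma w_low: "w \<notin> low" and rt_low: "rt \<notin> low"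
  using w(3) in_lev unfolding low_def by auto

lemma low_ch_w: "v \<in> set (ch w) \<Longrightarrow> v \<in> low \<longleftrightarrow> v \<in> W"
  using ch_in[OF w(1)] dep_ch[OF w(1)] w(3) anc_dep[of v] unfolding low_def in_lev by force

lemma F_low: assumes "E \<in> F" "v \<in> last E" shows "v \<in> low"
proof -
  obtain k where k: "E \<in> brk C k" "length E = Suc k" using assms F_AB ABE by (metis subsetD)
  have l: "length E0 = Suc (Suc p0)" using brk_iff E0_brk by blast
  then have pk: "Suc p0 \<le> k" "take (Suc (Suc p0)) E = E0" using F_len[OF assms(1)] k by auto
  have "anc v (Suc p0) \<in> E ! Suc p0" using anc_in[OF k(1) assms(2) pk(1)] .
  also have "E ! Suc p0 = W" using last_take[OF k(1) pk(1)] pk by simp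
  finally have "anc v (Suc p0) \<in> W" .
  moreover have "v \<in> lev k" using last_lev[OF k(1)] assms(2) by blast
  ultimately show ?thesis using pk unfolding low_def in_lev by simp
qed

lemma low_ex: "v \<in> lev k \<Longrightarrow> v \<in> low \<Longrightarrow> \<exists>E\<in>F. length E = Suc k \<and> v \<in> last E"
proof (induction k arbitrary: v)
  case 0
  then show ?case unfolding low_def in_lev by simp
next
  case (Suc k)
  have l: "length E0 = Suc (Suc p0)" using brk_iff E0_brk by blast
  have vV: "v \<in> V" "dep v = Suc k" using Suc.prems in_lev by auto
  show ?case
  proof (cases "k = p0")
    case True
    then have "v \<in> W" using Suc.prems anc_self unfolding low_def by fastforce
    then show ?thesis using E0_in l True by auto
  next
    case False
    then have pk: "Suc p0 \<le> k" using Suc.prems vV unfolding low_def by simp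
    let ?u = "anc v k"
    have u: "v \<in> set (ch ?u)" "?u \<in> lev k" using lev_Suc_anc[OF Suc.prems(1)] by auto
    have "?u \<noteq> w" using u(2) w(3) pk in_lev by auto
    then have "?u \<in> low" using low_ch[of ?u v] u in_lev Suc.prems(2) by blast
    then obtain E where E: "E \<in> F" "length E = Suc k" "?u \<in> last E" using Suc.IH u by blast
    have "v \<in> fib E" unfolding fib_def using E u by blast
    then obtain X where X: "X \<in> F" "butlast X = E" "v \<in> last X" using F_ex1[OF E(1)] by blast
    then have "length X = Suc (length E)" using F_AB AB_ne[of X] by (cases X rule: rev_cases) auto
    then show ?thesis using X E by auto
  qed
qed

text \<open>The brackets that become vertices of the contracted tree.\<close>

definition Phi :: "'a bracket set" where "Phi = F \<union> sb ` (V - low)"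

lemma Phi_AB: "Phi \<subseteq> AB"
  unfolding Phi_def using F_AB sb_AB by blast

lemma Phi_unique: assumes "X \<in> Phi" "Y \<in> Phi" "length X = length Y" "last X \<inter> last Y \<noteq> {}"
  shows "X = Y"
proof -
  consider "X \<in> F" "Y \<in> F" | "X \<in> F" "Y \<in> sb ` (V - low)" | "X \<in> sb ` (V - low)" "Y \<in> F"
    | "X \<in> sb ` (V - low)" "Y \<in> sb ` (V - low)" using assms(1,2) unfolding Phi_def by blast
  then show ?thesis
  proof cases
    case 1 then show ?thesis using F_unique assms by blast
  next
    case 2 then show ?thesis using F_low last_sb assms(4) by fastforce
  next
    case 3 then show ?thesis using F_low last_sb assms(4) by fastforce
  next
    case 4 then show ?thesis using last_sb assms(4) by auto
  qed
qed

lemma Phi_butlast: assumes "X \<in> Phi" "2 \<le> length X" shows "butlast X \<in> Phi"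
proof (cases "X \<in> F")
  case True
  then show ?thesis using F_cl[OF True] w w_low unfolding Phi_def by auto
next
  case False
  then obtain v where v: "v \<in> V" "v \<notin> low" "X = sb v" using assms unfolding Phi_def by blast
  then obtain k where k: "v \<in> lev (Suc k)" using assms(2) in_lev by (cases "dep v") auto
  have u: "v \<in> set (ch (anc v k))" "anc v k \<in> lev k" using lev_Suc_anc[OF k] by auto
  have uV: "anc v k \<in> V" using u in_lev by blast
  have "anc v k \<notin> low" using low_ch[OF uV u(1)] v w_low by (cases "anc v k = w") auto
  then show ?thesis using butlast_sb_lev[OF k] v uV unfolding Phi_def by auto
qed

lemma Phi_take: "X \<in> Phi \<Longrightarrow> 0 < i \<Longrightarrow> i \<le> length X \<Longrightarrow> take i X \<in> Phi"
proof (induction "length X" arbitrary: X rule: less_induct)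
  case less
  show ?case
  proof (cases "i = length X")
    case False
    then have "take i (butlast X) \<in> Phi" using less.prems Phi_butlast[of X] by (intro less.hyps) auto
    moreover have "take i (butlast X) = take i X" using less.prems False by (intro take_butlast) auto
    ultimately show ?thesis by simp
  qed (use less.prems in simp)
qed

abbreviation "S \<equiv> contract T C"
definition phi :: "'a + 'a bracket \<Rightarrow> 'a bracket" where "phi x = (case x of Inl v \<Rightarrow> sb v | Inr E \<Rightarrow> E)"

lemma phi_simps [simp]: "phi (Inl v) = sb v" "phi (Inr E) = E"
  unfolding phi_def by auto

lemma verts_S: "verts S = Inl ` (V - low) \<union> Inr ` F"
  unfolding contract_def fset ess low_eq by simp

lemma root_S: "root_of S = Inl rt"
  unfolding contract_def by simp

lemma phi_inj: "x \<in> verts S \<Longrightarrow> y \<in> verts S \<Longrightarrow> phi x = phi y \<Longrightarrow> x = y"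
proof -
  have "sb v \<notin> F" if "v \<in> V" for v using F_ns sing_sb that by blast
  then show "x \<in> verts S \<Longrightarrow> y \<in> verts S \<Longrightarrow> phi x = phi y \<Longrightarrow> x = y"
    unfolding verts_S using sb_inj by auto
qed

lemma phi_image: "phi ` verts S = Phi"
  unfolding verts_S Phi_def by (auto simp: image_Un image_image)

lemma phi_Phi: "x \<in> verts S \<Longrightarrow> phi x \<in> Phi"
  using phi_image by blast

lemma phi_ne: "x \<in> verts S \<Longrightarrow> phi x \<noteq> []"
  using phi_Phi Phi_AB AB_ne by blast

text \<open>The bracket condition at the last level of \<open>E0\<close> says that \<open>W\<close>
  is a block of consecutive children of \<open>w\<close>, so the list operations in
  \<open>contract\<close> cut out exactly this block.\<close>

lemma w_split: obtains xs ys zs where "ch w = xs @ ys @ zs" "set ys = W" "ys \<noteq> []"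
    "set xs \<inter> W = {}" "set zs \<inter> W = {}"
    "kids S (Inl w) = map Inl xs @ [Inr E0] @ map Inl zs"
proof -
  have b: "is_bracket T (Suc p0) E0" using br E0_brk by blast
  have "E0 ! p0 = {w}"
  proof -
    have "length E0 = Suc (Suc p0)" using br_length[OF b] .
    then have "E0 ! p0 = sb w ! p0" using w(2) by (metis lessI length_butlast diff_Suc_1 nth_butlast)
    then show ?thesis using sb_nth[of p0 w] w(3) anc_self[OF w(3)] in_lev by simp
  qed
  then have "w \<in> E0 ! (Suc p0 - 1)" by simp
  then have "\<exists>xs ys zs. ch w = xs @ ys @ zs \<and> E0 ! Suc p0 \<inter> set (ch w) = set ys"
    using b unfolding is_bracket_def by force
  then obtain xs ys zs where s: "ch w = xs @ ys @ zs" "E0 ! Suc p0 \<inter> set (ch w) = set ys" by blast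
  have ys: "set ys = W" using s(2) br_last[OF b] W_ch by auto
  then have ne: "ys \<noteq> []" using last_ne[of E0] E0_in F_AB by auto
  have d: "distinct (xs @ ys @ zs)" using distinct_ch[OF w(1)] s by simp
  have dx: "set xs \<inter> W = {}" "set zs \<inter> W = {}"
    using d ys[symmetric] by (simp_all add: Int_commute Int_Un_distrib)
  have hy: "hd ys \<in> W" using hd_in_set[OF ne] ys by simp
  have hz: "zs \<noteq> [] \<Longrightarrow> hd zs \<notin> W" using dx(2) hd_in_set by blast
  have t1: "takeWhile (\<lambda>v. v \<notin> W) (ch w) = xs"
    using dx ys ne hy unfolding s(1) by (subst takeWhile_append2) (auto simp: takeWhile_eq_Nil_iff)
  have t2: "dropWhile (\<lambda>v. v \<notin> W) (ch w) = ys @ zs"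
    using dx ys ne hy unfolding s(1) by (subst dropWhile_append2) (auto simp: dropWhile_eq_self_iff)
  have t3: "dropWhile (\<lambda>v. v \<in> W) (ys @ zs) = zs"
    using dx ys hz by (subst dropWhile_append2) (auto simp: dropWhile_eq_self_iff)
  have "kids S (Inl w) = map Inl xs @ [Inr E0] @ map Inl zs"
    unfolding contract_def fset fpar fus by (simp add: t1 t2 t3)
  then show thesis using that s(1) ys ne dx by blast
qed

lemma kids_Inl: "u \<noteq> w \<Longrightarrow> kids S (Inl u) = map Inl (ch u)"
  unfolding contract_def fpar by simp

lemma kids_Inr: assumes E: "E \<in> F"
  obtains Es where "kids S (Inr E) = map Inr Es" "distinct Es" "set Es = {E' \<in> F. butlast E' = E}"
    "sorted_wrt (\<lambda>E1 E2. (E1, E2) \<in> prec C) Es"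
proof -
  let ?A = "{E' \<in> F. butlast E' = E}"
  let ?P = "\<lambda>Es. distinct Es \<and> set Es = ?A \<and> sorted_wrt (\<lambda>E1 E2. (E1, E2) \<in> prec C) Es"
  have EAB: "E \<in> AB" using E F_AB by blast
  have "\<exists>Es. ?P Es"
  proof (rule sorted_wrt_list_ex)
    show "finite ?A" using F_AB finite_AB by (auto intro: finite_subset)
  next
    fix X Y assume a: "X \<in> ?A" "Y \<in> ?A" "X \<noteq> Y"
    then have o: "X \<in> over C E" "Y \<in> over C E" using over_iff[OF EAB] F_AB by auto
    then have "length X = length Y" using over_length[OF EAB] by simp
    then have "last X \<inter> last Y = {}" using F_unique a by blast
    then show "(X, Y) \<in> prec C \<or> (Y, X) \<in> prec C" using precI[OF EAB o] by blast
  qed (rule prec_trans)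
  then obtain Es where Es: "?P Es" by blast
  have "(THE Es. ?P Es) = Es"
  proof (rule the_equality[of ?P, OF Es])
    fix Es' assume "?P Es'"
    then show "Es' = Es"
      using Es prec_asym sorted_wrt_list_unique[of "\<lambda>E1 E2. (E1, E2) \<in> prec C" Es' Es] by auto
  qed
  then have "kids S (Inr E) = map Inr Es" unfolding contract_def ess by simp
  then show thesis using that Es by blast
qed

lemma sb_butlast_iff: assumes "u \<in> V" "v \<in> V" shows "butlast (sb v) = sb u \<longleftrightarrow> v \<in> set (ch u)"
proof
  assume a: "butlast (sb v) = sb u"
  then have "dep v = Suc (dep u)" by (metis diff_Suc_1 length_butlast sb_length)
  then have v: "v \<in> lev (Suc (dep u))" using assms in_lev by blast
  then have "sb (anc v (dep u)) = sb u" using butlast_sb_lev a by metis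
  then have "anc v (dep u) = u" using sb_inj anc_V assms by blast
  then show "v \<in> set (ch u)" using lev_Suc_anc[OF v] by simp
qed (use butlast_sb assms in blast)

lemma F_butlast_sb: "E \<in> F \<Longrightarrow> u \<in> V \<Longrightarrow> butlast E = sb u \<longleftrightarrow> E = E0 \<and> u = w"
  using F_cl[of E] F_ns[of "sb u"] sing_sb[of u] w sb_inj[of u w] by auto

text \<open>Through \<open>phi\<close>, old and new vertices are treated alike: being a child
  becomes projection of brackets. The tree axioms and all statements about ancestors rest on
  this.\<close>

lemma kids_set: assumes x: "x \<in> verts S"
  shows "set (kids S x) = {y \<in> verts S. butlast (phi y) = phi x}"
proof (cases x)
  case (Inl u)
  then have u: "u \<in> V" "u \<notin> low" using x unfolding verts_S by auto
  have eq: "{y \<in> verts S. butlast (phi y) = phi x} =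
      Inl ` {v \<in> V - low. v \<in> set (ch u)} \<union> Inr ` {E \<in> F. E = E0 \<and> u = w}"
  proof -
    have "{v \<in> V - low. butlast (sb v) = sb u} = {v \<in> V - low. v \<in> set (ch u)}"
      using sb_butlast_iff[OF u(1)] by blast
    moreover have "{E \<in> F. butlast E = sb u} = {E \<in> F. E = E0 \<and> u = w}"
      using F_butlast_sb[OF _ u(1)] by blast
    moreover have "{y \<in> verts S. butlast (phi y) = phi x} =
        Inl ` {v \<in> V - low. butlast (sb v) = sb u} \<union> Inr ` {E \<in> F. butlast E = sb u}"
      unfolding verts_S Inl by auto
    ultimately show ?thesis by simp
  qed
  show ?thesis
  proof (cases "u = w")
    case False
    have "{v \<in> V - low. v \<in> set (ch u)} = set (ch u)"
      using low_ch[OF u(1) _ False] u ch_in[OF u(1)] by blast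
    then show ?thesis unfolding eq using kids_Inl[OF False] Inl False by simp
  next
    case True
    obtain xs ys zs where s: "ch w = xs @ ys @ zs" "set ys = W" "set xs \<inter> W = {}" "set zs \<inter> W = {}"
      "kids S (Inl w) = map Inl xs @ [Inr E0] @ map Inl zs" using w_split by metis
    have "{v \<in> V - low. v \<in> set (ch w)} = set xs \<union> set zs"
      using low_ch_w ch_in[OF w(1)] s(1-4) by auto
    moreover have "{E \<in> F. E = E0 \<and> u = w} = {E0}" using True E0_in by blast
    ultimately show ?thesis unfolding eq using s(5) Inl True by auto
  qed
next
  case (Inr E)
  then have E: "E \<in> F" using x unfolding verts_S by auto
  obtain Es where Es: "kids S (Inr E) = map Inr Es" "distinct Es" "set Es = {E' \<in> F. butlast E' = E}"
    "sorted_wrt (\<lambda>E1 E2. (E1, E2) \<in> prec C) Es" using kids_Inr[OF E] .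
  have n: "butlast (sb v) \<noteq> E" if v: "v \<in> V" for v
  proof
    assume a: "butlast (sb v) = E"
    have "E \<noteq> []" using E F_AB AB_ne by blast
    then have "2 \<le> length (sb v)" using a by (cases "sb v" rule: rev_cases) (auto simp: Suc_le_eq)
    then show False using sing_butlast[OF sing_sb[OF v]] a F_ns[OF E] by simp
  qed
  have "{y \<in> verts S. butlast (phi y) = E} =
      Inl ` {v \<in> V - low. butlast (sb v) = E} \<union> Inr ` {E' \<in> F. butlast E' = E}"
    unfolding verts_S by auto
  moreover have "{v \<in> V - low. butlast (sb v) = E} = {}" using n by blast
  ultimately have "{y \<in> verts S. butlast (phi y) = E} = Inr ` {E' \<in> F. butlast E' = E}" by (simp only: image_empty Un_empty_left)
  then show ?thesis unfolding Inr Es(1) using Es(3) by simp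
qed

text \<open>The mixed case is the new child \<open>E0\<close> among the remaining children of
  \<open>w\<close>: compare with a vertex \<open>c\<close> of \<open>W\<close> as a sibling, then
  enlarge its singleton to \<open>E0\<close>.\<close>

lemma kids_prec: assumes x: "x \<in> verts S" and p: "precedes (kids S x) y z"
  shows "(phi y, phi z) \<in> prec C"
proof (cases x)
  case (Inl u)
  then have u: "u \<in> V" "u \<notin> low" using x unfolding verts_S by auto
  have sib: "(sb a, sb b) \<in> prec C" if "precedes (ch u) a b" for a b using prec_sb[OF u(1) that] .
  have inl: "\<exists>a b. y = Inl a \<and> z = Inl b \<and> precedes l a b"
    if "precedes (map (Inl :: 'a \<Rightarrow> 'a + 'a bracket) l) y z" for l
    using that unfolding precedes_def by auto blast
  show ?thesis
  proof (cases "u = w")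
    case False
    then obtain a b where "y = Inl a" "z = Inl b" "precedes (ch u) a b"
      using p inl[of "ch u"] kids_Inl[OF False] Inl by auto
    then show ?thesis using sib by simp
  next
    case True
    obtain xs ys zs where s: "ch w = xs @ ys @ zs" "set ys = W" "ys \<noteq> []" "set xs \<inter> W = {}" "set zs \<inter> W = {}"
      "kids S (Inl w) = map Inl xs @ [Inr E0] @ map Inl zs" using w_split by metis
    obtain c where c: "c \<in> W" "c \<in> set ys" using s(2,3) by (metis last_in_set)
    have cV: "c \<in> V" "butlast (sb c) = sb w" "last (sb c) = {c}"
      using c W_ch ch_in[OF w(1)] butlast_sb[OF w(1)] last_sb by auto
    have left: "(sb a, E0) \<in> prec C" if a: "a \<in> set xs" for a
    proof -
      have "precedes (ch w) a c" unfolding s(1) precedes_append using a c by simp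
      then have "(sb a, sb c) \<in> prec C" using sib True by simp
      moreover have "last (sb a) = {a}" using last_sb[of a] ch_in[OF w(1), of a] a s(1) by simp
      ultimately show ?thesis using prec_cong_right[of "sb a" "sb c" E0] cV E0_over c s(4) a by auto
    qed
    have right: "(E0, sb b) \<in> prec C" if b: "b \<in> set zs" for b
    proof -
      have "precedes (ch w) c b" unfolding s(1) precedes_append using b c by simp
      then have "(sb c, sb b) \<in> prec C" using sib True by simp
      moreover have "last (sb b) = {b}" using last_sb[of b] ch_in[OF w(1), of b] b s(1) by simp
      ultimately show ?thesis using prec_cong_left[of "sb c" "sb b" E0] cV E0_over c s(5) b by auto
    qed
    have n: "\<not> precedes [Inr E0] y z" unfolding precedes_def by auto
    have "precedes (map Inl xs) y z \<or> precedes (map Inl zs) y z \<or> y \<in> Inl ` set xs \<and> z \<in> Inl ` set zs \<or>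
        y \<in> Inl ` set xs \<and> z = Inr E0 \<or> y = Inr E0 \<and> z \<in> Inl ` set zs"
      using p n unfolding Inl True s(6) precedes_append by auto
    then show ?thesis
    proof (elim disjE conjE)
      assume "precedes (map Inl xs) y z"
      then obtain a b where "y = Inl a" "z = Inl b" "precedes xs a b" using inl by blast
      then show ?thesis using sib[of a b] unfolding True s(1) precedes_append by simp
    next
      assume "precedes (map Inl zs) y z"
      then obtain a b where "y = Inl a" "z = Inl b" "precedes zs a b" using inl by blast
      then show ?thesis using sib[of a b] unfolding True s(1) precedes_append by simp
    next
      assume "y \<in> Inl ` set xs" "z \<in> Inl ` set zs"
      then show ?thesis using sib unfolding True s(1) precedes_append by auto
    qed (use left right in auto)
  qed
next
  case (Inr E)
  then have E: "E \<in> F" using x unfolding verts_S by auto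
  obtain Es where Es: "kids S (Inr E) = map Inr Es" "distinct Es" "set Es = {E' \<in> F. butlast E' = E}"
    "sorted_wrt (\<lambda>E1 E2. (E1, E2) \<in> prec C) Es" using kids_Inr[OF E] .
  obtain i j where ij: "i < j" "j < length Es" "y = Inr (Es ! i)" "z = Inr (Es ! j)"
    using p unfolding Inr Es(1) precedes_def by auto
  then show ?thesis using sorted_wrt_nth_less[OF Es(4) ij(1,2)] by simp
qed

lemma kids_distinct: assumes x: "x \<in> verts S" shows "distinct (kids S x)"
proof (cases x)
  case (Inl u)
  then have u: "u \<in> V" using x unfolding verts_S by auto
  show ?thesis
  proof (cases "u = w")
    case False
    then show ?thesis using kids_Inl Inl distinct_ch[OF u] by (simp add: distinct_map)
  next
    case True
    obtain xs ys zs where s: "ch w = xs @ ys @ zs"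
      "kids S (Inl w) = map Inl xs @ [Inr E0] @ map Inl zs" using w_split by metis
    then show ?thesis using Inl True distinct_ch[OF w(1)] by (auto simp: distinct_map)
  qed
next
  case (Inr E)
  then have E: "E \<in> F" using x unfolding verts_S by auto
  obtain Es where "kids S (Inr E) = map Inr Es" "distinct Es" "set Es = {E' \<in> F. butlast E' = E}"
    "sorted_wrt (\<lambda>E1 E2. (E1, E2) \<in> prec C) Es" using kids_Inr[OF E] .
  then show ?thesis using Inr by (simp add: distinct_map)
qed

lemma contract_tree: "rooted_plane_tree S"
proof (rule rooted_plane_treeI[where h = "\<lambda>x. length (phi x)"])
  show "finite (verts S)" unfolding verts_S using finite_subset[OF F_AB finite_AB] by simp
  show rS: "root_of S \<in> verts S" unfolding root_S verts_S using rt_low by simp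
  show "set (kids S u) \<subseteq> verts S" if "u \<in> verts S" for u using kids_set[OF that] by blast
  show "distinct (kids S u)" if "u \<in> verts S" for u using kids_distinct[OF that] .
  show "root_of S \<notin> set (kids S u)" if u: "u \<in> verts S" for u
  proof
    assume "root_of S \<in> set (kids S u)"
    then have "butlast (sb rt) = phi u" using kids_set[OF u] root_S by simp
    moreover have "butlast (sb rt) = []" using sb_length[of rt] by (cases "sb rt") auto
    ultimately show False using phi_ne[OF u] by simp
  qed
  show "u = u'" if "u \<in> verts S" "u' \<in> verts S" "x \<in> set (kids S u)" "x \<in> set (kids S u')" for u u' x
    using that kids_set phi_inj by auto
  show "\<exists>u\<in>verts S. v \<in> set (kids S u) \<and> length (phi u) < length (phi v)"
    if v: "v \<in> verts S" "v \<noteq> root_of S" for v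
  proof -
    have "2 \<le> length (phi v)"
    proof (cases v)
      case (Inl a)
      then have a: "a \<in> V" "a \<noteq> rt" using v unfolding verts_S root_S by auto
      then have "dep a \<noteq> 0" using address_inj[of a rt] by auto
      then have "2 \<le> Suc (dep a)" by linarith
      then show ?thesis using Inl by simp
    next
      case (Inr E)
      then show ?thesis using v F_len E0_len unfolding verts_S by fastforce
    qed
    then have "butlast (phi v) \<in> phi ` verts S" using Phi_butlast phi_Phi[OF v(1)] phi_image by blast
    then obtain u where u: "u \<in> verts S" "phi u = butlast (phi v)" by auto
    then have "v \<in> set (kids S u)" using kids_set v by auto
    moreover have "length (phi u) < length (phi v)" using u \<open>2 \<le> length (phi v)\<close> by simp
    ultimately show ?thesis using u by blast
  qed
qed

section \<open>Positions in the contraction\<close>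

sublocale S: rpt "contract T C"
  by unfold_locales (rule contract_tree)

lemma S_dep: "x \<in> verts S \<Longrightarrow> length (phi x) = Suc (length (address S x))"
proof (induction "length (address S x)" arbitrary: x)
  case 0
  then have "x = root_of S" using S.address_inj[of x "root_of S"] by simp
  then show ?case using root_S 0 by simp
next
  case (Suc k)
  then have x: "x \<in> level S (Suc k)" using S.in_lev by simp
  let ?u = "ancestor_at S x k"
  have u: "x \<in> set (kids S ?u)" "?u \<in> level S k" using S.lev_Suc_anc[OF x] by auto
  then have uv: "?u \<in> verts S" "length (address S ?u) = k" using S.in_lev by auto
  then have "butlast (phi x) = phi ?u" using kids_set u by auto
  moreover have "length (phi ?u) = Suc k" using Suc.hyps(1)[of ?u] uv by simp
  ultimately show ?case using Suc.hyps(2) phi_ne[OF Suc.prems] by (cases "phi x" rule: rev_cases) auto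
qed

lemma S_lev: "x \<in> level S k \<longleftrightarrow> x \<in> verts S \<and> length (phi x) = Suc k"
  using S.in_lev S_dep by auto

lemma S_anc: assumes x: "x \<in> level S k" and j: "j \<le> k"
  shows "phi (ancestor_at S x j) = take (Suc j) (phi x)"
  using j
proof (induction j rule: inc_induct)
  case base
  then show ?case using S.anc_self[OF x] S_lev x by simp
next
  case (step n)
  have xV: "x \<in> verts S" "length (address S x) = k" "length (phi x) = Suc k" using x S.in_lev S_lev by auto
  have "ancestor_at S x (Suc n) \<in> set (kids S (ancestor_at S x n))" using S.anc_Suc xV step by simp
  then have "phi (ancestor_at S x n) = butlast (phi (ancestor_at S x (Suc n)))"
    using kids_set[OF S.anc_V[OF xV(1)]] by simp
  also have "\<dots> = take (Suc n) (phi x)" unfolding step.IH using xV step by (simp add: butlast_take)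
  finally show ?case .
qed

text \<open>Ancestors correspond to prefixes of brackets (\<open>S_anc\<close>), so lexicographic
  comparison becomes comparison of prefixes by \<open>prec C\<close>.\<close>

lemma S_lex: assumes x: "x \<in> level S k" and y: "y \<in> level S k"
  shows "lex_less S x y \<longleftrightarrow> (\<exists>j<k. (take (Suc (Suc j)) (phi x), take (Suc (Suc j)) (phi y)) \<in> prec C)"
  unfolding S.lex_anc[OF x y]
proof (intro ex_cong1 conj_cong refl)
  fix j assume j: "j < k"
  let ?a = "ancestor_at S x" and ?b = "ancestor_at S y"
  have V: "x \<in> verts S" "y \<in> verts S" "length (address S x) = k" "length (address S y) = k"
    "length (phi x) = Suc k" "length (phi y) = Suc k"
    using x y S.in_lev S_lev by auto
  have P: "phi (?a (Suc j)) = take (Suc (Suc j)) (phi x)" "phi (?b (Suc j)) = take (Suc (Suc j)) (phi y)"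
    "phi (?a j) = take (Suc j) (phi x)" "phi (?b j) = take (Suc j) (phi y)"
    using S_anc x y j by auto
  have K: "?a (Suc j) \<in> set (kids S (?a j))" "?b (Suc j) \<in> set (kids S (?b j))"
    using S.anc_Suc V j by auto
  have av: "?a j \<in> verts S" "?b j \<in> verts S" using S.anc_V V by auto
  show "?a j = ?b j \<and> precedes (kids S (?a j)) (?a (Suc j)) (?b (Suc j)) \<longleftrightarrow>
      (take (Suc (Suc j)) (phi x), take (Suc (Suc j)) (phi y)) \<in> prec C"
  proof
    assume "?a j = ?b j \<and> precedes (kids S (?a j)) (?a (Suc j)) (?b (Suc j))"
    then show "(take (Suc (Suc j)) (phi x), take (Suc (Suc j)) (phi y)) \<in> prec C"
      using kids_prec[OF av(1)] P by metis
  next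
    assume p: "(take (Suc (Suc j)) (phi x), take (Suc (Suc j)) (phi y)) \<in> prec C"
    then have "butlast (take (Suc (Suc j)) (phi x)) = butlast (take (Suc (Suc j)) (phi y))" using precD by blast
    then have "phi (?a j) = phi (?b j)" using P V j by (simp add: butlast_take)
    then have e: "?a j = ?b j" using phi_inj av by blast
    have "?a (Suc j) \<noteq> ?b (Suc j)" using p P prec_neq by metis
    then have "precedes (kids S (?a j)) (?a (Suc j)) (?b (Suc j)) \<or> precedes (kids S (?a j)) (?b (Suc j)) (?a (Suc j))"
      using precedes_total K e by metis
    moreover have "\<not> precedes (kids S (?a j)) (?b (Suc j)) (?a (Suc j))"
      using kids_prec[OF av(1)] p P prec_asym by metis
    ultimately show "?a j = ?b j \<and> precedes (kids S (?a j)) (?a (Suc j)) (?b (Suc j))" using e by blast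
  qed
qed

text \<open>By \<open>Phi_unique\<close> the prefixes of \<open>X\<close> and \<open>Y\<close> agree
  until they separate, and there the witness in \<open>before\<close> can be traded for the prefix
  of \<open>Y\<close>. Together with \<open>S_lex\<close> this identifies \<open>before\<close> with
  the order of the contraction.\<close>

lemma before_Phi: assumes X: "X \<in> Phi" "length X = Suc k" and Y: "Y \<in> Phi" "length Y = Suc k"
    and v: "v \<in> lev k" "v \<in> last Y"
  shows "before C X v \<longleftrightarrow> (\<exists>j<k. (take (Suc (Suc j)) X, take (Suc (Suc j)) Y) \<in> prec C)"
proof -
  have b: "X \<in> brk C k" "Y \<in> brk C k" using X Y Phi_AB brk_iff by auto
  show ?thesis
  proof
    assume "before C X v"
    then obtain j Z where j: "Suc j < length X" and Z: "Z \<in> over C (take (Suc j) X)"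
      "anc v (Suc j) \<in> last Z" "(take (Suc (Suc j)) X, Z) \<in> prec C" unfolding before_def by blast
    have jk: "Suc j \<le> k" using j X by simp
    let ?Q = "take (Suc j) X" and ?X = "take (Suc (Suc j)) X" and ?Y = "take (Suc (Suc j)) Y"
    have Q: "?Q \<in> brk C j" "take (Suc j) Y \<in> brk C j" using take_brk b jk by auto
    have QAB: "?Q \<in> AB" using Q brk_iff by blast
    have "anc v (Suc j) \<in> fib ?Q" using over_fib[OF QAB Z(1)] Z by blast
    then have "anc v j \<in> last ?Q" using fib_iff'[OF Q(1)] anc_anc[of v j "Suc j"] v in_lev by simp
    moreover have "anc v j \<in> last (take (Suc j) Y)" using anc_in[OF b(2) v(2)] last_take[OF b(2)] jk by simp
    ultimately have e: "take (Suc j) Y = ?Q"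
      using Phi_unique[of "take (Suc j) Y" ?Q] Phi_take[OF X(1)] Phi_take[OF Y(1)] X Y jk by auto
    have uY: "anc v (Suc j) \<in> last ?Y" using anc_in[OF b(2) v(2) jk] last_take[OF b(2) jk] by simp
    have d: "last ?X \<inter> last ?Y = {}"
    proof (rule ccontr)
      assume "last ?X \<inter> last ?Y \<noteq> {}"
      then have "?X = ?Y"
        using Phi_take[OF X(1)] Phi_take[OF Y(1)] X Y jk by (intro Phi_unique) auto
      then show False using uY Z precD[OF Z(3)] by auto
    qed
    have "butlast Z = ?Q" using over_iff[OF QAB] Z by blast
    then have "?Y \<in> over C (butlast Z)" using take_over[OF b(2) jk] e by simp
    then have "(?X, ?Y) \<in> prec C" using prec_cong_right[OF Z(3) _ _ d] uY Z by blast
    moreover have "j < k" using jk by simp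
    ultimately show "\<exists>j<k. (take (Suc (Suc j)) X, take (Suc (Suc j)) Y) \<in> prec C" by blast
  next
    assume "\<exists>j<k. (take (Suc (Suc j)) X, take (Suc (Suc j)) Y) \<in> prec C"
    then obtain j where j: "j < k" "(take (Suc (Suc j)) X, take (Suc (Suc j)) Y) \<in> prec C" by blast
    have "butlast (take (Suc (Suc j)) X) = butlast (take (Suc (Suc j)) Y)" using precD[OF j(2)] by blast
    then have "take (Suc j) X = take (Suc j) Y" using X Y j by (simp add: butlast_take)
    then have "take (Suc (Suc j)) Y \<in> over C (take (Suc j) X)" using take_over[OF b(2)] j by simp
    moreover have "anc v (Suc j) \<in> last (take (Suc (Suc j)) Y)"
      using anc_in[OF b(2) v(2)] last_take[OF b(2)] j by simp
    ultimately show "before C X v" unfolding before_def using j X by auto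
  qed
qed

lemma contract_map_phi: assumes v: "v \<in> lev k"
  shows "contract_map T C v \<in> level S k \<and> v \<in> last (phi (contract_map T C v))"
proof (cases "v \<in> low")
  case True
  obtain E where E: "E \<in> F" "length E = Suc k" "v \<in> last E" using low_ex[OF v True] by blast
  have d: "dep v = k" using v in_lev by blast
  have l: "last X = X ! k" if "X \<in> brk C k" for X using br_last br that by blast
  have "(THE E. E \<in> F \<and> E \<in> brk C k \<and> v \<in> E ! k) = E"
  proof (rule the_equality)
    have "E \<in> brk C k" using E F_AB brk_iff by blast
    then show "E \<in> F \<and> E \<in> brk C k \<and> v \<in> E ! k" using E l by simp
  next
    fix X assume "X \<in> F \<and> X \<in> brk C k \<and> v \<in> X ! k"
    then show "X = E" using F_unique[of X E] E l brk_iff by auto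
  qed
  then have "contract_map T C v = Inr E"
    using True unfolding contract_map_def fset low_eq ess d by simp
  then show ?thesis using E S_lev unfolding verts_S by simp
next
  case False
  then have "contract_map T C v = Inl v" unfolding contract_map_def fset low_eq by simp
  then show ?thesis using v False S_lev last_sb in_lev unfolding verts_S by auto
qed

text \<open>With the constant 1 a singleton gets 1 minus the number of slice members through its
  vertex, and that number is 1 on \<open>low\<close> and 0 elsewhere.\<close>

lemma wt_Phi: assumes Y: "Y \<in> brk C k" shows "wt C 1 (ind F) Y = (if Y \<in> Phi then 1 else 0)"
proof (cases "sing Y")
  case True
  obtain z where z: "z \<in> lev k" "Y = sb z" "last Y = {z}" using singE[OF True br[OF Y]] .
  have zV: "z \<in> V" using z in_lev by blast
  have ind1: "(\<Sum>X\<in>nsg C k z. ind F X) = real (card {X \<in> nsg C k z. X \<in> F})"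
    unfolding ind_def by (subst sum.inter_filter[symmetric]) simp_all
  have "Y \<in> Phi \<longleftrightarrow> z \<notin> low"
  proof -
    have "Y \<notin> F" using True F_ns by blast
    moreover have "Y \<in> sb ` (V - low) \<longleftrightarrow> z \<in> V - low" using z(2) zV sb_inj by blast
    ultimately show ?thesis using zV unfolding Phi_def by blast
  qed
  moreover have "card {X \<in> nsg C k z. X \<in> F} = (if z \<in> low then 1 else 0)"
  proof (cases "z \<in> low")
    case True
    obtain E where E: "E \<in> F" "length E = Suc k" "z \<in> last E" using low_ex[OF z(1) True] by blast
    have "{X \<in> nsg C k z. X \<in> F} = {E}"
    proof (intro equalityI subsetI)
      fix X assume X: "X \<in> {X \<in> nsg C k z. X \<in> F}"
      then have "X \<in> F" "length X = Suc k" "z \<in> last X" using brk_iff unfolding nsg_def by auto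
      then show "X \<in> {E}" using F_unique[of X E] E by auto
    next
      fix X assume "X \<in> {E}"
      moreover have "E \<in> brk C k" "\<not> sing E" using E F_AB F_ns brk_iff by auto
      ultimately show "X \<in> {X \<in> nsg C k z. X \<in> F}" using E unfolding nsg_def by simp
    qed
    then show ?thesis using True by simp
  next
    case False
    have "{X \<in> nsg C k z. X \<in> F} = {}" using F_low False unfolding nsg_def by auto
    then show ?thesis using False by simp
  qed
  ultimately show ?thesis using wt_sb[OF z(1)] z(2) ind1 by simp
next
  case False
  then have "Y \<in> Phi \<longleftrightarrow> Y \<in> F" using sing_sb unfolding Phi_def by blast
  then show ?thesis using wt_nonsing[OF False] unfolding ind_def by simp
qed

lemma pos_contract: assumes v: "v \<in> lev k"
  shows "real (pos S (contract_map T C v)) = 1 + ypos C (wt C 1 (ind F)) k v"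
proof -
  let ?x = "contract_map T C v"
  have x: "?x \<in> level S k" "v \<in> last (phi ?x)" using contract_map_phi[OF v] by auto
  have px: "phi ?x \<in> Phi" "length (phi ?x) = Suc k" using x S_lev phi_Phi by auto
  have "phi ` {z \<in> level S k. lex_less S z ?x} = {Y \<in> brk C k. before C Y v \<and> Y \<in> Phi}"
  proof (intro equalityI subsetI)
    fix Y assume "Y \<in> phi ` {z \<in> level S k. lex_less S z ?x}"
    then obtain z where z: "z \<in> level S k" "lex_less S z ?x" "Y = phi z" by blast
    have Y: "Y \<in> Phi" "length Y = Suc k" using z S_lev phi_Phi by auto
    then have "before C Y v" using before_Phi[OF Y px v x(2)] S_lex[OF z(1) x(1)] z by blast
    then show "Y \<in> {Y \<in> brk C k. before C Y v \<and> Y \<in> Phi}" using Y Phi_AB brk_iff by blast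
  next
    fix Y assume Y: "Y \<in> {Y \<in> brk C k. before C Y v \<and> Y \<in> Phi}"
    then have Y': "Y \<in> Phi" "length Y = Suc k" using brk_iff by auto
    then obtain z where z: "z \<in> verts S" "Y = phi z" using phi_image by blast
    then have zl: "z \<in> level S k" using S_lev Y' by blast
    then have "lex_less S z ?x" using before_Phi[OF Y' px v x(2)] S_lex[OF zl x(1)] z Y by blast
    then show "Y \<in> phi ` {z \<in> level S k. lex_less S z ?x}" using z zl by blast
  qed
  moreover have "inj_on phi {z \<in> level S k. lex_less S z ?x}"
  proof (rule inj_onI)
    fix y z assume "y \<in> {z \<in> level S k. lex_less S z ?x}" "z \<in> {z \<in> level S k. lex_less S z ?x}" "phi y = phi z"
    then show "y = z" using phi_inj[of y z] unfolding S_lev by blast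
  qed
  ultimately have "card {z \<in> level S k. lex_less S z ?x} = card {Y \<in> brk C k. before C Y v \<and> Y \<in> Phi}"
    using card_image[of phi "{z \<in> level S k. lex_less S z ?x}"] by simp
  also have "real \<dots> = (\<Sum>Y | Y \<in> brk C k \<and> before C Y v. if Y \<in> Phi then 1 else 0)"
    by (subst sum.inter_filter[symmetric]) (simp_all add: conj_assoc)
  also have "\<dots> = ypos C (wt C 1 (ind F)) k v"
    unfolding ypos_def using wt_Phi by (intro sum.cong) auto
  finally show ?thesis using S.pos_lev[OF x(1)] by simp
qed

lemma rho_Gam: "rho T C = Gam C (ind F)"
proof (intro ext)
  fix k i
  show "rho T C k i = Gam C (ind F) k i"
  proof (cases "(k, i) \<in> coords T")
    case True
    then show ?thesis
      using Gam_shift[OF True, of "ind F" 1] pos_contract[OF coords_nth(1)[OF True]]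
        pos_contract[OF coords_nth(2)[OF True]] C_ne_min unfolding rho_def by simp
  next
    case False
    then show ?thesis using C_ne_min unfolding rho_def Gam_def by simp
  qed
qed

end

section \<open>The vectors \<open>rho\<close> as values of \<open>Gam\<close>\<close>

context bing
begin

text \<open>With the constant 1 a singleton on a level of at least two vertices has weight 1 - 1 =
  0, and the maximum stands before nothing. All weighted positions vanish and only the shift by 1
  remains.\<close>

lemma rho_min: "rho T (min_bracketing T) = Gam B (ind mxs)"
proof (intro ext)
  fix k i
  show "rho T (min_bracketing T) k i = Gam B (ind mxs) k i"
  proof (cases "(k, i) \<in> coords T")
    case True
    then have k: "k \<le> tree_depth T" "2 \<le> card (lev k)" unfolding coords_def by auto
    have mb: "mx k \<in> brk B k" using mx_brk k by blast
    have ns: "\<not> sing (mx k)"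
    proof
      assume "sing (mx k)"
      then obtain u where "last (mx k) = {u}" using singE br[OF mb] by metis
      then show False using k by simp
    qed
    have mm: "mx k \<in> mxs" using ns k unfolding mxs_def is_max_bracket_def by blast
    have uniq: "Y = mx k" if "Y \<in> brk B k" "Y \<in> mxs" for Y
      using that ismx_iff br unfolding mxs_def by blast
    have "ypos B (wt B 1 (ind mxs)) k v = 0" if v: "v \<in> lev k" for v
      unfolding ypos_def
    proof (rule sum.neutral, rule ballI)
      fix Y assume "Y \<in> {Y \<in> brk B k. before B Y v}"
      then have Y: "Y \<in> brk B k" "before B Y v" by auto
      have "Y \<noteq> mx k"
      proof
        assume e: "Y = mx k"
        obtain j X where j: "Suc j < length Y" and X: "X \<in> over B (take (Suc j) Y)"
          "(take (Suc (Suc j)) Y, X) \<in> prec B" using Y(2) unfolding before_def by blast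
        have t: "take (Suc (Suc j)) Y = mx (Suc j)" using e j take_mx[of "Suc j" k] by simp
        have "X \<in> AB" "length X = Suc (Suc j)" using prec_AB[OF X(2)] precD[OF X(2)] t by auto
        then have "last X \<subseteq> lev (Suc j)" "last X \<noteq> {}" using last_lev last_ne brk_iff by auto
        then show False using precD(3)[OF X(2)] t by auto
      qed
      then have nm: "Y \<notin> mxs" using uniq Y by blast
      show "wt B 1 (ind mxs) Y = 0"
      proof (cases "sing Y")
        case True
        obtain z where z: "z \<in> lev k" "Y = sb z" using singE[OF True br[OF Y(1)]] .
        have "mx k \<in> nsg B k z" using mb ns z unfolding nsg_def by simp
        then have "(\<Sum>X\<in>nsg B k z. ind mxs X) = (\<Sum>X\<in>{mx k}. ind mxs X)"
          using uniq unfolding ind_def by (intro sum.mono_neutral_right) (auto simp: nsg_def)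
        then show ?thesis using wt_sb[OF z(1)] z mm unfolding ind_def by simp
      next
        case False
        then show ?thesis using wt_nonsing nm unfolding ind_def by simp
      qed
    qed
    then show ?thesis
      using Gam_shift[OF True, of "ind mxs" 1] coords_nth[OF True] True unfolding rho_def ones_def by simp
  next
    case False
    then show ?thesis unfolding rho_def Gam_def ones_def by simp
  qed
qed

lemma collision_below: assumes C: "C \<in> collisions T" "C \<preceq>\<^sub>K B"
  shows "snd (ell T C) \<in> cone B" "Gam B (snd (ell T C)) = rho T C"
    "\<And>A. 0 < snd (ell T C) A \<Longrightarrow> A \<in> all_brk C" "fst (ell T C) = C"
    "supp B (snd (ell T C)) = C" "C \<noteq> min_bracketing T"
proof -
  have Cb: "is_bracketing T C" using C unfolding collisions_def bracketings_def by auto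
  obtain E0 F where S: "sliced T C E0 F" "\<exists>A\<in>F. nontrivial T A" "restr C (triv T \<union> F) = C"
    using collision_slice[OF C(1)] .
  interpret S: collided T C E0 F using S by (simp add: collided_def collided_axioms_def)
  have e: "ell T C = (C, ind F)" using S.ell_CF[OF S(2)] S(3) by simp
  have z: "ind F A = 0" if "A \<notin> all_brk C" for A using that S.F_AB unfolding ind_def by auto
  show c: "snd (ell T C) \<in> cone B" using cone_extend[OF Cb C(2) S.ind_cone] e by simp
  show "Gam B (snd (ell T C)) = rho T C"
    using S.rho_Gam Gam_sub[OF Cb C(2), of "ind F"] z e by simp
  show "\<And>A. 0 < snd (ell T C) A \<Longrightarrow> A \<in> all_brk C" using z e by fastforce
  show "fst (ell T C) = C" using e by simp
  show "C \<noteq> min_bracketing T" by (rule S.C_ne_min)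
  have "all_brk (supp B (snd (ell T C))) = all_brk C"
    unfolding all_brk_supp e S.AC using triv_AB S.F_AB le_all_brk[OF C(2)] unfolding ind_def by auto
  then show "supp B (snd (ell T C)) = C"
    using eq_iff[OF supp_bracketing[OF c] supp_le Cb C(2)] by blast
qed

end

section \<open>Weighted ordered laminar families\<close>

text \<open>
  The brackets directly above a fixed bracket form a laminar family of subsets of its fibre, with an
  order on disjoint members. Weights whose sum over the members containing \<open>v\<close> is \<open>W\<close> for every \<open>v\<close>
  turn the family into an ultrametric tree with closeness \<open>sg\<close>.
\<close>

locale olam =
  fixes U :: "'a set" and XX :: "'x set" and tp :: "'x \<Rightarrow> 'a set"
    and R :: "('x \<times> 'x) set" and w :: "'x \<Rightarrow> real" and W :: real
  assumes finU: "finite U" and finX: "finite XX"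
    and tp_sub: "X \<in> XX \<Longrightarrow> tp X \<subseteq> U" and tp_ne: "X \<in> XX \<Longrightarrow> tp X \<noteq> {}"
    and lam: "X \<in> XX \<Longrightarrow> Y \<in> XX \<Longrightarrow> tp X \<inter> tp Y \<noteq> {} \<Longrightarrow> tp X \<subseteq> tp Y \<or> tp Y \<subseteq> tp X"
    and inj: "X \<in> XX \<Longrightarrow> Y \<in> XX \<Longrightarrow> tp X = tp Y \<Longrightarrow> X = Y"
    and minex: "v \<in> U \<Longrightarrow> \<exists>X\<in>XX. v \<in> tp X \<and> (\<forall>Z\<in>XX. tp Z \<inter> tp X \<noteq> {} \<longrightarrow> tp X \<subseteq> tp Z)"
    and tot: "X \<in> XX \<Longrightarrow> Y \<in> XX \<Longrightarrow> tp X \<inter> tp Y = {} \<Longrightarrow> (X, Y) \<in> R \<or> (Y, X) \<in> R"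
    and dis: "(X, Y) \<in> R \<Longrightarrow> tp X \<inter> tp Y = {}"
    and tr: "(X, Y) \<in> R \<Longrightarrow> (Y, Z) \<in> R \<Longrightarrow> (X, Z) \<in> R"
    and asy: "(X, Y) \<in> R \<Longrightarrow> (Y, X) \<notin> R"
    and cong_r: "(Y, X) \<in> R \<Longrightarrow> X \<in> XX \<Longrightarrow> Y \<in> XX \<Longrightarrow> X' \<in> XX \<Longrightarrow> tp X \<inter> tp X' \<noteq> {} \<Longrightarrow>
      tp Y \<inter> tp X' = {} \<Longrightarrow> (Y, X') \<in> R"
    and cong_l: "(X, Y) \<in> R \<Longrightarrow> X \<in> XX \<Longrightarrow> Y \<in> XX \<Longrightarrow> X' \<in> XX \<Longrightarrow> tp X \<inter> tp X' \<noteq> {} \<Longrightarrow>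
      tp Y \<inter> tp X' = {} \<Longrightarrow> (X', Y) \<in> R"
    and wpos: "X \<in> XX \<Longrightarrow> 0 < w X"
    and fl: "v \<in> U \<Longrightarrow> W = (\<Sum>X | X \<in> XX \<and> v \<in> tp X. w X)"
begin

definition lt :: "'a \<Rightarrow> 'a \<Rightarrow> bool" where
  "lt u v \<longleftrightarrow> (\<exists>X\<in>XX. \<exists>Y\<in>XX. u \<in> tp X \<and> v \<in> tp Y \<and> (X, Y) \<in> R)"

definition bef :: "'x \<Rightarrow> 'a \<Rightarrow> bool" where
  "bef X v \<longleftrightarrow> (\<exists>Y\<in>XX. v \<in> tp Y \<and> (X, Y) \<in> R)"

definition sg :: "'a \<Rightarrow> 'a \<Rightarrow> real" where
  "sg u v = (\<Sum>X | X \<in> XX \<and> u \<in> tp X \<and> v \<in> tp X. w X)"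

definition gap :: "'a \<Rightarrow> 'a \<Rightarrow> real" where
  "gap u v = (\<Sum>X | X \<in> XX \<and> bef X v. w X) - (\<Sum>X | X \<in> XX \<and> bef X u. w X)"

definition mn :: "'a \<Rightarrow> 'x" where
  "mn v = (SOME X. X \<in> XX \<and> v \<in> tp X \<and> (\<forall>Z\<in>XX. tp Z \<inter> tp X \<noteq> {} \<longrightarrow> tp X \<subseteq> tp Z))"

lemma mn: assumes "v \<in> U"
  shows mn_in: "mn v \<in> XX" and mn_mem: "v \<in> tp (mn v)"
    and mn_min: "Z \<in> XX \<Longrightarrow> tp Z \<inter> tp (mn v) \<noteq> {} \<Longrightarrow> tp (mn v) \<subseteq> tp Z"
proof -
  have "\<exists>X. X \<in> XX \<and> v \<in> tp X \<and> (\<forall>Z\<in>XX. tp Z \<inter> tp X \<noteq> {} \<longrightarrow> tp X \<subseteq> tp Z)" using minex[OF assms] by blast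
  from someI_ex[OF this] show "mn v \<in> XX" "v \<in> tp (mn v)"
    "Z \<in> XX \<Longrightarrow> tp Z \<inter> tp (mn v) \<noteq> {} \<Longrightarrow> tp (mn v) \<subseteq> tp Z"
    unfolding mn_def by blast+
qed

lemma mn_le: "X \<in> XX \<Longrightarrow> v \<in> tp X \<Longrightarrow> tp (mn v) \<subseteq> tp X"
  using mn_min[of v X] mn_mem[of v] tp_sub by blast

lemma mn_notin: "v \<in> U \<Longrightarrow> X \<in> XX \<Longrightarrow> v \<notin> tp X \<Longrightarrow> tp X \<inter> tp (mn v) = {}"
  using mn_min mn_mem by blast

lemma bef_mn: assumes v: "v \<in> U" and X: "X \<in> XX" shows "bef X v \<longleftrightarrow> (X, mn v) \<in> R"
proof
  assume "bef X v"
  then obtain Y where Y: "Y \<in> XX" "v \<in> tp Y" "(X, Y) \<in> R" unfolding bef_def by blast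
  have "v \<notin> tp X" using dis[OF Y(3)] Y(2) by blast
  then show "(X, mn v) \<in> R"
    using cong_r[OF Y(3) Y(1) X mn_in[OF v]] mn_notin[OF v X] mn_mem[OF v] Y(2) by blast
next
  assume "(X, mn v) \<in> R" then show "bef X v" unfolding bef_def using mn_in mn_mem v by blast
qed

lemma lt_bef: assumes "u \<in> U" "v \<in> U" shows "lt u v \<longleftrightarrow> (mn u, mn v) \<in> R"
proof
  assume "lt u v"
  then obtain X Y where XY: "X \<in> XX" "Y \<in> XX" "u \<in> tp X" "v \<in> tp Y" "(X, Y) \<in> R" unfolding lt_def by blast
  then have b: "(X, mn v) \<in> R" using bef_mn[OF assms(2) XY(1)] unfolding bef_def by blast
  have "tp (mn u) \<subseteq> tp X" using mn_le XY by blast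
  then have "tp (mn v) \<inter> tp (mn u) = {}" using dis[OF b] by blast
  then show "(mn u, mn v) \<in> R"
    using cong_l[OF b XY(1) mn_in[OF assms(2)] mn_in[OF assms(1)]] XY(3) mn_mem[OF assms(1)] by blast
next
  assume "(mn u, mn v) \<in> R" then show "lt u v" unfolding lt_def using mn_in mn_mem assms by blast
qed

lemma lt_trans: "u \<in> U \<Longrightarrow> v \<in> U \<Longrightarrow> z \<in> U \<Longrightarrow> lt u v \<Longrightarrow> lt v z \<Longrightarrow> lt u z"
  using lt_bef tr by blast

lemma lt_asym: "u \<in> U \<Longrightarrow> v \<in> U \<Longrightarrow> lt u v \<Longrightarrow> \<not> lt v u"
  using lt_bef asy by blast

lemma not_lt: assumes "u \<in> U" "v \<in> U" "\<not> lt u v" "\<not> lt v u" shows "mn u = mn v"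
proof -
  have "tp (mn u) \<inter> tp (mn v) \<noteq> {}" using tot[of "mn u" "mn v"] assms mn_in lt_bef by blast
  then have "tp (mn u) = tp (mn v)" using mn_min[OF assms(1) mn_in[OF assms(2)]]
      mn_min[OF assms(2) mn_in[OF assms(1)]] by blast
  then show ?thesis using inj mn_in assms by blast
qed

lemma sep_bef: assumes "u \<in> U" "v \<in> U" "lt u v" "X \<in> XX" "u \<in> tp X" "v \<notin> tp X"
  shows "bef X v" "\<not> bef X u"
proof -
  have "(mn u, mn v) \<in> R" using assms lt_bef by blast
  moreover have "tp X \<inter> tp (mn v) = {}" using mn_notin assms by blast
  ultimately have "(X, mn v) \<in> R"
    using cong_l[of "mn u" "mn v" X] mn_in mn_mem assms by blast
  then show "bef X v" using bef_mn assms by blast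
  show "\<not> bef X u" unfolding bef_def using dis assms by blast
qed

lemma gap_lt: assumes "u \<in> U" "v \<in> U" "lt u v"
  shows "gap u v = (\<Sum>X | X \<in> XX \<and> bef X v \<and> \<not> bef X u. w X)"
proof -
  have sub: "{X. X \<in> XX \<and> bef X u} \<subseteq> {X. X \<in> XX \<and> bef X v}"
    using bef_mn lt_bef assms tr by blast
  have "{X. X \<in> XX \<and> bef X v \<and> \<not> bef X u} = {X. X \<in> XX \<and> bef X v} - {X. X \<in> XX \<and> bef X u}" by blast
  then show ?thesis unfolding gap_def using sum_diff[OF _ sub, of w] finX by simp
qed

lemma W_sg: assumes u: "u \<in> U"
  shows "W - sg u v = (\<Sum>X | X \<in> XX \<and> u \<in> tp X \<and> v \<notin> tp X. w X)"
proof -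
  have "(\<Sum>X | X \<in> XX \<and> u \<in> tp X. w X) = sg u v + (\<Sum>X | X \<in> XX \<and> u \<in> tp X \<and> v \<notin> tp X. w X)"
    unfolding sg_def using finX by (subst sum.union_disjoint[symmetric]) (auto intro!: sum.cong)
  then show ?thesis using fl[OF u] by simp
qed

text \<open>The members through \<open>u\<close> that miss \<open>v\<close> have total weight
  \<open>W - sg u v\<close>, and all of them lie to the left of \<open>v\<close> but not of
  \<open>u\<close>. Members strictly between may add more.\<close>

lemma gap_ge: assumes "u \<in> U" "v \<in> U" "lt u v" shows "W - sg u v \<le> gap u v"
  unfolding W_sg[OF assms(1)] gap_lt[OF assms]
  by (rule sum_mono2) (use finX wpos sep_bef[OF assms] in \<open>auto intro: less_imp_le\<close>)

lemma lt_notin: assumes "u \<in> U" "v \<in> U" "lt u v" shows "v \<notin> tp (mn u)"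
proof
  assume "v \<in> tp (mn u)"
  moreover have "(mn u, mn v) \<in> R" using assms lt_bef by blast
  ultimately show False using dis mn_mem assms by blast
qed

lemma sg_less: assumes "u \<in> U" "v \<in> U" "lt u v" shows "sg u v < W"
proof -
  have "w (mn u) \<le> (\<Sum>X | X \<in> XX \<and> u \<in> tp X \<and> v \<notin> tp X. w X)"
    using finX wpos mn_in mn_mem lt_notin[OF assms] assms
    by (intro member_le_sum) (auto intro: less_imp_le)
  then show ?thesis using W_sg[OF assms(1), of v] wpos[OF mn_in[OF assms(1)]] by linarith
qed

lemma gap_same: assumes "u \<in> U" "v \<in> U" "\<not> lt u v" "\<not> lt v u" shows "gap u v = 0" "sg u v = W"
proof -
  have e: "mn u = mn v" using not_lt assms by blast
  have "{X. X \<in> XX \<and> bef X u} = {X. X \<in> XX \<and> bef X v}" using bef_mn assms e by auto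
  then show "gap u v = 0" unfolding gap_def by simp
  have z: "{X. X \<in> XX \<and> u \<in> tp X \<and> v \<notin> tp X} = {}"
    using mn_le[of _ u] mn_mem[OF assms(2)] unfolding e by blast
  show "sg u v = W" using W_sg[OF assms(1), of v] unfolding z by simp
qed

text \<open>A member to the left of \<open>v\<close> and not of \<open>u\<close> must contain
  \<open>u\<close>, because otherwise each of its points would lie between the two.\<close>

lemma gap_adj: assumes "u \<in> U" "v \<in> U" "lt u v" "\<And>z. z \<in> U \<Longrightarrow> lt u z \<Longrightarrow> lt z v \<Longrightarrow> False"
  shows "gap u v = W - sg u v"
proof -
  have "u \<in> tp X \<and> v \<notin> tp X" if X: "X \<in> XX" "bef X v" "\<not> bef X u" for X
  proof -
    have "v \<notin> tp X" using X(2) dis unfolding bef_def by blast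
    moreover have "u \<in> tp X"
    proof (rule ccontr)
      assume "u \<notin> tp X"
      then have "tp X \<inter> tp (mn u) = {}" using mn_notin assms X by blast
      then have uX: "(mn u, X) \<in> R" using tot[OF X(1) mn_in[OF assms(1)]] bef_mn[OF assms(1) X(1)] X(3) by blast
      obtain z where z: "z \<in> tp X" using tp_ne[OF X(1)] by blast
      have "lt u z" unfolding lt_def using uX X(1) z mn_in mn_mem assms by blast
      moreover have "lt z v" using X z unfolding lt_def bef_def by blast
      moreover have "z \<in> U" using z tp_sub X by blast
      ultimately show False using assms(4) by blast
    qed
    ultimately show ?thesis by blast
  qed
  then have "{X. X \<in> XX \<and> bef X v \<and> \<not> bef X u} = {X. X \<in> XX \<and> u \<in> tp X \<and> v \<notin> tp X}"
    using sep_bef[OF assms(1-3)] by blast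
  then show ?thesis unfolding W_sg[OF assms(1)] gap_lt[OF assms(1-3)] by simp
qed

lemma gap_anti: "gap v u = - gap u v"
  unfolding gap_def by simp

lemma sg_sym: "sg u v = sg v u"
  unfolding sg_def by (rule sum.cong) auto

lemma sg_mono: "(\<And>X. X \<in> XX \<Longrightarrow> u \<in> tp X \<Longrightarrow> v \<in> tp X \<Longrightarrow> u' \<in> tp X \<and> v' \<in> tp X) \<Longrightarrow> sg u v \<le> sg u' v'"
  unfolding sg_def using finX wpos by (intro sum_mono2) (auto intro: less_imp_le)

text \<open>If some member through \<open>u\<close> and \<open>z\<close> misses \<open>v\<close>,
  then by laminarity every member through \<open>z\<close> and \<open>v\<close> contains it, hence
  contains \<open>u\<close>.\<close>

lemma sg_ultra: "min (sg u z) (sg z v) \<le> sg u v"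
proof (cases "\<forall>X\<in>XX. u \<in> tp X \<and> z \<in> tp X \<longrightarrow> v \<in> tp X")
  case True
  then have "sg u z \<le> sg u v" by (intro sg_mono) auto
  then show ?thesis by simp
next
  case False
  then obtain A where A: "A \<in> XX" "u \<in> tp A" "z \<in> tp A" "v \<notin> tp A" by blast
  have "u \<in> tp X" if "X \<in> XX" "z \<in> tp X" "v \<in> tp X" for X using lam[OF A(1) that(1)] A that by blast
  then have "sg z v \<le> sg u v" by (intro sg_mono) auto
  then show ?thesis by simp
qed

text \<open>If \<open>X\<close> missed \<open>z\<close>, it would be disjoint from the innermost
  member around \<open>z\<close> and would have to lie on both sides of it.\<close>

lemma between: assumes "u \<in> U" "v \<in> U" "z \<in> U" "lt u z" "lt z v" and X: "X \<in> XX" "u \<in> tp X" "v \<in> tp X"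
  shows "z \<in> tp X"
proof (rule ccontr)
  assume n: "z \<notin> tp X"
  have d: "tp X \<inter> tp (mn z) = {}" using mn_notin assms n by blast
  have "(mn u, mn z) \<in> R" "(mn z, mn v) \<in> R" using lt_bef assms by blast+
  then have "(X, mn z) \<in> R" "(mn z, X) \<in> R"
    using cong_l[of "mn u" "mn z" X] cong_r[of "mn z" "mn v" X] d X mn_in mn_mem assms by blast+
  then show False using asy by blast
qed

lemma sg_between: assumes "u \<in> U" "v \<in> U" "z \<in> U" "lt u z" "lt z v"
  shows "sg u v \<le> sg u z" "sg u v \<le> sg z v"
  using between[OF assms] by (intro sg_mono; blast)+

text \<open>The largest radius at which \<open>Y\<close> is a ball of the closeness
  \<open>sg\<close> around any of its points, see \<open>ball_SS\<close>.\<close>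

definition SS :: "'x \<Rightarrow> real" where "SS Y = (\<Sum>X | X \<in> XX \<and> tp Y \<subseteq> tp X. w X)"

lemma SS_bounds: assumes Y: "Y \<in> XX" shows "0 < SS Y" "SS Y \<le> W"
proof -
  have "w Y \<le> SS Y" unfolding SS_def using Y finX wpos by (intro member_le_sum) (auto intro: less_imp_le)
  then show "0 < SS Y" using wpos[OF Y] by linarith
  obtain u where u: "u \<in> tp Y" using tp_ne Y by blast
  then have "W = (\<Sum>X | X \<in> XX \<and> u \<in> tp X. w X)" using fl tp_sub Y by blast
  moreover have "SS Y \<le> (\<Sum>X | X \<in> XX \<and> u \<in> tp X. w X)"
    unfolding SS_def by (rule sum_mono2) (use u finX wpos in \<open>auto intro: less_imp_le\<close>)
  ultimately show "SS Y \<le> W" by simp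
qed

lemma SS_le_sg: assumes "u \<in> tp Y" "v \<in> tp Y" shows "SS Y \<le> sg u v"
  unfolding SS_def sg_def using finX wpos assms by (intro sum_mono2) (auto intro: less_imp_le)

text \<open>The largest member through \<open>u\<close> of radius at least \<open>r\<close> is the
  ball. If it missed a point \<open>v\<close> with \<open>r \<le> sg u v\<close>, the smallest
  member through both points would also have radius at least \<open>r\<close> and be larger.\<close>

lemma ball: assumes u: "u \<in> U" and r: "0 < r" "r \<le> W"
  shows "\<exists>Y\<in>XX. tp Y = {v \<in> U. r \<le> sg u v} \<and> r \<le> SS Y"
proof -
  let ?c = "{X \<in> XX. u \<in> tp X \<and> r \<le> SS X}"
  \<comment> \<open>The innermost member around \<open>u\<close> has the full radius
    \<open>W\<close>, so there is a member to start from.\<close>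
  have "{X. X \<in> XX \<and> u \<in> tp X} = {X. X \<in> XX \<and> tp (mn u) \<subseteq> tp X}" using mn_le mn_mem[OF u] by blast
  then have "SS (mn u) = W" unfolding SS_def using fl[OF u] by simp
  then have "mn u \<in> ?c" using mn_in mn_mem u r by simp
  moreover have "\<forall>X. X \<in> ?c \<longrightarrow> card (tp X) < Suc (card U)"
    using card_mono[OF finU] tp_sub by (simp add: less_Suc_eq_le)
  ultimately obtain Y where Y: "Y \<in> ?c" and mx: "\<And>X. X \<in> ?c \<Longrightarrow> card (tp X) \<le> card (tp Y)"
    using ex_has_greatest_nat[of "\<lambda>X. X \<in> ?c" "mn u" "\<lambda>X. card (tp X)" "Suc (card U)"] by blast
  have "v \<in> tp Y \<longleftrightarrow> r \<le> sg u v" if v: "v \<in> U" for v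
  proof
    assume "v \<in> tp Y"
    then show "r \<le> sg u v" using SS_le_sg[of u Y v] Y by simp
  next
    assume s: "r \<le> sg u v"
    show "v \<in> tp Y"
    proof (rule ccontr)
      assume n: "v \<notin> tp Y"
      let ?d = "{X \<in> XX. u \<in> tp X \<and> v \<in> tp X}"
      have "?d \<noteq> {}"
      proof
        assume "?d = {}"
        then have "sg u v = 0" unfolding sg_def by (metis (no_types, lifting) sum.empty)
        then show False using s r by simp
      qed
      then obtain X0 where X0: "X0 \<in> ?d" and mi: "\<And>X. X \<in> ?d \<Longrightarrow> card (tp X0) \<le> card (tp X)"
        using ex_has_least_nat[of "\<lambda>X. X \<in> ?d" _ "\<lambda>X. card (tp X)"] by blast
      have fin: "finite (tp X)" if "X \<in> XX" for X using tp_sub[OF that] finU finite_subset by blast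
      have sub: "tp X0 \<subseteq> tp X" if X: "X \<in> ?d" for X
      proof -
        have "finite (tp X0)" using fin X0 by blast
        then have "\<not> tp X \<subset> tp X0" using psubset_card_mono[of "tp X0" "tp X"] mi[OF X] by linarith
        moreover have "tp X \<subseteq> tp X0 \<or> tp X0 \<subseteq> tp X" using lam[of X X0] X X0 by blast
        ultimately show ?thesis by blast
      qed
      have "sg u v \<le> SS X0"
        unfolding SS_def sg_def using sub finX wpos by (intro sum_mono2) (auto intro: less_imp_le)
      then have "X0 \<in> ?c" using X0 s by simp
      then have le: "card (tp X0) \<le> card (tp Y)" using mx by blast
      have "tp Y \<subset> tp X0" using lam[of Y X0] Y X0 n by blast
      moreover have "finite (tp X0)" using fin X0 by blast
      ultimately show False using psubset_card_mono[of "tp X0" "tp Y"] le by linarith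
    qed
  qed
  then have "tp Y = {v \<in> U. r \<le> sg u v}" using tp_sub[of Y] Y by blast
  then show ?thesis using Y by blast
qed

text \<open>The ball is a member \<open>Z\<close> containing \<open>Y\<close> whose radius is not
  smaller. A strictly larger member would have a radius smaller by at least
  \<open>w Y\<close>.\<close>

lemma ball_SS: assumes Y: "Y \<in> XX" and u: "u \<in> tp Y" shows "tp Y = {v \<in> U. SS Y \<le> sg u v}"
proof -
  have uU: "u \<in> U" using tp_sub Y u by blast
  obtain Z where Z: "Z \<in> XX" "tp Z = {v \<in> U. SS Y \<le> sg u v}" "SS Y \<le> SS Z"
    using ball[OF uU SS_bounds[OF Y]] by blast
  have YZ: "tp Y \<subseteq> tp Z" using Z(2) SS_le_sg[OF u] tp_sub[OF Y] by blast
  have "tp Z \<subseteq> tp Y"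
  proof (rule ccontr)
    assume n: "\<not> tp Z \<subseteq> tp Y"
    have "w Y + SS Z = (\<Sum>X\<in>insert Y {X. X \<in> XX \<and> tp Z \<subseteq> tp X}. w X)"
      unfolding SS_def using n finX by (subst sum.insert) auto
    also have "\<dots> \<le> SS Y" unfolding SS_def using YZ Y finX wpos
      by (intro sum_mono2) (auto intro: less_imp_le)
    finally show False using Z(3) wpos[OF Y] by linarith
  qed
  then show ?thesis using YZ Z by blast
qed

end

text \<open>\<open>G\<close> models an observed position difference, in which contributions of
  larger brackets are mixed with those of the family. They are nonnegative along the order and
  vanish when two points share a member, so equality can be demanded only for neighbours of positive
  closeness.\<close>

locale olamG = olam +
  fixes G :: "'a \<Rightarrow> 'a \<Rightarrow> real"
  assumes G_ge: "u \<in> U \<Longrightarrow> v \<in> U \<Longrightarrow> lt u v \<Longrightarrow> W - sg u v \<le> G u v"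
    and G_adj: "u \<in> U \<Longrightarrow> v \<in> U \<Longrightarrow> lt u v \<Longrightarrow> (\<And>z. z \<in> U \<Longrightarrow> lt u z \<Longrightarrow> lt z v \<Longrightarrow> False) \<Longrightarrow>
      0 < sg u v \<Longrightarrow> G u v = W - sg u v"
    and G_same: "u \<in> U \<Longrightarrow> v \<in> U \<Longrightarrow> \<not> lt u v \<Longrightarrow> \<not> lt v u \<Longrightarrow> G u v = 0"
    and G_anti: "u \<in> U \<Longrightarrow> v \<in> U \<Longrightarrow> G v u = - G u v"
begin

lemma lt_G: assumes "u \<in> U" "v \<in> U" shows "lt u v \<longleftrightarrow> 0 < G u v"
proof -
  have *: "0 < G u v" if "lt u v" "u \<in> U" "v \<in> U" for u v using G_ge[of u v] sg_less[of u v] that by linarith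
  show ?thesis
  proof
    assume g: "0 < G u v"
    show "lt u v"
    proof (rule ccontr)
      assume n: "\<not> lt u v"
      show False
      proof (cases "lt v u")
        case True then show False using *[OF True assms(2,1)] G_anti[OF assms] g by simp
      next
        case False then show False using G_same[OF assms n False] g by simp
      qed
    qed
  qed (use * assms in blast)
qed

text \<open>
  Only neighbours in the order have \<open>G = W - sg\<close>; for other pairs \<open>G\<close> may be larger, so the balls of
  the closeness are the connected components of this relation.
\<close>

definition near :: "real \<Rightarrow> ('a \<times> 'a) set" where
  "near r = {(x, y). x \<in> U \<and> y \<in> U \<and> \<bar>G x y\<bar> \<le> W - r}"

lemma near_sym: "sym (near r)"
proof (rule symI)
  fix x y assume "(x, y) \<in> near r"
  then show "(y, x) \<in> near r" unfolding near_def using G_anti[of x y] by auto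
qed

lemma near_sg: assumes "(x, y) \<in> near r" shows "r \<le> sg x y"
proof -
  have xy: "x \<in> U" "y \<in> U" "\<bar>G x y\<bar> \<le> W - r" using assms unfolding near_def by auto
  consider "lt x y" | "lt y x" | "\<not> lt x y" "\<not> lt y x" by blast
  then show ?thesis
  proof cases
    case 1 then show ?thesis using G_ge[OF xy(1,2)] xy(3) by linarith
  next
    case 2 then show ?thesis using G_ge[OF xy(2,1)] G_anti[OF xy(1,2)] xy(3) sg_sym[of x y] by linarith
  next
    case 3 then show ?thesis using gap_same(2)[OF xy(1,2)] xy(3) by linarith
  qed
qed

text \<open>Two close points are joined by a chain of neighbours along which the closeness does not
  drop (\<open>sg_between\<close>). Conversely, by the ultrametric inequality a chain of steps of
  closeness at least \<open>r\<close> has ends of closeness at least \<open>r\<close>.\<close>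

lemma sg_near: assumes "u \<in> U" "v \<in> U" "0 < r" shows "r \<le> sg u v \<longleftrightarrow> r \<le> W \<and> (u, v) \<in> (near r)\<^sup>*"
proof
  have up: "(u, v) \<in> (near r)\<^sup>*" if "lt u v" "u \<in> U" "v \<in> U" "r \<le> sg u v" for u v
    using that
  proof (induction "card {z \<in> U. lt u z \<and> lt z v}" arbitrary: u v rule: less_induct)
    case less
    show ?case
    proof (cases "\<exists>z\<in>U. lt u z \<and> lt z v")
      case False
      \<comment> \<open>Since \<open>r\<close> is positive, so is the closeness, which is the
        condition under which \<open>G_adj\<close> gives equality.\<close>
      then have "G u v = W - sg u v" using G_adj[of u v] less.prems assms(3) by force
      moreover have "0 < G u v" using lt_G less.prems by blast
      ultimately have "(u, v) \<in> near r" unfolding near_def using less.prems by simp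
      then show ?thesis by blast
    next
      case True
      then obtain z where z: "z \<in> U" "lt u z" "lt z v" by blast
      have s: "r \<le> sg u z" "r \<le> sg z v" using sg_between[OF less.prems(2,3) z] less.prems(4) by auto
      have "{y \<in> U. lt u y \<and> lt y z} \<subset> {y \<in> U. lt u y \<and> lt y v}"
        using z lt_trans[of _ z v] lt_asym[of z z] less.prems by blast
      moreover have "{y \<in> U. lt z y \<and> lt y v} \<subset> {y \<in> U. lt u y \<and> lt y v}"
        using z lt_trans[of u z] lt_asym[of z z] less.prems by blast
      ultimately have "card {y \<in> U. lt u y \<and> lt y z} < card {y \<in> U. lt u y \<and> lt y v}"
        "card {y \<in> U. lt z y \<and> lt y v} < card {y \<in> U. lt u y \<and> lt y v}"
        using finU by (auto intro!: psubset_card_mono)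
      then have "(u, z) \<in> (near r)\<^sup>*" "(z, v) \<in> (near r)\<^sup>*" using less.hyps less.prems z s by blast+
      then show ?thesis by (rule rtrancl_trans)
    qed
  qed
  assume s: "r \<le> sg u v"
  have "sg u v \<le> W"
    unfolding sg_def fl[OF assms(1)] using finX wpos by (intro sum_mono2) (auto intro: less_imp_le)
  moreover have "(u, v) \<in> (near r)\<^sup>*"
  proof -
    consider "lt u v" | "lt v u" | "\<not> lt u v" "\<not> lt v u" by blast
    then show ?thesis
    proof cases
      case 1 then show ?thesis using up assms s by blast
    next
      case 2
      then have "(v, u) \<in> (near r)\<^sup>*" using up[OF 2 assms(2,1)] s sg_sym[of u v] by simp
      then show ?thesis using sym_rtrancl[OF near_sym[of r]] by (meson symE)
    next
      case 3
      then have "G u v = 0" "r \<le> W" using G_same assms gap_same(2)[OF assms(1,2)] s by auto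
      then have "(u, v) \<in> near r" unfolding near_def using assms by simp
      then show ?thesis by blast
    qed
  qed
  ultimately show "r \<le> W \<and> (u, v) \<in> (near r)\<^sup>*" using s by linarith
next
  assume a: "r \<le> W \<and> (u, v) \<in> (near r)\<^sup>*"
  then have "(u, v) \<in> (near r)\<^sup>*" by blast
  then show "r \<le> sg u v"
  proof (induction rule: rtrancl_induct)
    case base
    have "\<not> lt u u" using lt_asym assms by blast
    then show ?case using gap_same(2)[OF assms(1,1)] a by simp
  next
    case (step y z)
    then show ?case using near_sg[of y z r] sg_ultra[of u y z] by linarith
  qed
qed

end

text \<open>\<open>G\<close> determines \<open>near\<close> and hence all balls of positive radius;
  by \<open>ball\<close> and \<open>ball_SS\<close> these are the members, together with their
  radii. Weights follow from the radii, starting with the largest members, and the order follows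
  from the sign of \<open>G\<close>.\<close>

lemma olam_recover:
  assumes O: "olamG U XX tp R w W G" and O': "olamG U XX' tp R' w' W G'"
    and GG: "\<And>u v. u \<in> U \<Longrightarrow> v \<in> U \<Longrightarrow> G u v = G' u v" and inj: "inj_on tp (XX \<union> XX')"
  shows "XX = XX'" "\<And>X. X \<in> XX \<Longrightarrow> w X = w' X"
    "\<And>X Y. X \<in> XX \<Longrightarrow> Y \<in> XX \<Longrightarrow> (X, Y) \<in> R \<longleftrightarrow> (X, Y) \<in> R'"
proof -
  interpret O: olamG U XX tp R w W G by (rule O)
  interpret P: olamG U XX' tp R' w' W G' by (rule O')
  have near: "O.near r = P.near r" for r unfolding O.near_def P.near_def using GG by auto
  have sg: "r \<le> O.sg u v \<longleftrightarrow> r \<le> P.sg u v" if "u \<in> U" "v \<in> U" "0 < r" for u v r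
    using O.sg_near[OF that] P.sg_near[OF that] near by simp
  have sub: "Y \<in> XX' \<and> O.SS Y \<le> P.SS Y" if Y: "Y \<in> XX" for Y
  proof -
    obtain u where u: "u \<in> tp Y" using O.tp_ne Y by blast
    have uU: "u \<in> U" using u O.tp_sub Y by blast
    obtain Z where Z: "Z \<in> XX'" "tp Z = {v \<in> U. O.SS Y \<le> P.sg u v}" "O.SS Y \<le> P.SS Z"
      using P.ball[OF uU O.SS_bounds[OF Y]] by blast
    have "tp Z = tp Y" unfolding Z(2) O.ball_SS[OF Y u] using sg[OF uU _ O.SS_bounds(1)[OF Y]] by blast
    then have "Z = Y" using inj Z(1) Y unfolding inj_on_def by blast
    then show ?thesis using Z by blast
  qed
  have sub': "Y \<in> XX \<and> P.SS Y \<le> O.SS Y" if Y: "Y \<in> XX'" for Y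
  proof -
    obtain u where u: "u \<in> tp Y" using P.tp_ne Y by blast
    have uU: "u \<in> U" using u P.tp_sub Y by blast
    obtain Z where Z: "Z \<in> XX" "tp Z = {v \<in> U. P.SS Y \<le> O.sg u v}" "P.SS Y \<le> O.SS Z"
      using O.ball[OF uU P.SS_bounds[OF Y]] by blast
    have "tp Z = tp Y" unfolding Z(2) P.ball_SS[OF Y u] using sg[OF uU _ P.SS_bounds(1)[OF Y]] by blast
    then have "Z = Y" using inj Z(1) Y unfolding inj_on_def by blast
    then show ?thesis using Z by blast
  qed
  show eq: "XX = XX'" using sub sub' by blast
  have SS: "O.SS Y = P.SS Y" if "Y \<in> XX" for Y using sub sub' that by (meson antisym)
  show "w X = w' X" if "X \<in> XX" for X
    using that
  proof (induction "card U - card (tp X)" arbitrary: X rule: less_induct)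
    case less
    let ?up = "{Z. Z \<in> XX \<and> tp X \<subset> tp Z}"
    have "w Z = w' Z" if Z: "Z \<in> ?up" for Z
    proof (rule less.hyps)
      have "tp Z \<subseteq> U" using O.tp_sub Z by blast
      then have "card (tp Z) \<le> card U" "card (tp X) < card (tp Z)"
        using Z O.finU by (auto intro: card_mono psubset_card_mono finite_subset)
      then show "card U - card (tp Z) < card U - card (tp X)" by linarith
      show "Z \<in> XX" using Z by blast
    qed
    then have "(\<Sum>Z\<in>?up. w Z) = (\<Sum>Z\<in>?up. w' Z)" by (intro sum.cong) auto
    moreover have "{Z. Z \<in> XX \<and> tp X \<subseteq> tp Z} = insert X ?up" using O.inj less.prems by blast
    moreover have "P.SS X = (\<Sum>Z | Z \<in> XX \<and> tp X \<subseteq> tp Z. w' Z)" unfolding P.SS_def using eq by simp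
    ultimately show ?case using SS[OF less.prems] O.finX unfolding O.SS_def by simp
  qed
  show "(X, Y) \<in> R \<longleftrightarrow> (X, Y) \<in> R'" if XY: "X \<in> XX" "Y \<in> XX" for X Y
  proof (cases "tp X \<inter> tp Y = {}")
    case False
    then show ?thesis using O.dis P.dis by blast
  next
    case True
    obtain u v where uv: "u \<in> tp X" "v \<in> tp Y" using O.tp_ne XY by blast
    have U: "u \<in> U" "v \<in> U" using uv O.tp_sub XY by auto
    have lt: "O.lt u v \<longleftrightarrow> P.lt u v" using O.lt_G[OF U] P.lt_G[OF U] GG[OF U] by simp
    have "(X, Y) \<in> R \<longleftrightarrow> O.lt u v"
      using O.tot[OF XY True] O.lt_asym[OF U] uv XY unfolding O.lt_def by blast
    moreover have "(X, Y) \<in> R' \<longleftrightarrow> P.lt u v"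
      using P.tot[OF _ _ True] P.lt_asym[OF U] uv XY eq unfolding P.lt_def by blast
    ultimately show ?thesis using lt by simp
  qed
qed

section \<open>Reconstructing a weighted bracketing from its positions\<close>

text \<open>
  The brackets above \<open>A\<close> are reconstructed after those above every \<open>Q\<close> with \<open>prior Q A\<close>. Any other
  \<open>Q\<close> of the level of \<open>A\<close> either contains \<open>A\<close> or has no influence on position differences within
  the fibre of \<open>A\<close>.
\<close>

definition prior :: "'a bracket \<Rightarrow> 'a bracket \<Rightarrow> bool" where
  "prior Q A \<longleftrightarrow> (\<exists>i<length Q. take i Q = take i A \<and> Q ! i \<subset> A ! i)"

section \<open>Contributions to position differences in one fibre\<close>

locale posw = bing T B for T :: "'a plane_tree" and B :: "'a bracketing" +
  fixes w :: "'a bracket \<Rightarrow> real"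
  assumes w_pos: "A \<in> AB \<Longrightarrow> 0 < w A"
    and w_flow: "A \<in> AB \<Longrightarrow> v \<in> fib A \<Longrightarrow> w A = (\<Sum>X | X \<in> over B A \<and> v \<in> last X. w X)"
begin

lemma fib_V: "A \<in> AB \<Longrightarrow> fib A \<subseteq> V"
  using last_V ch_in unfolding fib_def by blast

lemma olamA: assumes A: "A \<in> AB" shows "olam (fib A) (over B A) last (prec B) w (w A)"
proof
  show "finite (fib A)" using fib_V[OF A] finite_V by (rule finite_subset)
  show "finite (over B A)" by simp
  show "X \<in> over B A \<Longrightarrow> last X \<subseteq> fib A" for X by (rule over_fib[OF A])
  show "X \<in> over B A \<Longrightarrow> last X \<noteq> {}" for X using last_ne over_AB[OF A] by blast
  show "X \<in> over B A \<Longrightarrow> Y \<in> over B A \<Longrightarrow> last X \<inter> last Y \<noteq> {} \<Longrightarrow> last X \<subseteq> last Y \<or> last Y \<subseteq> last X" for X Y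
    by (rule nested_over[OF A])
  show "X \<in> over B A \<Longrightarrow> Y \<in> over B A \<Longrightarrow> last X = last Y \<Longrightarrow> X = Y" for X Y by (rule over_last_inj[OF A])
  show "v \<in> fib A \<Longrightarrow> \<exists>X\<in>over B A. v \<in> last X \<and> (\<forall>Z\<in>over B A. last Z \<inter> last X \<noteq> {} \<longrightarrow> last X \<subseteq> last Z)" for v
    using ex_min[OF A] by blast
  show "X \<in> over B A \<Longrightarrow> Y \<in> over B A \<Longrightarrow> last X \<inter> last Y = {} \<Longrightarrow> (X, Y) \<in> prec B \<or> (Y, X) \<in> prec B" for X Y
    by (rule precI[OF A])
  show "(X, Y) \<in> prec B \<Longrightarrow> last X \<inter> last Y = {}" for X Y by (rule precD(3))
  show "(X, Y) \<in> prec B \<Longrightarrow> (Y, Z) \<in> prec B \<Longrightarrow> (X, Z) \<in> prec B" for X Y Z by (rule prec_trans)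
  show "(X, Y) \<in> prec B \<Longrightarrow> (Y, X) \<notin> prec B" for X Y by (rule prec_asym)
  show "(Y, X') \<in> prec B" if "(Y, X) \<in> prec B" "X \<in> over B A" "Y \<in> over B A" "X' \<in> over B A"
    "last X \<inter> last X' \<noteq> {}" "last Y \<inter> last X' = {}" for X Y X'
    using prec_cong_right[OF that(1) _ that(5,6)] that(2,4) over_iff[OF A] by simp
  show "(X', Y) \<in> prec B" if "(X, Y) \<in> prec B" "X \<in> over B A" "Y \<in> over B A" "X' \<in> over B A"
    "last X \<inter> last X' \<noteq> {}" "last Y \<inter> last X' = {}" for X Y X'
    using prec_cong_left[OF that(1) _ that(5,6)] that(2,4) over_iff[OF A] by simp
  show "X \<in> over B A \<Longrightarrow> 0 < w X" for X using w_pos over_AB[OF A] by blast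
  show "v \<in> fib A \<Longrightarrow> w A = (\<Sum>X | X \<in> over B A \<and> v \<in> last X. w X)" for v by (rule w_flow[OF A])
qed

abbreviation "LT A \<equiv> olam.lt (over B A) last (prec B)"
abbreviation "BF A \<equiv> olam.bef (over B A) last (prec B)"
abbreviation "GP A \<equiv> olam.gap (over B A) last (prec B) w"
abbreviation "SG A \<equiv> olam.sg (over B A) last w"

text \<open>The share that the brackets directly above \<open>Q\<close> have in a position
  difference.\<close>

definition D :: "'a bracket \<Rightarrow> 'a \<Rightarrow> 'a \<Rightarrow> real" where
  "D Q u v = (\<Sum>Y\<in>over B Q. w Y * (of_bool (before B Y v) - of_bool (before B Y u)))"

text \<open>The larger \<open>Q\<close> cannot be treated before \<open>A\<close>, so their gaps
  stay together with that of \<open>A\<close>. The sum still satisfies the conditions of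
  \<open>olamG\<close>.\<close>

definition G :: "'a bracket \<Rightarrow> 'a \<Rightarrow> 'a \<Rightarrow> real" where
  "G A u v = (\<Sum>Q | Q \<in> AB \<and> A \<sqsubseteq>\<^sub>b Q. GP Q u v)"

lemma ypos_D: "ypos B w (Suc k) v - ypos B w (Suc k) u = (\<Sum>Q\<in>brk B k. D Q u v)"
proof -
  have y: "ypos B w (Suc k) x = (\<Sum>Q\<in>brk B k. \<Sum>Y\<in>over B Q. w Y * of_bool (before B Y x))" for x
  proof -
    have "ypos B w (Suc k) x = (\<Sum>Y\<in>brk B (Suc k). if before B Y x then w Y else 0)"
      unfolding ypos_def by (subst sum.inter_filter[symmetric]) simp_all
    also have "\<dots> = (\<Sum>Y\<in>brk B (Suc k). w Y * of_bool (before B Y x))"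
      by (intro sum.cong) auto
    also have "\<dots> = (\<Sum>Q\<in>brk B k. \<Sum>Y | Y \<in> brk B (Suc k) \<and> butlast Y = Q. w Y * of_bool (before B Y x))"
      using butlast_brk by (intro sum.group[symmetric]) auto
    also have "\<dots> = (\<Sum>Q\<in>brk B k. \<Sum>Y\<in>over B Q. w Y * of_bool (before B Y x))"
      using over_brk by (intro sum.cong) auto
    finally show ?thesis .
  qed
  show ?thesis unfolding y D_def by (simp add: sum_subtractf right_diff_distrib)
qed

lemma fib_anc: assumes Q: "Q \<in> brk B k" and v: "v \<in> fib Q" and j: "j \<le> k" shows "anc v j \<in> Q ! j"
proof -
  have "v \<in> lev (Suc k)" "anc v k \<in> last Q" using fib_iff'[OF Q] v by auto
  then show ?thesis using anc_in[OF Q _ j, of "anc v k"] anc_anc[of v j k] j in_lev by simp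
qed

lemma over_take: assumes Q: "Q \<in> brk B k" and Y: "Y \<in> over B Q" and i: "i \<le> Suc k" shows "take i Y = take i Q"
proof -
  have Q': "Q \<in> AB" "length Q = Suc k" using Q brk_iff by auto
  show ?thesis by (subst over_eq[OF Q'(1) Y]) (use Q' i in simp)
qed

text \<open>A bracket passes to the left of \<open>v\<close> at one definite level: up to
  \<open>j\<close> the ancestors of \<open>v\<close> lie in \<open>Y\<close>, and at
  \<open>Suc j\<close> they have left it.\<close>

lemma before_at: assumes Y: "Y \<in> brk B m" and X: "X \<in> over B (take (Suc j) Y)" "anc v (Suc j) \<in> last X"
    "(take (Suc (Suc j)) Y, X) \<in> prec B" and j: "Suc j \<le> m" and v: "v \<in> V"
  shows "anc v (Suc j) \<notin> Y ! Suc j" "i \<le> j \<Longrightarrow> anc v i \<in> Y ! i"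
proof -
  show "anc v (Suc j) \<notin> Y ! Suc j" using precD(3)[OF X(3)] X(2) last_take[OF Y j] by auto
  have t: "take (Suc j) Y \<in> brk B j" using take_brk Y j by simp
  have tAB: "take (Suc j) Y \<in> AB" using t brk_iff by blast
  have "anc v (Suc j) \<in> fib (take (Suc j) Y)" using over_fib[OF tAB X(1)] X(2) by blast
  then have h: "anc (anc v (Suc j)) i \<in> take (Suc j) Y ! i" if "i \<le> j" for i using fib_anc[OF t _ that] by blast
  show "anc v i \<in> Y ! i" if i: "i \<le> j" using h[OF i] anc_anc[OF v, of i "Suc j"] i by simp
qed

text \<open>The ancestors of \<open>v\<close> stay inside \<open>Q\<close>, so by
  \<open>before_at\<close> the separation can happen only at the last level.\<close>

lemma before_over: assumes Q: "Q \<in> brk B k" and Y: "Y \<in> over B Q" and v: "v \<in> fib Q"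
  shows "before B Y v \<longleftrightarrow> BF Q Y v"
proof -
  have QAB: "Q \<in> AB" "length Q = Suc k" using Q brk_iff by auto
  interpret O: olam "fib Q" "over B Q" last "prec B" w "w Q" by (rule olamA[OF QAB(1)])
  have Yb: "Y \<in> brk B (Suc k)" "length Y = Suc (Suc k)" using over_brk[OF Q] Y brk_iff by auto
  have vl: "v \<in> lev (Suc k)" "v \<in> V" using fib_iff'[OF Q] v in_lev by auto
  have tQ: "take (Suc k) Y = Q" using over_take[OF Q Y, of "Suc k"] QAB by simp
  have tY: "take (Suc (Suc k)) Y = Y" using Yb by simp
  show ?thesis
  proof
    assume "before B Y v"
    then obtain j X where j: "Suc j < length Y" and X: "X \<in> over B (take (Suc j) Y)"
      "anc v (Suc j) \<in> last X" "(take (Suc (Suc j)) Y, X) \<in> prec B" unfolding before_def by blast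
    have jk: "Suc j \<le> Suc k" using j Yb by simp
    have "j = k"
    proof (rule ccontr)
      assume "j \<noteq> k"
      then have "Suc j \<le> k" using jk by simp
      then have "anc v (Suc j) \<in> Q ! Suc j" using fib_anc[OF Q v] by blast
      moreover have "Y ! Suc j = Q ! Suc j" using tQ \<open>Suc j \<le> k\<close> by (metis le_imp_less_Suc nth_take)
      ultimately show False using before_at(1)[OF Yb(1) X jk vl(2)] by simp
    qed
    then show "BF Q Y v" unfolding O.bef_def using X tQ tY anc_self[OF vl(1)] by auto
  next
    assume "BF Q Y v"
    then obtain X where "X \<in> over B Q" "v \<in> last X" "(Y, X) \<in> prec B" unfolding O.bef_def by blast
    then show "before B Y v" unfolding before_def using tQ tY anc_self[OF vl(1)] Yb
      by (intro exI[of _ k] exI[of _ X]) auto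
  qed
qed

lemma fib_mono: "A \<in> AB \<Longrightarrow> A \<sqsubseteq>\<^sub>b Q \<Longrightarrow> fib A \<subseteq> fib Q"
  using sub_last AB_ne unfolding fib_def by blast

lemma D_above: assumes A: "A \<in> brk B k" and Q: "Q \<in> brk B k" and AQ: "A \<sqsubseteq>\<^sub>b Q" and uv: "u \<in> fib A" "v \<in> fib A"
  shows "D Q u v = GP Q u v"
proof -
  have QAB: "Q \<in> AB" "A \<in> AB" using A Q brk_iff by auto
  interpret O: olam "fib Q" "over B Q" last "prec B" w "w Q" by (rule olamA[OF QAB(1)])
  have u: "u \<in> fib Q" "v \<in> fib Q" using fib_mono[OF QAB(2) AQ] uv by auto
  have *: "(\<Sum>X | X \<in> over B Q \<and> BF Q X x. w X) = (\<Sum>Y\<in>over B Q. w Y * of_bool (before B Y x))"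
    if "x \<in> fib Q" for x
  proof -
    have "(\<Sum>X | X \<in> over B Q \<and> BF Q X x. w X) = (\<Sum>Y\<in>over B Q. if BF Q Y x then w Y else 0)"
      by (subst sum.inter_filter[symmetric]) simp_all
    also have "\<dots> = (\<Sum>Y\<in>over B Q. w Y * of_bool (before B Y x))"
      using before_over[OF Q _ that] by (intro sum.cong) auto
    finally show ?thesis .
  qed
  show ?thesis unfolding O.gap_def D_def *[OF u(1)] *[OF u(2)] by (simp add: sum_subtractf right_diff_distrib)
qed

lemma sub_not_prior: "length Q = length A \<Longrightarrow> A \<sqsubseteq>\<^sub>b Q \<Longrightarrow> \<not> prior Q A"
  unfolding prior_def using sub_nth[of A Q] by fastforce

lemma sub_prior: assumes "Q \<sqsubseteq>\<^sub>b A" "Q \<noteq> A" shows "prior Q A"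
proof -
  have l: "length Q = length A" using sub_length assms by blast
  then have ex: "\<exists>i. i < length Q \<and> Q ! i \<noteq> A ! i" using assms(2) nth_equalityI by blast
  define i where "i = (LEAST i. i < length Q \<and> Q ! i \<noteq> A ! i)"
  have i: "i < length Q" "Q ! i \<noteq> A ! i" using LeastI_ex[OF ex] unfolding i_def by auto
  have "Q ! j = A ! j" if "j < i" for j
    using not_less_Least[of j "\<lambda>i. i < length Q \<and> Q ! i \<noteq> A ! i"] that i(1) unfolding i_def[symmetric] by auto
  then have "take i Q = take i A" using l i by (intro nth_equalityI) auto
  moreover have "Q ! i \<subset> A ! i" using sub_nth[OF assms(1) i(1)] i(2) by blast
  ultimately show ?thesis unfolding prior_def using i by blast
qed

lemma prior_take: assumes "prior (take n Q) (take n A)" shows "prior Q A"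
proof -
  obtain i where i: "i < length (take n Q)" "take i (take n Q) = take i (take n A)" "take n Q ! i \<subset> take n A ! i"
    using assms unfolding prior_def by blast
  then have "take i Q = take i A" "i < n" "i < length Q" by (auto simp: min_def split: if_splits)
  then show ?thesis using i(3) unfolding prior_def by auto
qed

text \<open>Let \<open>Suc p\<close> be the first level at which \<open>Q\<close> and
  \<open>A\<close> are disjoint; up to \<open>p\<close> the prefix of \<open>A\<close> lies in that
  of \<open>Q\<close>, since \<open>Q\<close> is not prior. A bracket above \<open>Q\<close> can be
  separated from a point of \<open>fib A\<close> only at level \<open>Suc p\<close>. There the
  ancestors of all these points lie in one set of \<open>A\<close>, so the bracket is to the left of
  all of them or of none.\<close>

lemma D_apart: assumes A: "A \<in> brk B k" and Q: "Q \<in> brk B k" and n: "\<not> prior Q A" "\<not> A \<sqsubseteq>\<^sub>b Q"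
    and uv: "u \<in> fib A" "v \<in> fib A"
  shows "D Q u v = 0"
proof -
  have l: "length Q = Suc k" "length A = Suc k" "Q \<in> AB" "A \<in> AB" using A Q brk_iff by auto
  have nest: "take (Suc i) A \<sqsubseteq>\<^sub>b take (Suc i) Q" if i: "i \<le> k" "Q ! i \<inter> A ! i \<noteq> {}" for i
  proof -
    have t: "take (Suc i) A \<in> brk B i" "take (Suc i) Q \<in> brk B i" using take_brk A Q i by auto
    then have "take (Suc i) A \<sqsubseteq>\<^sub>b take (Suc i) Q \<or> take (Suc i) Q \<sqsubseteq>\<^sub>b take (Suc i) A"
      using nested[of "take (Suc i) A" "take (Suc i) Q"] last_take[OF A i(1)] last_take[OF Q i(1)] i(2) brk_iff l by auto
    then show ?thesis using sub_prior[of "take (Suc i) Q" "take (Suc i) A"] prior_take n(1) by (metis sub_refl)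
  qed
  have ex: "\<exists>i\<le>k. Q ! i \<inter> A ! i = {}" using nest[of k] n(2) l by auto
  define i1 where "i1 = (LEAST i. i \<le> k \<and> Q ! i \<inter> A ! i = {})"
  have i1: "i1 \<le> k" "Q ! i1 \<inter> A ! i1 = {}" using LeastI_ex[OF ex] unfolding i1_def by auto
  have before_i1: "Q ! i \<inter> A ! i \<noteq> {}" if "i < i1" for i
    using not_less_Least[of i "\<lambda>i. i \<le> k \<and> Q ! i \<inter> A ! i = {}"] that i1(1) unfolding i1_def[symmetric] by auto
  have "i1 \<noteq> 0" using i1(2) br_rt[OF br[OF A]] br_rt[OF br[OF Q]] by auto
  then obtain p where p: "i1 = Suc p" by (cases i1) auto
  have pk: "Suc p \<le> k" using i1 p by simp
  let ?Q' = "take (Suc p) Q" and ?A' = "take (Suc p) A" and ?Q = "take (Suc (Suc p)) Q" and ?A = "take (Suc (Suc p)) A"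
  have AQ': "?A' \<sqsubseteq>\<^sub>b ?Q'" using nest[of p] before_i1[of p] p pk by simp
  have Ao: "?A \<in> over B ?A'" and Qo: "?Q \<in> over B ?Q'" using take_over A Q pk by auto
  have lA: "last ?A = A ! Suc p" "last ?Q = Q ! Suc p" using last_take A Q pk by auto
  have d: "last ?Q \<inter> last ?A = {}" using i1 p lA by simp
  have tAB: "?A' \<in> AB" "?Q' \<in> AB" using take_AB l by auto
  have AB': "?A \<in> AB" "?Q \<in> AB" using take_AB l by auto
  have main: "before B Y y" if Y: "Y \<in> over B Q" and xy: "x \<in> fib A" "y \<in> fib A" and b: "before B Y x" for Y x y
  proof -
    have Yb: "Y \<in> brk B (Suc k)" "length Y = Suc (Suc k)" using over_brk[OF Q] Y brk_iff by auto
    have V: "x \<in> V" "y \<in> V" using xy fib_V[OF l(4)] by auto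
    have YQ: "take i Y = take i Q" if "i \<le> Suc k" for i using over_take[OF Q Y that] .
    have YQn: "Y ! i = Q ! i" if "i \<le> k" for i
      using YQ[of "Suc k"] that by (metis le_imp_less_Suc nth_take order_refl)
    obtain j X where j: "Suc j < length Y" and X: "X \<in> over B (take (Suc j) Y)"
      "anc x (Suc j) \<in> last X" "(take (Suc (Suc j)) Y, X) \<in> prec B" using b unfolding before_def by blast
    have jk: "Suc j \<le> Suc k" using j Yb by simp
    note at = before_at[OF Yb(1) X jk V(1)]
    have "\<not> j < p"
    proof
      assume "j < p"
      then have jp: "Suc j \<le> p" "Suc j \<le> k" using pk by auto
      have "anc x (Suc j) \<in> A ! Suc j" using fib_anc[OF A xy(1) jp(2)] .
      also have "A ! Suc j \<subseteq> Q ! Suc j" using sub_nth[OF AQ', of "Suc j"] jp l by simp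
      finally show False using at(1) YQn[OF jp(2)] by simp
    qed
    moreover have "\<not> p < j"
    proof
      assume "p < j"
      then have "anc x (Suc p) \<in> Q ! Suc p" using at(2)[of "Suc p"] YQn[OF pk] by simp
      moreover have "anc x (Suc p) \<in> A ! Suc p" using fib_anc[OF A xy(1) pk] .
      ultimately show False using i1 p by blast
    qed
    ultimately have jp: "j = p" by simp
    have X': "X \<in> over B ?Q'" "anc x (Suc p) \<in> last X" "(?Q, X) \<in> prec B" using X YQ jp pk by auto
    have XAB: "X \<in> AB" using over_AB[OF tAB(2) X'(1)] .
    have xA: "anc x (Suc p) \<in> last ?A" "anc y (Suc p) \<in> last ?A" using fib_anc[OF A _ pk] xy lA by auto
    have lX: "length X = length ?A" using over_length[OF tAB(2) X'(1)] l pk by simp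
    \<comment> \<open>If the witness \<open>X\<close> does not contain the prefix of
      \<open>A\<close>, it lies inside it. Then both have the same projection, and the prefix can
      replace \<open>X\<close>.\<close>
    have "\<exists>Z\<in>over B ?Q'. anc y (Suc p) \<in> last Z \<and> (?Q, Z) \<in> prec B"
    proof (cases "?A \<sqsubseteq>\<^sub>b X")
      case True
      then have "anc y (Suc p) \<in> last X" using sub_last[OF True AB_ne[OF AB'(1)]] xA by blast
      then show ?thesis using X' by blast
    next
      case False
      then have "X \<sqsubseteq>\<^sub>b ?A" using nested[OF XAB AB'(1) lX] X'(2) xA by blast
      then have "?Q' \<sqsubseteq>\<^sub>b ?A'"
        using sub_butlast[of X ?A] over_iff[OF tAB(2)] over_iff[OF tAB(1)] X'(1) Ao by simp
      then have e: "?A' = ?Q'" using AQ' sub_antisym by blast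
      have bX: "butlast X = ?Q'" using over_iff[OF tAB(2)] X'(1) by blast
      have "last X \<inter> last ?A \<noteq> {}" using X'(2) xA by blast
      then have "(?Q, ?A) \<in> prec B" using prec_cong_right[OF X'(3) _ _ d] Ao e bX by simp
      then show ?thesis using Ao e xA by metis
    qed
    then show ?thesis unfolding before_def using YQ pk Yb by (intro exI[of _ p]) auto
  qed
  have "before B Y u \<longleftrightarrow> before B Y v" if "Y \<in> over B Q" for Y using main[OF that] uv by blast
  then show ?thesis unfolding D_def by simp
qed

text \<open>A bracket above \<open>A\<close> that meets a bracket above a strictly larger
  \<open>Q\<close> is contained in it, as the converse inclusion would project to \<open>Q\<close>
  inside \<open>A\<close>. So points separated over \<open>Q\<close> share no bracket above
  \<open>A\<close>, and axiom 5c keeps their order.\<close>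

lemma LT_descend: assumes A: "A \<in> AB" and Q: "Q \<in> AB" and AQ: "A \<sqsubseteq>\<^sub>b Q" and uv: "u \<in> fib A" "v \<in> fib A"
    and lt: "LT Q u v"
  shows "LT A u v" "A \<noteq> Q \<Longrightarrow> SG A u v = 0"
proof -
  interpret O: olam "fib A" "over B A" last "prec B" w "w A" by (rule olamA[OF A])
  interpret P: olam "fib Q" "over B Q" last "prec B" w "w Q" by (rule olamA[OF Q])
  obtain X' Y' where XY': "X' \<in> over B Q" "Y' \<in> over B Q" "u \<in> last X'" "v \<in> last Y'" "(X', Y') \<in> prec B"
    using lt unfolding P.lt_def by blast
  have d: "last X' \<inter> last Y' = {}" using precD(3)[OF XY'(5)] .
  have le: "X \<sqsubseteq>\<^sub>b Z" if X: "X \<in> over B A" and Z: "Z \<in> over B Q" and x: "x \<in> last X" "x \<in> last Z" and ne: "A \<noteq> Q" for X Z x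
  proof -
    have "length X = length Z" using over_length[OF A X] over_length[OF Q Z] sub_length[OF AQ] by simp
    then have "X \<sqsubseteq>\<^sub>b Z \<or> Z \<sqsubseteq>\<^sub>b X" using nested[of X Z] over_AB[OF A X] over_AB[OF Q Z] x by blast
    moreover have "\<not> Z \<sqsubseteq>\<^sub>b X"
      using sub_butlast[of Z X] over_iff[OF A] over_iff[OF Q] X Z sub_antisym[OF AQ] ne by auto
    ultimately show ?thesis by blast
  qed
  have le': "last X \<subseteq> last Z" if "X \<in> over B A" "Z \<in> over B Q" "x \<in> last X" "x \<in> last Z" "A \<noteq> Q" for X Z x
    using sub_last[OF le[OF that]] AB_ne over_AB[OF A that(1)] by blast
  show "SG A u v = 0" if ne: "A \<noteq> Q"
  proof -
    have "v \<notin> last X" if X: "X \<in> over B A" "u \<in> last X" for X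
      using le'[OF X(1) XY'(1) X(2) XY'(3) ne] d XY'(4) by blast
    then have "{X. X \<in> over B A \<and> u \<in> last X \<and> v \<in> last X} = {}" by blast
    then show ?thesis unfolding O.sg_def by (simp only: sum.empty)
  qed
  show "LT A u v"
  proof (cases "A = Q")
    case True
    then show ?thesis using lt by simp
  next
    case ne: False
    let ?X = "O.mn u" and ?Y = "O.mn v"
    have m: "?X \<in> over B A" "u \<in> last ?X" "?Y \<in> over B A" "v \<in> last ?Y" using O.mn_in O.mn_mem uv by auto
    have s: "?X \<sqsubseteq>\<^sub>b X'" "?Y \<sqsubseteq>\<^sub>b Y'" using le m XY' ne by blast+
    have "butlast ?X = butlast ?Y" using over_iff[OF A] m by simp
    then have "(?X, ?Y) \<in> prec B" using prec_mono[OF XY'(5) _ _ _ s] over_AB[OF A] m by blast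
    then show ?thesis using O.lt_bef uv by blast
  qed
qed

text \<open>\<open>gap_ge\<close> and \<open>gap_adj\<close> settle the gap of \<open>A\<close>
  itself. For a strictly larger \<open>Q\<close>, \<open>LT_descend\<close> makes the gap
  nonnegative along the order over \<open>A\<close>, and zero when the two points share a bracket
  above \<open>A\<close>.\<close>

lemma olamG_A: assumes A: "A \<in> AB" shows "olamG (fib A) (over B A) last (prec B) w (w A) (G A)"
proof -
  interpret O: olam "fib A" "over B A" last "prec B" w "w A" by (rule olamA[OF A])
  let ?S = "{Q. Q \<in> AB \<and> A \<sqsubseteq>\<^sub>b Q}"
  have AS: "A \<in> ?S" "finite ?S" using A by auto
  have split: "G A u v = GP A u v + (\<Sum>Q\<in>?S - {A}. GP Q u v)" for u v
    unfolding G_def by (rule sum.remove[OF AS(2,1)])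
  have GPs: "0 \<le> GP Q u v \<and> (\<not> LT Q u v \<longrightarrow> GP Q u v = 0)"
    if Q: "Q \<in> ?S" and uv: "u \<in> fib A" "v \<in> fib A" and n: "\<not> LT A v u" for Q u v
  proof -
    have QAB: "Q \<in> AB" "A \<sqsubseteq>\<^sub>b Q" using Q by auto
    interpret P: olam "fib Q" "over B Q" last "prec B" w "w Q" by (rule olamA[OF QAB(1)])
    have f: "u \<in> fib Q" "v \<in> fib Q" using fib_mono[OF A QAB(2)] uv by auto
    have "\<not> LT Q v u" using LT_descend(1)[OF A QAB uv(2,1)] n by blast
    then show ?thesis using P.gap_ge[OF f] P.sg_less[OF f] P.gap_same(1)[OF f] by (cases "LT Q u v") auto
  qed
  show ?thesis
  proof (intro olamG.intro olamG_axioms.intro)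
    show "olam (fib A) (over B A) last (prec B) w (w A)" by (rule olamA[OF A])
    fix u v assume uv: "u \<in> fib A" "v \<in> fib A"
    show "w A - SG A u v \<le> G A u v" if lt: "LT A u v"
    proof -
      have "\<not> LT A v u" using O.lt_asym uv lt by blast
      then have "0 \<le> (\<Sum>Q\<in>?S - {A}. GP Q u v)" using GPs uv by (intro sum_nonneg) auto
      then show ?thesis using O.gap_ge[OF uv lt] split[of u v] by linarith
    qed
    show "G A u v = w A - SG A u v" if lt: "LT A u v" and adj: "\<And>z. z \<in> fib A \<Longrightarrow> LT A u z \<Longrightarrow> LT A z v \<Longrightarrow> False"
      and s: "0 < SG A u v"
    proof -
      have n: "\<not> LT A v u" using O.lt_asym uv lt by blast
      have "GP Q u v = 0" if Q: "Q \<in> ?S - {A}" for Q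
      proof -
        have "\<not> LT Q u v" using LT_descend(2)[OF A _ _ uv, of Q] Q s by force
        then show ?thesis using GPs[of Q u v] Q uv n by blast
      qed
      then have "(\<Sum>Q\<in>?S - {A}. GP Q u v) = 0" by (intro sum.neutral) blast
      then show ?thesis using O.gap_adj[OF uv lt adj] split[of u v] by simp
    qed
    show "G A u v = 0" if n: "\<not> LT A u v" "\<not> LT A v u"
    proof -
      have "\<not> LT Q u v" if "Q \<in> ?S" for Q using LT_descend(1)[OF A _ _ uv, of Q] that n by blast
      then have "GP Q u v = 0" if "Q \<in> ?S" for Q using GPs[OF that uv n(2)] that by blast
      then show ?thesis unfolding G_def by (intro sum.neutral) blast
    qed
    have "GP Q v u = - GP Q u v" if "Q \<in> ?S" for Q
    proof -
      interpret P: olam "fib Q" "over B Q" last "prec B" w "w Q" using olamA that by blast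
      show ?thesis by (rule P.gap_anti)
    qed
    then show "G A v u = - G A u v" unfolding G_def by (simp add: sum_negf[symmetric])
  qed
qed

lemma G_D: assumes A: "A \<in> brk B k" and uv: "u \<in> fib A" "v \<in> fib A"
  shows "(\<Sum>Q\<in>brk B k. D Q u v) = G A u v + (\<Sum>Q | Q \<in> brk B k \<and> prior Q A. D Q u v)"
proof -
  let ?S = "{Q. Q \<in> AB \<and> A \<sqsubseteq>\<^sub>b Q}" and ?P = "{Q. Q \<in> brk B k \<and> prior Q A}"
  have Sk: "?S \<subseteq> brk B k" using A brk_iff sub_length by fastforce
  have dj: "?S \<inter> ?P = {}"
  proof (rule equals0I)
    fix Q assume "Q \<in> ?S \<inter> ?P"
    then show False using sub_length[of A Q] sub_not_prior[of Q A] by simp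
  qed
  have "(\<Sum>Q\<in>brk B k. D Q u v) = (\<Sum>Q\<in>?S \<union> ?P. D Q u v)"
  proof (rule sum.mono_neutral_right)
    show "\<forall>Q\<in>brk B k - (?S \<union> ?P). D Q u v = 0" using D_apart[OF A _ _ _ uv] brk_iff by blast
  qed (use Sk in auto)
  also have "\<dots> = (\<Sum>Q\<in>?S. D Q u v) + (\<Sum>Q\<in>?P. D Q u v)" using dj by (intro sum.union_disjoint) auto
  also have "(\<Sum>Q\<in>?S. D Q u v) = G A u v"
    unfolding G_def using D_above[OF A _ _ uv] Sk by (intro sum.cong) auto
  finally show ?thesis .
qed

end

text \<open>At a fixed length, \<open>prior\<close> lowers the list of cardinalities
  lexicographically, so recursion along it is well-founded.\<close>

lemma prior_lex: assumes "length Q = length A" "prior Q A" "\<And>X. X \<in> set A \<Longrightarrow> finite X"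
  shows "(map card Q, map card A) \<in> lex less_than"
proof -
  obtain i where i: "i < length Q" "take i Q = take i A" "Q ! i \<subset> A ! i" using assms(2) unfolding prior_def by blast
  have "Q = take i Q @ Q ! i # drop (Suc i) Q" "A = take i A @ A ! i # drop (Suc i) A"
    using i(1) assms(1) by (auto simp: id_take_nth_drop)
  then have "map card Q = map card (take i Q) @ card (Q ! i) # map card (drop (Suc i) Q)"
    "map card A = map card (take i Q) @ card (A ! i) # map card (drop (Suc i) A)"
    using i(2) by (metis list.simps(9) map_append)+
  moreover have "card (Q ! i) < card (A ! i)" using i assms(1,3) by (intro psubset_card_mono) auto
  ultimately show ?thesis unfolding lex_conv using assms(1)
    by (auto intro!: exI[of _ "map card (take i Q)"])
qed

text \<open>As \<open>B\<close> and \<open>B'\<close> need not have a common upper bound,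
  \<open>C k\<close> compares their orders too, and the two versions of \<open>before\<close> are
  shown to agree above prior brackets. The shares of prior brackets then cancel from the position
  difference, \<open>D_apart\<close> disposes of the unrelated ones, and the remaining
  \<open>G A\<close> determines everything above \<open>A\<close> by
  \<open>olam_recover\<close>.\<close>

lemma posw_unique:
  fixes T :: "'a plane_tree"
  assumes P1: "posw T B w" and P2: "posw T B' w'"
    and root: "w (singleton_bracket T (root_of T)) = w' (singleton_bracket T (root_of T))"
    and pos: "\<And>k u v. u \<in> level T k \<Longrightarrow> v \<in> level T k \<Longrightarrow>
      rpt.ypos T B w k v - rpt.ypos T B w k u = rpt.ypos T B' w' k v - rpt.ypos T B' w' k u"
  shows "B = B'" "\<And>A. A \<in> all_brk B \<Longrightarrow> w A = w' A"
proof -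
  interpret L: posw T B w by (rule P1)
  interpret R: posw T B' w' by (rule P2)
  define C where "C k \<longleftrightarrow> brk B k = brk B' k \<and> (\<forall>A\<in>brk B k. w A = w' A) \<and>
      (\<forall>X\<in>brk B k. \<forall>Y\<in>brk B k. (X, Y) \<in> prec B \<longleftrightarrow> (X, Y) \<in> prec B')" for k
  have C: "\<forall>l\<le>k. C l" for k
  proof (induction k)
    case 0
    have b0: "brk E 0 = {L.sb L.rt}" if "bing T E" for E
    proof -
      interpret E: bing T E by (rule that)
      have "A = L.sb L.rt" if A: "A \<in> brk E 0" for A
      proof (rule nth_equalityI)
        show "length A = length (L.sb L.rt)" using A E.brk_iff by simp
        show "A ! i = L.sb L.rt ! i" if "i < length A" for i
          using that L.br_rt[OF E.br[OF A]] A E.brk_iff L.sb_nth[of 0 L.rt] by simp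
      qed
      moreover have "L.sb L.rt \<in> brk E 0" using E.sb_brk L.lev_0 by blast
      ultimately show ?thesis by blast
    qed
    have b: "brk B 0 = {L.sb L.rt}" "brk B' 0 = {L.sb L.rt}" using b0 L.bing_axioms R.bing_axioms by auto
    have "C 0" unfolding C_def b using root L.prec_neq R.prec_neq by blast
    then show ?case by simp
  next
    case (Suc k)
    have ov: "over B A = over B' A" if "A \<in> brk B j" "Suc j \<le> k" for A j
    proof -
      have "C j" "C (Suc j)" using Suc that by auto
      then have e: "brk B j = brk B' j" "brk B (Suc j) = brk B' (Suc j)" unfolding C_def by auto
      then show ?thesis using L.over_brk[OF that(1)] R.over_brk[of A j] that by auto
    qed
    have Ck: "brk B k = brk B' k" "\<And>A. A \<in> brk B k \<Longrightarrow> w A = w' A" using Suc unfolding C_def by auto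
    define P where "P A \<longleftrightarrow> over B A = over B' A \<and> (\<forall>X\<in>over B A. w X = w' X) \<and>
      (\<forall>X\<in>over B A. \<forall>Y\<in>over B A. (X, Y) \<in> prec B \<longleftrightarrow> (X, Y) \<in> prec B')" for A
    have P: "P A" if "A \<in> brk B k" for A
      using that
    proof (induction A rule: wf_induct[OF wf_inv_image[OF wf_lex[OF wf_less_than]], of "map card", consumes 0, case_names less])
      case (less A)
      have A: "A \<in> brk B k" "A \<in> brk B' k" "A \<in> L.AB" "A \<in> R.AB" "length A = Suc k"
        using less.prems Ck(1) L.brk_iff R.brk_iff by auto
      have fin: "finite X" if mem: "X \<in> set A" for X
      proof -
        obtain i where "i < length A" "X = A ! i" using mem unfolding in_set_conv_nth by blast
        then have "X \<subseteq> L.lev i" using L.br_lev[OF L.br[OF A(1)], of i] A(5) by simp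
        then show ?thesis by (rule finite_subset) simp
      qed
      have PQ: "P Q" if Q: "Q \<in> brk B k" "prior Q A" for Q
      proof -
        have "length Q = length A" using Q A L.brk_iff by simp
        then have "(map card Q, map card A) \<in> lex less_than" using prior_lex Q(2) fin by blast
        then show ?thesis using less.IH Q(1) by (simp add: inv_image_def)
      qed
      have DQ: "L.D Q u v = R.D Q u v" if Q: "Q \<in> brk B k" "prior Q A" for Q u v
      proof -
        have pq: "over B Q = over B' Q" "\<And>X. X \<in> over B Q \<Longrightarrow> w X = w' X"
          "\<And>X Y. X \<in> over B Q \<Longrightarrow> Y \<in> over B Q \<Longrightarrow> (X, Y) \<in> prec B \<longleftrightarrow> (X, Y) \<in> prec B'"
          using PQ[OF Q] unfolding P_def by auto
        have "L.before B Y x \<longleftrightarrow> L.before B' Y x" if Y: "Y \<in> over B Q" for Y x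
          unfolding L.before_def
        proof (intro ex_cong1 conj_cong refl)
          have Yb: "Y \<in> brk B (Suc k)" "Y \<in> brk B' (Suc k)" "length Y = Suc (Suc k)"
            using L.over_brk[OF Q(1)] R.over_brk[of Q k] Q Ck Y pq(1) L.brk_iff by auto
          fix j X assume j: "Suc j < length Y"
          have tQ: "take (Suc j) Y = take (Suc j) Q" using L.over_take[OF Q(1) Y] j Yb by simp
          have lQ: "length Q = Suc k" using Q L.brk_iff by blast
          have tj: "take (Suc j) Y \<in> brk B j" using L.take_brk[OF Yb(1)] j Yb by simp
          have eo: "over B (take (Suc j) Y) = over B' (take (Suc j) Y)"
          proof (cases "j = k")
            case True then show ?thesis using tQ lQ pq by simp
          next
            case False then show ?thesis using ov[OF tj] j Yb by simp
          qed
          show "X \<in> over B (take (Suc j) Y) \<longleftrightarrow> X \<in> over B' (take (Suc j) Y)" using eo by simp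
          assume X: "X \<in> over B' (take (Suc j) Y)"
          show "(take (Suc (Suc j)) Y, X) \<in> prec B \<longleftrightarrow> (take (Suc (Suc j)) Y, X) \<in> prec B'"
          proof (cases "j = k")
            case True
            then have "take (Suc (Suc j)) Y = Y" "X \<in> over B Q" using X tQ lQ eo Yb by auto
            then show ?thesis using pq(3)[OF Y] by simp
          next
            case False
            then have jk: "Suc j \<le> k" using j Yb by simp
            have "X \<in> brk B (Suc j)" using X eo L.over_brk[OF tj] by blast
            moreover have "take (Suc (Suc j)) Y \<in> brk B (Suc j)" using L.take_brk[OF Yb(1)] jk by simp
            moreover have "C (Suc j)" using Suc jk by blast
            ultimately show ?thesis unfolding C_def by blast
          qed
        qed
        then show ?thesis unfolding L.D_def R.D_def using pq by (intro sum.cong) auto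
      qed
      have GG: "L.G A u v = R.G A u v" if uv: "u \<in> L.fib A" "v \<in> L.fib A" for u v
      proof -
        have "u \<in> L.lev (Suc k)" "v \<in> L.lev (Suc k)" using L.fib_iff'[OF A(1)] uv by auto
        then have "(\<Sum>Q\<in>brk B k. L.D Q u v) = (\<Sum>Q\<in>brk B' k. R.D Q u v)"
          using pos L.ypos_D[of k v u] R.ypos_D[of k v u] by simp
        moreover have "(\<Sum>Q | Q \<in> brk B k \<and> prior Q A. L.D Q u v) = (\<Sum>Q | Q \<in> brk B' k \<and> prior Q A. R.D Q u v)"
          using DQ Ck by (intro sum.cong) auto
        ultimately show ?thesis using L.G_D[OF A(1) uv] R.G_D[OF A(2) uv] by simp
      qed
      have wA: "w A = w' A" using Ck A by blast
      have inj: "inj_on last (over B A \<union> over B' A)"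
      proof (rule inj_onI)
        fix X Y assume "X \<in> over B A \<union> over B' A" "Y \<in> over B A \<union> over B' A" and e: "last X = last Y"
        then have "X = A @ [last X]" "Y = A @ [last Y]" using L.over_eq R.over_eq A by blast+
        then show "X = Y" using e by simp
      qed
      have O: "olamG (L.fib A) (over B A) last (prec B) w (w A) (L.G A)" by (rule L.olamG_A[OF A(3)])
      have O': "olamG (L.fib A) (over B' A) last (prec B') w' (w A) (R.G A)"
        using R.olamG_A[OF A(4)] wA by simp
      show ?case unfolding P_def using olam_recover[OF O O' GG inj] by blast
    qed
    have "brk B (Suc k) = brk B' (Suc k)"
    proof -
      have "X \<in> brk B (Suc k) \<longleftrightarrow> X \<in> brk B' (Suc k)" for X
        using P[of "butlast X"] L.over_brk[of "butlast X" k X] R.over_brk[of "butlast X" k X]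
          L.butlast_brk[of X k] R.butlast_brk[of X k] Ck(1) unfolding P_def by auto
      then show ?thesis by blast
    qed
    moreover have "\<forall>X\<in>brk B (Suc k). w X = w' X"
      using P L.over_brk L.butlast_brk unfolding P_def by blast
    moreover have "(X, Y) \<in> prec B \<longleftrightarrow> (X, Y) \<in> prec B'" if XY: "X \<in> brk B (Suc k)" "Y \<in> brk B (Suc k)" for X Y
    proof (cases "butlast X = butlast Y")
      case True
      have b: "butlast X \<in> brk B k" using L.butlast_brk XY by blast
      then have "X \<in> over B (butlast X)" "Y \<in> over B (butlast X)" using L.over_brk[OF b] XY True by auto
      then show ?thesis using P[OF b] unfolding P_def by blast
    next
      case False
      then show ?thesis using L.precD(2) R.precD(2) by blast
    qed
    ultimately have "C (Suc k)" unfolding C_def by blast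
    then show ?case using Suc le_Suc_eq by auto
  qed
  have bk: "brk B k = brk B' k" for k using C[of k] unfolding C_def by blast
  then have ab: "L.AB = R.AB" unfolding all_brk_def by simp
  show "B = B'"
  proof (rule bracketing.equality)
    show "brk B = brk B'" using bk by blast
    have "(X, Y) \<in> prec B \<longleftrightarrow> (X, Y) \<in> prec B'" for X Y
    proof (cases "X \<in> L.AB \<and> Y \<in> L.AB \<and> length X = length Y")
      case True
      then obtain k where "X \<in> brk B k" "length X = Suc k" using L.ABE by metis
      moreover from this have "Y \<in> brk B k" using True L.brk_iff by simp
      ultimately show ?thesis using C[of k] unfolding C_def by blast
    next
      case False
      then show ?thesis using L.prec_AB R.prec_AB L.precD(1) R.precD(1) ab by blast
    qed
    then show "prec B = prec B'" by auto
  qed simp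
  show "w A = w' A" if A: "A \<in> all_brk B" for A
  proof -
    obtain k where "A \<in> brk B k" using A by (metis L.ABE)
    then show ?thesis using C[of k] unfolding C_def by blast
  qed
qed

section \<open>The isomorphism\<close>

lemma snd_met_sum: "snd (met_sum T g k) A = (\<Sum>i\<le>k. snd (g i) A)"
  by (induction k) (simp_all add: met_add_def)

lemma snd_met_scale: "snd (met_scale T t M) A = t * snd M A"
  unfolding met_scale_def by simp

text \<open>\<open>decompose\<close> may list a collision several times, while \<open>tau\<close>
  has one coefficient for each.\<close>

lemma sum_list_group:
  assumes "finite S" "snd ` set L \<subseteq> S"
  shows "(\<Sum>(l, C)\<leftarrow>L. l * (g C :: real)) = (\<Sum>C\<in>S. (\<Sum>p\<leftarrow>filter (\<lambda>p. snd p = C) L. fst p) * g C)"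
  using assms(2)
proof (induction L)
  case (Cons p L)
  obtain l C where p: "p = (l, C)" by (cases p)
  have C: "C \<in> S" using Cons.prems p by simp
  have "(\<Sum>D\<in>S. (\<Sum>q\<leftarrow>filter (\<lambda>q. snd q = D) (p # L). fst q) * g D) =
      (\<Sum>D\<in>S. (if D = C then l * g D else 0) + (\<Sum>q\<leftarrow>filter (\<lambda>q. snd q = D) L. fst q) * g D)"
    using p by (intro sum.cong) (auto simp: distrib_right)
  also have "\<dots> = l * g C + (\<Sum>D\<in>S. (\<Sum>q\<leftarrow>filter (\<lambda>q. snd q = D) L. fst q) * g D)"
    using C assms(1) by (simp add: sum.distrib)
  finally show ?case using Cons p by simp
qed simp

section \<open>Images of the cones, and decompositions\<close>

context bing
begin

definition low_colls :: "'a bracketing set" where "low_colls = {C. C \<in> collisions T \<and> C \<preceq>\<^sub>K B}"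

lemma finite_colls: "finite low_colls"
proof (rule finite_subset)
  show "low_colls \<subseteq> restr B ` Pow AB"
  proof
    fix C assume "C \<in> low_colls"
    then have C: "is_bracketing T C" "C \<preceq>\<^sub>K B" unfolding low_colls_def collisions_def bracketings_def by auto
    then show "C \<in> restr B ` Pow AB" using le_restr[OF C] le_all_brk[OF C(2)] by blast
  qed
qed simp

lemma ind_mxs_nontrivial: "nontrivial T A \<Longrightarrow> ind mxs A = 0"
  unfolding ind_def mxs_def nontrivial_def by auto

lemma cone_shift: assumes f: "f \<in> cone B" shows "(\<lambda>A. f A + c * ind mxs A) \<in> cone B"
proof -
  have "flow B (\<lambda>A. 1 * f A + c * ind mxs A)" using flow_comb coneD(1) f mxs_cone by blast
  then show ?thesis using coneD(2)[OF f] ind_mxs_nontrivial unfolding cone_def by simp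
qed

lemma cone_sum: assumes "finite I" "\<And>i. i \<in> I \<Longrightarrow> h i \<in> cone B" shows "(\<lambda>A. \<Sum>i\<in>I. h i A) \<in> cone B"
  using assms
proof (induction I rule: finite_induct)
  case empty
  then show ?case using cone_zero by simp
next
  case (insert x F)
  then show ?case using cone_add[of "h x" B "\<lambda>A. \<Sum>i\<in>F. h i A"] by simp
qed

lemma Gam_mxs: "Gam B (ind mxs) = ones T"
  using rho_min unfolding rho_def by simp

lemma Gam_supp: assumes f: "f \<in> cone B" shows "Gam (supp B f) f = Gam B f"
proof (rule Gam_sub[OF supp_bracketing[OF f] supp_le])
  interpret S: bing T "supp B f" by unfold_locales (rule supp_bracketing[OF f])
  show "f A = 0" if "A \<notin> all_brk (supp B f)" for A
    using S.metric_iff supp_metric[OF f] that unfolding flow_def by blast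
qed

text \<open>Both sides are generated by the collisions below \<open>B\<close> and one line: the left
  side by \<open>decompose\<close>, the right side by definition. \<open>collision_below\<close> and
  \<open>Gam_mxs\<close> match the generators.\<close>

lemma Gam_cone: "Gam B ` cone B = tau T B"
proof (intro equalityI subsetI)
  fix x assume "x \<in> Gam B ` cone B"
  then obtain f where f: "f \<in> cone B" "x = Gam B f" by blast
  obtain c L where L: "\<forall>(l, C)\<in>set L. 0 \<le> l \<and> C \<in> collisions T \<and> C \<preceq>\<^sub>K supp B f"
    "f = (\<lambda>A. c * ind mxs A + (\<Sum>(l, C)\<leftarrow>L. l * snd (ell T C) A))" using decompose[OF f(1)] by blast
  have sub: "snd ` set L \<subseteq> low_colls" using L(1) le_trans[OF _ supp_le] unfolding low_colls_def by fastforce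
  define lam where "lam C = (\<Sum>p\<leftarrow>filter (\<lambda>p. snd p = C) L. fst p)" for C
  have lam: "0 \<le> lam C" for C unfolding lam_def using L(1) by (intro sum_list_nonneg) auto
  have e: "f = (\<lambda>A. c * ind mxs A + (\<Sum>C\<in>low_colls. lam C * snd (ell T C) A))"
    unfolding lam_def sum_list_group[OF finite_colls sub, symmetric] by (rule L(2))
  have "Gam B f k i = c * ones T k i + (\<Sum>C\<in>low_colls. lam C * Gam B (snd (ell T C)) k i)" for k i
    by (subst e) (simp add: Gam_add Gam_scale Gam_sum[OF finite_colls] Gam_mxs)
  then have "x = (\<lambda>k i. c * ones T k i + (\<Sum>C\<in>low_colls. lam C * Gam B (snd (ell T C)) k i))"
    unfolding f(2) by (intro ext)
  also have "\<dots> = (\<lambda>k i. (\<Sum>C | C \<in> collisions T \<and> C \<preceq>\<^sub>K B. lam C * rho T C k i) + c * ones T k i)"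
    using collision_below(2) unfolding low_colls_def by (intro ext) (auto intro!: sum.cong)
  finally show "x \<in> tau T B" unfolding tau_def using lam by blast
next
  fix x assume "x \<in> tau T B"
  then obtain lam c where x: "x = (\<lambda>k i. (\<Sum>C | C \<in> collisions T \<and> C \<preceq>\<^sub>K B. lam C * rho T C k i) + c * ones T k i)"
    and lam: "\<And>C. C \<in> collisions T \<and> C \<preceq>\<^sub>K B \<Longrightarrow> 0 \<le> lam C" unfolding tau_def by blast
  define f where "f = (\<lambda>A. (\<Sum>C\<in>low_colls. lam C * snd (ell T C) A) + c * ind mxs A)"
  have "f \<in> cone B" unfolding f_def
    using collision_below(1) lam by (intro cone_shift cone_sum finite_colls cone_scale) (auto simp: low_colls_def)
  moreover have "Gam B f = x"
  proof (intro ext)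
    fix k i
    have "Gam B f k i = (\<Sum>C\<in>low_colls. lam C * Gam B (snd (ell T C)) k i) + c * ones T k i"
      unfolding f_def by (simp add: Gam_add Gam_scale Gam_sum[OF finite_colls] Gam_mxs)
    also have "(\<Sum>C\<in>low_colls. lam C * Gam B (snd (ell T C)) k i) = (\<Sum>C\<in>low_colls. lam C * rho T C k i)"
      using collision_below(2) by (intro sum.cong) (auto simp: low_colls_def)
    finally show "Gam B f k i = x k i" unfolding x low_colls_def .
  qed
  ultimately show "x \<in> Gam B ` cone B" by blast
qed

lemma met_sum_supp: assumes "\<And>i. i \<le> k \<Longrightarrow> h i \<in> cone B \<and> g i = (supp B (h i), h i)"
  shows "met_sum T g k = (supp B (\<lambda>A. \<Sum>i\<le>k. h i A), \<lambda>A. \<Sum>i\<le>k. h i A)"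
  using assms
proof (induction k)
  case (Suc k)
  have "(\<lambda>A. \<Sum>i\<le>k. h i A) \<in> cone B" using Suc.prems by (intro cone_sum) auto
  then show ?case using Suc by (simp add: met_add_supp)
qed simp

lemma ex_decomposition: assumes f: "f \<in> cone B"
  shows "\<exists>k lam C. is_decomposition T (supp B f, f) k lam C"
proof -
  obtain c L where L: "\<forall>(l, C)\<in>set L. 0 \<le> l \<and> C \<in> collisions T \<and> C \<preceq>\<^sub>K supp B f"
    "f = (\<lambda>A. c * ind mxs A + (\<Sum>(l, C)\<leftarrow>L. l * snd (ell T C) A))" using decompose[OF f] by blast
  let ?k = "length L"
  \<comment> \<open>Index 0 is reserved for the multiple of the minimum bracketing, so entry
    \<open>i - 1\<close> of \<open>L\<close> moves to index \<open>i\<close>.\<close>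
  define lam where "lam i = (if i = 0 then c else fst (L ! (i - 1)))" for i
  define C where "C i = (if i = 0 then min_bracketing T else snd (L ! (i - 1)))" for i
  define h where "h i = (\<lambda>A. lam i * snd (ell T (C i)) A)" for i
  have LC: "0 \<le> lam i \<and> C i \<in> collisions T \<and> C i \<preceq>\<^sub>K supp B f" if "i \<in> {1..?k}" for i
  proof -
    have "L ! (i - 1) \<in> set L" using that by (intro nth_mem) auto
    then show ?thesis using L(1) that unfolding lam_def C_def by (auto simp: case_prod_beta)
  qed
  have h: "h i \<in> cone B \<and> met_scale T (lam i) (ell T (C i)) = (supp B (h i), h i)" if i: "i \<le> ?k" for i
  proof (cases "i = 0")
    case True
    have h0: "h i = (\<lambda>A. c * ind mxs A)" unfolding h_def lam_def C_def using True snd_ell_min by simp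
    then have "h i \<in> cone B" using cone_shift[OF cone_zero, of c] by simp
    \<comment> \<open>\<open>c\<close> may have either sign, but maxima are trivial, so the support
      is the minimum bracketing in every case.\<close>
    moreover have "triv T \<union> {A. 0 < c * ind mxs A} = triv T" unfolding triv_def ind_def mxs_def by auto
    then have "supp B (h i) = min_bracketing T" unfolding supp_def h0 min_eq by simp
    moreover have "fst (ell T (min_bracketing T)) = min_bracketing T" unfolding ell_def by simp
    ultimately show ?thesis using True h0 snd_ell_min unfolding met_scale_def lam_def C_def by auto
  next
    case False
    then have C: "0 \<le> lam i" "C i \<in> collisions T" "C i \<preceq>\<^sub>K B" using LC[of i] i le_trans[OF _ supp_le] by auto
    note cb = collision_below[OF C(2,3)]
    have "ell T (C i) = (supp B (snd (ell T (C i))), snd (ell T (C i)))" using cb(4,5) by (metis prod.collapse)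
    then show ?thesis using met_scale_supp[OF C(1)] cone_scale[OF cb(1) C(1)] unfolding h_def by metis
  qed
  have "f = (\<lambda>A. \<Sum>i\<le>?k. h i A)"
  proof
    fix A
    have "(\<Sum>i\<le>?k. h i A) = h 0 A + (\<Sum>i<?k. h (Suc i) A)" by (rule sum.atMost_shift)
    also have "(\<Sum>i<?k. h (Suc i) A) = (\<Sum>(l, C)\<leftarrow>L. l * snd (ell T C) A)"
      unfolding sum_list_sum_nth h_def lam_def C_def by (simp add: case_prod_beta atLeast0LessThan)
    also have "h 0 A = c * ind mxs A" unfolding h_def lam_def C_def using snd_ell_min by simp
    finally show "f A = (\<Sum>i\<le>?k. h i A)" using L(2) by metis
  qed
  then have "(supp B f, f) = met_sum T (\<lambda>i. met_scale T (lam i) (ell T (C i))) ?k"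
    using met_sum_supp[of ?k h "\<lambda>i. met_scale T (lam i) (ell T (C i))"] h by simp
  note e = this
  have "is_decomposition T (supp B f, f) ?k lam C"
  proof -
    have "C 0 = min_bracketing T" unfolding C_def by simp
    moreover have "\<forall>i\<in>{1..?k}. C i \<in> collisions T \<and> C i \<preceq>\<^sub>K fst (supp B f, f) \<and> 0 \<le> lam i" using LC by simp
    ultimately show ?thesis using e unfolding is_decomposition_def by blast
  qed
  then show ?thesis by blast
qed

text \<open>A decomposition writes \<open>f\<close> pointwise as a linear combination, and
  \<open>Gam B\<close> is linear. Hence all decompositions give the same vector, which is the
  well-definedness of the map.\<close>

lemma decomposition_Gam: assumes d: "is_decomposition T (B, f) k lam C"
  shows "Gam B f = (\<lambda>j i. \<Sum>r\<le>k. lam r * rho T (C r) j i)"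
proof -
  have e: "(B, f) = met_sum T (\<lambda>i. met_scale T (lam i) (ell T (C i))) k"
    using d unfolding is_decomposition_def by blast
  have f: "f = (\<lambda>A. \<Sum>r\<le>k. lam r * snd (ell T (C r)) A)"
    using arg_cong[OF e, of snd] by (simp add: snd_met_sum snd_met_scale fun_eq_iff)
  have "Gam B (snd (ell T (C r))) = rho T (C r)" if "r \<le> k" for r
  proof (cases "r = 0")
    case True
    then show ?thesis using d rho_min snd_ell_min unfolding is_decomposition_def by simp
  next
    case False
    then show ?thesis using d that collision_below(2)[of "C r"] unfolding is_decomposition_def by simp
  qed
  moreover have "Gam B f j i = (\<Sum>r\<le>k. lam r * Gam B (snd (ell T (C r))) j i)" for j i
    by (subst f) (simp add: Gam_sum)
  ultimately show ?thesis by (intro ext) simp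
qed

end

section \<open>Injectivity and the inverse map\<close>

context rpt
begin

text \<open>Only the bracketing of \<open>M\<close> itself enters; by \<open>Gam_supp\<close> any
  cone containing \<open>M\<close> yields the same value, so the map is consistent on
  overlaps.\<close>

definition Gamma :: "'a metric_bracketing \<Rightarrow> vec" where
  "Gamma M = Gam (fst M) (snd M)"

text \<open>
  Adding a large multiple of \<open>\<ell>(\<B>\<^sub>m\<^sub>i\<^sub>n)\<close>, and then choosing the constant in \<^const>\<open>wt\<close> large, makes all
  weights positive, including those of the maximum and the singleton brackets.
\<close>

lemma Gamma_inj: assumes M: "is_metric T M" "is_metric T M'" and eq: "Gamma M = Gamma M'"
  shows "M = M'"
proof -
  obtain B f B' f' where MM: "M = (B, f)" "M' = (B', f')" by (metis prod.collapse)
  have Bs: "is_bracketing T B" "is_bracketing T B'" using M MM unfolding is_metric_def bracketings_def by auto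
  interpret L: bing T B by unfold_locales (rule Bs)
  interpret R: bing T B' by unfold_locales (rule Bs)
  have m: "flow B f" "\<forall>A\<in>all_brk B. nontrivial T A \<longrightarrow> 0 < f A"
    "flow B' f'" "\<forall>A\<in>all_brk B'. nontrivial T A \<longrightarrow> 0 < f' A"
    using M MM L.metric_iff R.metric_iff by auto
  \<comment> \<open>The constants are chosen for both bracketings at once: the two weightings must
    be shifted by the same amounts to remain comparable.\<close>
  define c where "c = 1 + (\<Sum>A\<in>all_brk B. \<bar>f A\<bar>) + (\<Sum>A\<in>all_brk B'. \<bar>f' A\<bar>)"
  define F where "F = (\<lambda>A. f A + c * ind mxs A)"
  define F' where "F' = (\<lambda>A. f' A + c * ind mxs A)"
  define d where "d = 1 + (\<Sum>A\<in>all_brk B. \<bar>F A\<bar>) + (\<Sum>A\<in>all_brk B'. \<bar>F' A\<bar>)"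
  have core: "posw T E (wt E d H)"
    if E: "bing T E" and g: "flow E g" "\<forall>A\<in>all_brk E. nontrivial T A \<longrightarrow> 0 < g A"
      and H: "H = (\<lambda>A. g A + c * ind mxs A)" and c: "(\<Sum>A\<in>all_brk E. \<bar>g A\<bar>) < c"
      and d: "(\<Sum>A\<in>all_brk E. \<bar>H A\<bar>) < d" for E g H
  proof -
    interpret E: bing T E by (rule E)
    have fH: "flow E H" using flow_comb[OF g(1) coneD(1)[OF E.mxs_cone], of 1 c] unfolding H by simp
    show ?thesis
    proof
      fix A assume A: "A \<in> E.AB"
      show "0 < wt E d H A"
      proof (cases "sing A")
        case True
        obtain k where k: "A \<in> brk E k" using A E.ABE by metis
        obtain z where z: "z \<in> lev k" "A = sb z" using singE[OF True E.br[OF k]] .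
        have "(\<Sum>Y\<in>nsg E k z. H Y) \<le> (\<Sum>Y\<in>nsg E k z. \<bar>H Y\<bar>)" by (intro sum_mono) simp
        also have "\<dots> \<le> (\<Sum>A\<in>all_brk E. \<bar>H A\<bar>)"
          using E.brk_iff unfolding nsg_def by (intro sum_mono2) auto
        finally show ?thesis using wt_sb[OF z(1)] z d by simp
      next
        case False
        have "0 < H A"
        proof (cases "ismx A")
          case True
          have "\<bar>g A\<bar> \<le> (\<Sum>A\<in>all_brk E. \<bar>g A\<bar>)" using A by (intro member_le_sum) auto
          then show ?thesis using c True False unfolding H ind_def mxs_def by simp
        next
          case nm: False
          then show ?thesis using g(2) A False unfolding H ind_def mxs_def nontrivial_def by simp
        qed
        then show ?thesis using wt_nonsing[OF False] by simp
      qed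
    next
      fix A v assume "A \<in> E.AB" "v \<in> fib A"
      then show "wt E d H A = (\<Sum>X | X \<in> over E A \<and> v \<in> last X. wt E d H X)" by (rule E.wt_flow[OF fH])
    qed
  qed
  have nn: "0 \<le> (\<Sum>A\<in>X. \<bar>h A\<bar>)" for X and h :: "'a bracket \<Rightarrow> real" by (intro sum_nonneg) simp
  have P: "posw T B (wt B d F)" "posw T B' (wt B' d F')"
    using core[OF L.bing_axioms m(1,2) F_def] core[OF R.bing_axioms m(3,4) F'_def] nn[of f] nn[of f']
      nn[of F] nn[of F'] unfolding c_def d_def by (auto simp: add.commute add_strict_increasing)
  \<comment> \<open>Level 0 has no nonsingleton bracket, so the root has weight \<open>d\<close> on
    both sides, which starts the comparison by levels.\<close>
  have root: "wt E d H (sb rt) = d" if "bing T E" for E H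
  proof -
    interpret E: bing T E by (rule that)
    have "sing Y" if Y: "Y \<in> brk E 0" for Y
    proof -
      have "Y = sb rt" using Y E.brk_iff br_rt[OF E.br[OF Y]] sb_nth[of 0 rt] by (intro nth_equalityI) auto
      then show ?thesis using sing_sb rt_in by blast
    qed
    then have "nsg E 0 rt = {}" unfolding nsg_def by blast
    then show ?thesis using wt_sb[of rt 0 E d H] lev_0 by simp
  qed
  have GF: "Gam B F = Gam B' F'"
    using eq MM L.Gam_mxs R.Gam_mxs unfolding F_def F'_def Gamma_def
    by (simp add: Gam_add Gam_scale fun_eq_iff)
  have pos: "ypos B (wt B d F) k v - ypos B (wt B d F) k u = ypos B' (wt B' d F') k v - ypos B' (wt B' d F') k u"
    if uv: "u \<in> lev k" "v \<in> lev k" for k u v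
  proof -
    \<comment> \<open>\<open>Gam\<close> records only differences of neighbours in a level; that
      \<open>h\<close> is constant along the level extends the equality to all pairs.\<close>
    define h where "h x = ypos B (wt B d F) k x - ypos B' (wt B' d F') k x" for x
    have h1: "h (nth_vertex T k i) = h (nth_vertex T k 1)" if "1 \<le> i" "i \<le> card (lev k)" for i
      using that
    proof (induction i rule: dec_induct)
      case (step i)
      have "k \<noteq> 0"
      proof
        assume "k = 0"
        then have "card (lev k) = 1" using lev_0 by simp
        then show False using step by simp
      qed
      then have ki: "(k, i) \<in> coords T" using step lev_le[OF uv(1)] unfolding coords_def by auto
      have "h (nth_vertex T k (i + 1)) = h (nth_vertex T k i)"
        using L.Gam_shift[OF ki, of F d] R.Gam_shift[OF ki, of F' d] GF unfolding h_def by simp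
      then show ?case using step by simp
    qed simp
    have "h x = h (nth_vertex T k 1)" if "x \<in> lev k" for x using h1[of "pos T x"] nth_vertex_pos[OF that] by simp
    then have "h u = h v" using uv by simp
    then show ?thesis unfolding h_def by simp
  qed
  have BB: "B = B'" and ww: "\<And>A. A \<in> all_brk B \<Longrightarrow> wt B d F A = wt B' d F' A"
    using posw_unique[OF P] root[OF L.bing_axioms] root[OF R.bing_axioms] pos by auto
  have "f A = f' A" for A
  proof (cases "A \<in> all_brk B \<and> \<not> sing A")
    case True
    then show ?thesis using ww[of A] wt_nonsing unfolding F_def F'_def by simp
  next
    case False
    then show ?thesis using m(1,3) BB unfolding flow_def by auto
  qed
  then show ?thesis using MM BB by auto
qed

lemma metric_complexE: assumes "M \<in> \<Union>(metric_complex T)"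
  obtains B f where "bing T B" "M = (supp B f, f)" "f \<in> cone B"
proof -
  obtain B where hB: "is_bracketing T B" "M \<in> tau_met T B"
    using assms unfolding metric_complex_def bracketings_def by blast
  interpret bing T B by unfold_locales (rule hB)
  show thesis using that bing_axioms hB(2) unfolding tau_met_eq by blast
qed

lemma Gamma_supp: "bing T B \<Longrightarrow> f \<in> cone B \<Longrightarrow> Gamma (supp B f, f) = Gam B f"
  unfolding Gamma_def using bing.Gam_supp by simp

lemma Gamma_tau_met: assumes "bing T B" shows "Gamma ` tau_met T B = tau T B"
  unfolding bing.tau_met_eq[OF assms] bing.Gam_cone[OF assms, symmetric] image_image
  using Gamma_supp[OF assms] by (intro image_cong) auto

lemma tau_met_closed: assumes "bing T B" "M \<in> tau_met T B" "N \<in> tau_met T B"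
  shows "met_add T M N \<in> tau_met T B" "Gamma (met_add T M N) = (\<lambda>k i. Gamma M k i + Gamma N k i)"
    "0 \<le> t \<Longrightarrow> met_scale T t M \<in> tau_met T B" "0 \<le> t \<Longrightarrow> Gamma (met_scale T t M) = (\<lambda>k i. t * Gamma M k i)"
proof -
  interpret bing T B by (rule assms(1))
  obtain f g where fg: "f \<in> cone B" "g \<in> cone B" "M = (supp B f, f)" "N = (supp B g, g)"
    using assms(2,3) unfolding tau_met_eq by blast
  note G = Gamma_supp[OF assms(1)]
  show "met_add T M N \<in> tau_met T B" unfolding fg(3,4) met_add_supp[OF fg(1,2)] tau_met_eq
    using cone_add[OF fg(1,2)] by blast
  show "Gamma (met_add T M N) = (\<lambda>k i. Gamma M k i + Gamma N k i)"
    unfolding fg(3,4) met_add_supp[OF fg(1,2)] G[OF cone_add[OF fg(1,2)]] G[OF fg(1)] G[OF fg(2)]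
    by (intro ext) (rule Gam_add)
  show "met_scale T t M \<in> tau_met T B" if t: "0 \<le> t"
    unfolding fg(3) met_scale_supp[OF t] tau_met_eq using cone_scale[OF fg(1) t] by blast
  show "Gamma (met_scale T t M) = (\<lambda>k i. t * Gamma M k i)" if t: "0 \<le> t"
    unfolding fg(3) met_scale_supp[OF t] G[OF cone_scale[OF fg(1) t]] G[OF fg(1)]
    by (intro ext) (rule Gam_scale)
qed

text \<open>Injectivity on the union lets a single inverse \<open>g\<close> serve all cones. On
  \<open>tau T B\<close> it lands in \<open>tau_met T B\<close>, because \<open>Gamma\<close> maps
  the latter onto the former, and there it inherits linearity from \<open>Gamma\<close>.\<close>

lemma Gamma_iso: "pl_iso (met_ops T) (metric_complex T) vec_ops (velocity_fan T) Gamma"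
proof -
  have inj: "M = N" if "M \<in> \<Union>(metric_complex T)" "N \<in> \<Union>(metric_complex T)" "Gamma M = Gamma N" for M N
    using that Gamma_inj unfolding metric_complex_def tau_met_def by blast
  have B: "bing T B" if "B \<in> bracketings T" for B
    using that rpt unfolding bracketings_def by unfold_locales auto
  have sub: "tau_met T B \<subseteq> \<Union>(metric_complex T)" if "B \<in> bracketings T" for B
    using that unfolding metric_complex_def by blast
  define g where "g y = inv_into (\<Union>(metric_complex T)) Gamma y" for y
  have gG: "g (Gamma M) = M" if "M \<in> \<Union>(metric_complex T)" for M
    unfolding g_def using inv_into_f_f[of Gamma "\<Union>(metric_complex T)" M] inj that unfolding inj_on_def by blast
  have fwd: "pl_map (met_ops T) (metric_complex T) vec_ops (velocity_fan T) Gamma"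
    unfolding pl_map_def
  proof
    fix S assume "S \<in> metric_complex T"
    then obtain B where S: "B \<in> bracketings T" "S = tau_met T B" unfolding metric_complex_def by blast
    have "semilinear_on (met_ops T) vec_ops S Gamma"
      unfolding semilinear_on_def met_ops_def vec_ops_def S(2) using tau_met_closed[OF B[OF S(1)]] by simp
    moreover have "tau T B \<in> velocity_fan T" using S unfolding velocity_fan_def by blast
    ultimately show "\<exists>S'\<in>velocity_fan T. Gamma ` S \<subseteq> S' \<and> semilinear_on (met_ops T) vec_ops S Gamma"
      using Gamma_tau_met[OF B[OF S(1)]] S(2) by blast
  qed
  have bwd: "pl_map vec_ops (velocity_fan T) (met_ops T) (metric_complex T) g"
    unfolding pl_map_def
  proof
    fix S assume "S \<in> velocity_fan T"
    then obtain B where S: "B \<in> bracketings T" "S = tau T B" unfolding velocity_fan_def by blast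
    note cl = tau_met_closed[OF B[OF S(1)]]
    have gM: "\<exists>M\<in>tau_met T B. y = Gamma M \<and> g y = M" if "y \<in> S" for y
    proof -
      have "y \<in> Gamma ` tau_met T B" using that Gamma_tau_met[OF B[OF S(1)]] S(2) by simp
      then obtain M where M: "M \<in> tau_met T B" "y = Gamma M" by blast
      then have "g y = M" using gG sub[OF S(1)] by blast
      then show ?thesis using M by blast
    qed
    have "semilinear_on vec_ops (met_ops T) S g"
      unfolding semilinear_on_def
    proof (intro conjI ballI allI impI)
      fix x y assume "x \<in> S" "y \<in> S"
      then obtain M N where MN: "M \<in> tau_met T B" "N \<in> tau_met T B" "x = Gamma M" "y = Gamma N" "g x = M" "g y = N"
        using gM by metis
      have "sadd vec_ops x y = Gamma (met_add T M N)" unfolding vec_ops_def using cl(2)[OF MN(1,2)] MN by simp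
      moreover have "g (Gamma (met_add T M N)) = met_add T M N"
        using gG[OF subsetD[OF sub[OF S(1)] cl(1)[OF MN(1,2)]]] .
      ultimately show "g (sadd vec_ops x y) = sadd (met_ops T) (g x) (g y)"
        using MN unfolding met_ops_def by simp
    next
      fix x and t :: real assume "x \<in> S" and t: "0 \<le> t"
      then obtain M where M: "M \<in> tau_met T B" "x = Gamma M" "g x = M" using gM by metis
      have "sscale vec_ops t x = Gamma (met_scale T t M)" unfolding vec_ops_def using cl(4)[OF M(1,1) t] M by simp
      moreover have "g (Gamma (met_scale T t M)) = met_scale T t M"
        using gG[OF subsetD[OF sub[OF S(1)] cl(3)[OF M(1,1) t]]] .
      ultimately show "g (sscale vec_ops t x) = sscale (met_ops T) t (g x)"
        using M unfolding met_ops_def by simp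
    qed
    moreover have "g ` S \<subseteq> tau_met T B" using gM by blast
    moreover have "tau_met T B \<in> metric_complex T" using S unfolding metric_complex_def by blast
    ultimately show "\<exists>S'\<in>metric_complex T. g ` S \<subseteq> S' \<and> semilinear_on vec_ops (met_ops T) S g" by blast
  qed
  have "Gamma (g y) = y" if y: "y \<in> \<Union>(velocity_fan T)" for y
  proof -
    obtain B where "B \<in> bracketings T" "y \<in> tau T B" using y unfolding velocity_fan_def by blast
    then obtain M where "M \<in> \<Union>(metric_complex T)" "y = Gamma M" using Gamma_tau_met[OF B] sub by blast
    then show ?thesis using gG by simp
  qed
  then show ?thesis unfolding pl_iso_def using fwd bwd gG by blast
qed

lemma Gamma_decomposition:
  assumes M: "M \<in> \<Union>(metric_complex T)" and d: "is_decomposition T M k lam C"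
  shows "Gamma M = (\<lambda>j i. \<Sum>r\<le>k. lam r * rho T (C r) j i)"
proof -
  have "is_metric T M" using M unfolding metric_complex_def tau_met_def by blast
  then have "is_bracketing T (fst M)" unfolding is_metric_def bracketings_def by auto
  then interpret bing T "fst M" by unfold_locales
  show ?thesis unfolding Gamma_def using decomposition_Gam[of "snd M"] d by simp
qed

end

theorem proposition1p2:
  fixes T :: "'a plane_tree"
  assumes "rooted_plane_tree T" and "1 \<le> tree_depth T" and "\<not> is_path_tree T"
  shows "(\<forall>M\<in>\<Union>(metric_complex T). \<exists>k lam C. is_decomposition T M k lam C) \<and>
    (\<exists>\<Gamma> :: 'a metric_bracketing \<Rightarrow> vec.
       (\<forall>M\<in>\<Union>(metric_complex T). \<forall>k lam C. is_decomposition T M k lam C \<longrightarrow>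
          \<Gamma> M = (\<lambda>j i. \<Sum>r\<le>k. lam r * rho T (C r) j i)) \<and>
       pl_iso (met_ops T) (metric_complex T) vec_ops (velocity_fan T) \<Gamma>)"
proof -
  interpret rpt T by unfold_locales (rule assms(1))
  have "\<exists>k lam C. is_decomposition T M k lam C" if "M \<in> \<Union>(metric_complex T)" for M
    using metric_complexE[OF that] bing.ex_decomposition by metis
  then show ?thesis using Gamma_decomposition Gamma_iso by blast
qed

end
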